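(* (a) For integers $2\le m<n-1$, there is an isomorphic copy of $\mathrm{Aut}^0(F_{m,\infty},t_{m-1})$ in $\mathrm{Aut}(B_n(\mathbf{R}))$ that has trivial intersection with $\mathrm{Aut}(A_n(\mathbf{R}))$. (b) For integers $2\le m=n-1$, there is an isomorphic copy of $\mathrm{Aut}^0_{LI}(F_{m,\infty},t_{m-1})$ in $\mathrm{Aut}(B_n(\mathbf{R}))$ that has trivial intersection with $\mathrm{Aut}(A_n(\mathbf{R}))$.
   Context: Functions are written to the right of their arguments and composed from left to right. For an integer $n\ge 2$: $\mathbf{Z}[\frac1n]=\{an^b : a,b\in\mathbf{Z}\}$ and $\langle n\rangle=\{n^k : k\in\mathbf{Z}\}$. A break of a piecewise linear (PL) function is a point where its derivative is discontinuous. $A_n(\mathbf{R})$ is the group of all homeomorphisms $h:\mathbf{R}\to\mathbf{R}$ such that (1) $h$ preserves orientation, (2) $h$ is PL, (3) all slopes of $h$ are in $\langle n\rangle$, (4) the breaks of $h$ lie in a discrete subset of $\mathbf{Z}[\frac1n]$, (5) $(\mathbf{Z}[\frac1n])h=\mathbf{Z}[\frac1n]$. Let $\phi_n:\mathbf{Z}[\frac1n]\to\mathbf{Z}_{n-1}$ be the well-defined surjective ring homomorphism $(an^b)\phi_n=a\pmod{n-1}$. There is a well-defined homomorphism $\rho_n:A_n(\mathbf{R})\to\mathbf{Z}_{n-1}$, $f\rho_n=(xf)\phi_n-x\phi_n$ for any $x\in\mathbf{Z}[\frac1n]$, and $B_n(\mathbf{R})=\ker\rho_n$. For real $r$, $t_r$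 is the translation $xt_r=x+r$. For integers $i$, $g_{n,i}$ is the homeomorphism of $\mathbf{R}$ with $xg_{n,i}=x$ for $x<i$, $xg_{n,i}=n(x-i)+i$ for $i\le x\le i+1$, $xg_{n,i}=x+n-1$ for $x>i+1$. $F_{n,\infty}$ is the subgroup of $B_n(\mathbf{R})$ generated by $t_{n-1}$ and all $g_{n,i}$, $i\in\mathbf{Z}$. For $G$ equal to $A_n(\mathbf{R})$, $B_n(\mathbf{R})$ or $F_{n,\infty}$, every automorphism of $G$ is conjugation $f\mapsto h^{-1}fh$ by a unique self homeomorphism $h$ of $\mathbf{R}$, so $\mathrm{Aut}(G)$ is identified with the normalizer of $G$ in $\mathrm{Homeo}(\mathbf{R})$; under this identification $\mathrm{Aut}(A_n(\mathbf{R}))\subseteq\mathrm{Aut}(B_n(\mathbf{R}))$. $\mathrm{Aut}^0(F_{n,\infty},t_{n-1})$ is the group of automorphisms of $F_{n,\infty}$ whose homeomorphism $h$ commutes with $t_{n-1}$ and fixes $0$. $C^0(B_n(\mathbf{R}),t_{n-1})$ is the group of elements of $B_n(\mathbf{R})$ that commute with $t_{n-1}$ and fix $0$. An $\alpha\in\mathrm{Aut}^0(F_{n,\infty},t_{n-1})$ is locally inner if for every $i\in\mathbf{Z}$ there is $w\in C^0(B_n(\mathbf{R}),t_{n-1})$ (depending on $i$) with $g_{n,i}\alpha=w^{-1}g_{n,i}w$. $\mathrm{Aut}^0_{LI}(F_{n,\infty},t_{n-1})$ is the subgroup of locally inner elements of $\mathrm{Aut}^0(F_{n,\infty},t_{n-1})$.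 *)

theory Defs
  imports
    "HOL-Analysis.Analysis"
    "HOL-Algebra.Bij"
    "HOL-Algebra.Generated_Groups"
    "HOL-Algebra.Elementary_Groups"
begin

section \<open>Homeomorphisms of the line\<close>

definition homeos :: "(real \<Rightarrow> real) set" where
  "homeos = {h. \<exists>k. homeomorphism UNIV UNIV h k}"

text \<open>Functions act on the right: the product of \<open>f\<close> and \<open>g\<close> is ``first \<open>f\<close>, then \<open>g\<close>''.\<close>

definition homeo_group :: "(real \<Rightarrow> real) monoid" where
  "homeo_group = \<lparr>carrier = homeos, mult = (\<lambda>f g x. g (f x)), one = (\<lambda>x. x)\<rparr>"

abbreviation homeo_subgroup :: "(real \<Rightarrow> real) set \<Rightarrow> (real \<Rightarrow> real) monoid" where
  "homeo_subgroup G \<equiv> homeo_group\<lparr>carrier := G\<rparr>"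

definition conj_by :: "(real \<Rightarrow> real) \<Rightarrow> (real \<Rightarrow> real) \<Rightarrow> (real \<Rightarrow> real)" where
  "conj_by h f = inv\<^bsub>homeo_group\<^esub> h \<otimes>\<^bsub>homeo_group\<^esub> f \<otimes>\<^bsub>homeo_group\<^esub> h"


section \<open>The groups \<open>A\<^sub>n(\<real>)\<close> and \<open>B\<^sub>n(\<real>)\<close>\<close>

definition nadic :: "nat \<Rightarrow> real set" where
  "nadic n = {of_int a * real n powi b | a b. True}"

definition npowers :: "nat \<Rightarrow> real set" where
  "npowers n = {real n powi k | k. True}"

text \<open>Being affine on both sides of every point makes the pieces locally finite; infinitely many
  pieces are allowed.\<close>

definition piecewise_linear :: "(real \<Rightarrow> real) \<Rightarrow> bool" where
  "piecewise_linear f \<longleftrightarrow>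
     (\<forall>x. \<exists>e>0. \<exists>p q. (\<forall>y\<in>{x - e..x}. f y = f x + p * (y - x)) \<and>
                     (\<forall>y\<in>{x..x + e}. f y = f x + q * (y - x)))"

definition breaks :: "(real \<Rightarrow> real) \<Rightarrow> real set" where
  "breaks f = {x. \<not> (f differentiable (at x) \<and> isCont (deriv f) x)}"

definition slopes :: "(real \<Rightarrow> real) \<Rightarrow> real set" where
  "slopes f = {d. \<exists>x. (f has_real_derivative d) (at x)}"

definition A_R :: "nat \<Rightarrow> (real \<Rightarrow> real) set" where
  "A_R n = {h \<in> homeos. strict_mono h \<and> piecewise_linear h \<and> slopes h \<subseteq> npowers n \<and>
            (\<exists>D. discrete D \<and> D \<subseteq> nadic n \<and> breaks h \<subseteq> D) \<and>
            h ` nadic n = nadic n}"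

text \<open>Elements of \<open>\<int>\<^bsub>n-1\<^esub>\<close> are represented by their residues in \<open>{0..<n - 1}\<close>, as in
  \<^const>\<open>integer_mod_group\<close>.\<close>

definition phi :: "nat \<Rightarrow> real \<Rightarrow> int" where
  "phi n x = (THE r. \<exists>a b. x = of_int a * real n powi b \<and> r = a mod (int n - 1))"

definition rho :: "nat \<Rightarrow> (real \<Rightarrow> real) \<Rightarrow> int" where
  "rho n f = (THE r. \<forall>x\<in>nadic n. r = (phi n (f x) - phi n x) mod (int n - 1))"

definition B_R :: "nat \<Rightarrow> (real \<Rightarrow> real) set" where
  "B_R n = kernel (homeo_subgroup (A_R n)) (integer_mod_group (n - 1)) (rho n)"


section \<open>The group \<open>F\<^bsub>n,\<infinity>\<^esub>\<close>\<close>

definition transl :: "real \<Rightarrow> real \<Rightarrow> real" where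
  "transl r x = x + r"

definition pl_gen :: "nat \<Rightarrow> int \<Rightarrow> real \<Rightarrow> real" where
  "pl_gen n i x = (if x < of_int i then x
                   else if x \<le> of_int i + 1 then real n * (x - of_int i) + of_int i
                   else x + real n - 1)"

definition F_inf :: "nat \<Rightarrow> (real \<Rightarrow> real) set" where
  "F_inf n = generate (homeo_subgroup (B_R n)) (insert (transl (real n - 1)) (range (pl_gen n)))"


section \<open>Automorphism groups\<close>

text \<open>\<^const>\<open>AutoGroup\<close> composes automorphisms right to left, the opposite of the convention above.
  All automorphism groups below use this same product, so this does not affect subgroups,
  intersections or isomorphism between them.\<close>

abbreviation Aut :: "(real \<Rightarrow> real) set \<Rightarrow> ((real \<Rightarrow> real) \<Rightarrow> (real \<Rightarrow> real)) monoid" where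
  "Aut G \<equiv> AutoGroup (homeo_subgroup G)"

definition implements ::
    "(real \<Rightarrow> real) \<Rightarrow> (real \<Rightarrow> real) set \<Rightarrow> ((real \<Rightarrow> real) \<Rightarrow> (real \<Rightarrow> real)) \<Rightarrow> bool" where
  "implements h G \<alpha> \<longleftrightarrow> h \<in> homeos \<and> (\<forall>f\<in>G. \<alpha> f = conj_by h f)"

text \<open>An automorphism of \<open>G\<close> and an automorphism of \<open>K\<close> are identified when the same homeomorphism
  implements both. \<open>Aut_in G K\<close> is the copy of \<open>Aut G\<close> found inside \<open>Aut K\<close> in this way.\<close>

definition Aut_in ::
    "(real \<Rightarrow> real) set \<Rightarrow> (real \<Rightarrow> real) set \<Rightarrow> ((real \<Rightarrow> real) \<Rightarrow> (real \<Rightarrow> real)) set" where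
  "Aut_in G K = {\<alpha> \<in> carrier (Aut K).
     \<exists>\<beta>\<in>carrier (Aut G). \<exists>h. implements h G \<beta> \<and> implements h K \<alpha>}"

definition Aut0 :: "nat \<Rightarrow> ((real \<Rightarrow> real) \<Rightarrow> (real \<Rightarrow> real)) set" where
  "Aut0 n = {\<alpha> \<in> carrier (Aut (F_inf n)).
     \<exists>h. implements h (F_inf n) \<alpha> \<and>
         h \<otimes>\<^bsub>homeo_group\<^esub> transl (real n - 1) = transl (real n - 1) \<otimes>\<^bsub>homeo_group\<^esub> h \<and>
         h 0 = 0}"

definition C0 :: "nat \<Rightarrow> (real \<Rightarrow> real) set" where
  "C0 n = {w \<in> B_R n.
     w \<otimes>\<^bsub>homeo_group\<^esub> transl (real n - 1) = transl (real n - 1) \<otimes>\<^bsub>homeo_group\<^esub> w \<and> w 0 = 0}"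

definition locally_inner :: "nat \<Rightarrow> ((real \<Rightarrow> real) \<Rightarrow> (real \<Rightarrow> real)) \<Rightarrow> bool" where
  "locally_inner n \<alpha> \<longleftrightarrow> (\<forall>i. \<exists>w\<in>C0 n. \<alpha> (pl_gen n i) = conj_by w (pl_gen n i))"

abbreviation Aut0_group :: "nat \<Rightarrow> ((real \<Rightarrow> real) \<Rightarrow> (real \<Rightarrow> real)) monoid" where
  "Aut0_group n \<equiv> (Aut (F_inf n))\<lparr>carrier := Aut0 n\<rparr>"

abbreviation Aut0_LI_group :: "nat \<Rightarrow> ((real \<Rightarrow> real) \<Rightarrow> (real \<Rightarrow> real)) monoid" where
  "Aut0_LI_group n \<equiv> (Aut (F_inf n))\<lparr>carrier := {\<alpha> \<in> Aut0 n. locally_inner n \<alpha>}\<rparr>"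

end

theory Submission
  imports Defs
begin


text \<open>
  Both parts come from one construction, which works for \<open>2 \<le> m < n\<close>. It turns a homeomorphism
  \<open>h\<close> of the line that normalizes \<open>F\<^bsub>m,\<infinity>\<^esub>\<close>, commutes with \<open>t\<^bsub>m-1\<^esub>\<close> and fixes \<open>0\<close> into a homeomorphism
  \<open>hat h\<close> that normalizes \<open>B\<^sub>n(\<real>)\<close>, in such a way that \<open>hat (h \<circ> k) = hat h \<circ> hat k\<close>.

  The unit interval \<open>[i, i + 1]\<close> is divided by the expansion \<open>g\<^bsub>n,i\<^esub>\<close> into \<open>n\<close> pieces that correspond
  to the unit intervals \<open>[i, i + 1], \<dots>, [i + n - 1, i + n]\<close>, and for \<open>F\<^bsub>n,\<infinity>\<^esub>\<close> unit intervals differ only by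
  the residue of \<open>i\<close> modulo \<open>n - 1\<close>. Call the residues \<open>0, \<dots>, m - 2\<close> active and the other \<open>n - m\<close> of them
  inactive. If the inactive intervals are collapsed, then the rule for dividing active intervals
  becomes the rule for dividing unit intervals by \<open>m\<close>. Conversely the line with its \<open>n\<close>-adic
  subdivision arises from the line with its \<open>m\<close>-adic subdivision by inserting to the left of every point
  \<open>p\<close> of the orbit of \<open>0\<close> under \<open>F\<^bsub>m,\<infinity>\<^esub>\<close>, that is of the ideal \<open>(m - 1)\<int>[1/m]\<close>, a gap. The gaps are scaled
  copies of \<open>[m - n, 0]\<close>, and \<open>gap_point p v\<close> is the point of the gap at \<open>p\<close> that corresponds to
  \<open>v \<in> [m - n, 0]\<close>. Every \<open>f \<in> F\<^bsub>m,\<infinity>\<^esub>\<close> has a lift in \<open>F\<^bsub>n,\<infinity>\<^esub>\<close> that maps \<open>gap_point p v\<close> to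
  \<open>gap_point (f p) v\<close> (\<open>lift_exists\<close>). The homeomorphism \<open>h\<close> preserves the orbit of \<open>0\<close>, so it
  permutes the gaps, and \<open>hat h\<close> sends \<open>gap_point p v\<close> to \<open>gap_point (h p) (hat h v)\<close>. Inside the gap at \<open>0\<close>,
  \<open>hat h\<close> is defined recursively: on the inactive interval \<open>[q, q + 1]\<close> it is the copy, reduced by the factor
  \<open>n\<close>, of its own restriction to \<open>[q, q + n]\<close>. On the orbit of \<open>0\<close> under \<open>F\<^bsub>n,\<infinity>\<^esub>\<close> this recursion stops, and
  \<open>hat h\<close> is the extension to the line by monotonicity. Conjugation by \<open>hat h\<close> takes the lift of \<open>f\<close> to the
  lift of the conjugate of \<open>f\<close> by \<open>h\<close> and fixes the generators with inactive index
  (\<open>hat_preserves_F_inf\<close>). Since \<open>B\<^sub>n(\<real>)\<close> consists of the homeomorphisms that agree near every point with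
  an element of \<open>F\<^bsub>n,\<infinity>\<^esub>\<close> (\<open>B_R_locally_F_inf\<close>), \<open>hat h\<close> normalizes \<open>B\<^sub>n(\<real>)\<close> as well.

  An automorphism of \<open>A\<^sub>n(\<real>)\<close> that agrees on \<open>B\<^sub>n(\<real>)\<close> with conjugation by \<open>hat h\<close> is itself conjugation by
  \<open>hat h\<close>, as the centralizer of \<open>F\<^bsub>n,\<infinity>\<^esub>\<close> is trivial (\<open>centralizer_F_inf\<close>). Then \<open>hat h\<close> conjugates the
  translations by integers to piecewise linear maps, so its germs to the right of different integers
  are the same up to affine maps. Comparing self-similar inactive intervals with active ones, \<open>hat_rigid\<close>
  deduces that \<open>hat h\<close> is the identity.

  The same argument applies to any subgroup of \<open>Aut\<^sup>0(F\<^bsub>m,\<infinity>\<^esub>, t\<^bsub>m-1\<^esub>)\<close> (\<open>exotic_subgroup\<close>), in particular to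
  the locally inner automorphisms.
\<close>


section \<open>Homeomorphisms of the line\<close>

abbreviation finv :: "(real \<Rightarrow> real) \<Rightarrow> (real \<Rightarrow> real)" where
  "finv \<equiv> inv_into UNIV"

lemma homeos_iff:
  "h \<in> homeos \<longleftrightarrow> bij h \<and> continuous_on UNIV h \<and> continuous_on UNIV (finv h)"
proof
  assume "h \<in> homeos"
  then obtain k where k: "homeomorphism UNIV UNIV h k"
    by (auto simp: homeos_def)
  then have kh: "k (h x) = x" and hk: "h (k x) = x" for x
    by (auto simp: homeomorphism_def)
  then have b: "bij h"
    by (metis bijI')
  have "finv h = k"
    by (metis b bij_inv_eq_iff hk ext)
  with k b show "bij h \<and> continuous_on UNIV h \<and> continuous_on UNIV (finv h)"
    by (auto simp: homeomorphism_def)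
next
  assume "bij h \<and> continuous_on UNIV h \<and> continuous_on UNIV (finv h)"
  then show "h \<in> homeos"
    unfolding homeos_def homeomorphism_def
    by (auto simp: bij_is_inj bij_is_surj surj_f_inv_f intro!: exI[of _ "finv h"])
       (metis bij_is_inj inv_f_f rangeI)
qed

lemma homeos_bij: "h \<in> homeos \<Longrightarrow> bij h"
  by (simp add: homeos_iff)

lemma homeos_inv_apply [simp]: "h \<in> homeos \<Longrightarrow> finv h (h x) = x"
  by (simp add: homeos_bij bij_is_inj)

lemma homeos_apply_inv [simp]: "h \<in> homeos \<Longrightarrow> h (finv h x) = x"
  by (simp add: homeos_bij bij_is_surj surj_f_inv_f)

lemma homeos_isCont: "h \<in> homeos \<Longrightarrow> isCont h x"
  by (simp add: homeos_iff continuous_on_eq_continuous_at)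

lemma homeos_filterlim: "h \<in> homeos \<Longrightarrow> filterlim h (nhds (h x)) (nhds x)"
  using homeos_isCont[of h x] by (simp add: isCont_def tendsto_at_iff_tendsto_nhds)

lemma homeos_inv: "h \<in> homeos \<Longrightarrow> finv h \<in> homeos"
  by (simp add: homeos_iff bij_imp_bij_inv inv_inv_eq)

lemma homeos_inv_inv [simp]: "h \<in> homeos \<Longrightarrow> finv (finv h) = h"
  by (simp add: homeos_bij inv_inv_eq)

lemma homeos_comp: "f \<in> homeos \<Longrightarrow> g \<in> homeos \<Longrightarrow> g \<circ> f \<in> homeos"
proof -
  assume f: "f \<in> homeos" and g: "g \<in> homeos"
  then have "finv (g \<circ> f) = finv f \<circ> finv g"
    by (intro o_inv_distrib) (auto simp: homeos_bij)
  moreover have "continuous_on UNIV (g \<circ> f)" "continuous_on UNIV (finv f \<circ> finv g)"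
    using f g by (auto simp: homeos_iff simp del: o_apply
        intro!: continuous_on_compose elim: continuous_on_subset)
  ultimately show ?thesis
    using f g by (simp add: homeos_iff bij_comp)
qed

lemma homeos_id: "id \<in> homeos"
  by (simp add: homeos_iff)

lemma strict_mono_surj_homeos:
  fixes f :: "real \<Rightarrow> real"
  assumes "strict_mono f" "surj f"
  shows "f \<in> homeos"
proof -
  have b: "bij f"
    using assms by (simp add: bij_def strict_mono_imp_inj_on)
  have "mono (finv f)"
  proof (rule monoI)
    fix x y :: real assume "x \<le> y"
    then have "f (finv f x) \<le> f (finv f y)"
      using assms(2) by (simp add: surj_f_inv_f)
    then show "finv f x \<le> finv f y"
      using assms(1) by (simp add: strict_mono_less_eq)
  qed
  then have "continuous_on UNIV (finv f)"
    by (intro continuous_onI_mono) (auto simp: b bij_imp_bij_inv bij_is_surj monoD)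
  moreover have "continuous_on UNIV f"
    using assms by (intro continuous_onI_mono) (auto simp: strict_mono_less_eq)
  ultimately show ?thesis
    by (simp add: homeos_iff b)
qed

lemma homeos_mono_or_antimono:
  assumes "h \<in> homeos"
  shows "strict_mono h \<or> strict_antimono_on UNIV h"
proof -
  have "inj_on h UNIV \<longleftrightarrow> strict_mono_on UNIV h \<or> strict_antimono_on UNIV h"
    using assms by (intro injective_eq_monotone_map) (auto simp: homeos_iff)
  then show ?thesis
    using assms by (simp add: homeos_bij bij_is_inj)
qed

text \<open>A homeomorphism commuting with a translation cannot reverse the orientation, since it carries
  the pair \<open>x < x + c\<close> to a pair with the same difference.\<close>

lemma homeos_commute_translation_mono:
  assumes "h \<in> homeos" "c > 0" "\<And>x. h (x + c) = h x + c"
  shows "strict_mono h"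
proof (rule ccontr)
  assume "\<not> strict_mono h"
  then have "strict_antimono_on UNIV h"
    using homeos_mono_or_antimono assms by blast
  then have "h (0 + c) < h 0"
    using \<open>c > 0\<close> by (simp add: monotone_on_def)
  then show False
    using assms(2) assms(3)[of 0] by simp
qed

lemma homeos_eq_on_dense:
  assumes "f \<in> homeos" "g \<in> homeos" "closure D = UNIV" "\<And>x. x \<in> D \<Longrightarrow> f x = g x"
  shows "f = g"
proof
  fix x
  have "closed {x. f x = g x}"
    using assms(1,2) by (intro closed_Collect_eq) (auto simp: homeos_iff)
  then have "closure D \<subseteq> {x. f x = g x}"
    using assms(4) by (intro closure_minimal) auto
  then show "f x = g x"
    using assms(3) by auto
qed

lemma group_homeo_group: "group homeo_group"
proof (rule groupI)
  fix x assume "x \<in> carrier homeo_group"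
  then show "\<exists>y\<in>carrier homeo_group. y \<otimes>\<^bsub>homeo_group\<^esub> x = \<one>\<^bsub>homeo_group\<^esub>"
    by (auto simp: homeo_group_def intro!: bexI[of _ "finv x"] homeos_inv)
next
  show "\<one>\<^bsub>homeo_group\<^esub> \<in> carrier homeo_group"
    using homeos_id by (simp add: homeo_group_def id_def)
next
  fix x y assume "x \<in> carrier homeo_group" "y \<in> carrier homeo_group"
  then show "x \<otimes>\<^bsub>homeo_group\<^esub> y \<in> carrier homeo_group"
    using homeos_comp by (simp add: homeo_group_def comp_def)
qed (auto simp: homeo_group_def)

interpretation homeo: group homeo_group
  by (rule group_homeo_group)

lemma carrier_homeo_group [simp]: "carrier homeo_group = homeos"
  by (simp add: homeo_group_def)

lemma mult_homeo_group [simp]: "f \<otimes>\<^bsub>homeo_group\<^esub> g = g \<circ> f"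
  by (auto simp: homeo_group_def)

lemma one_homeo_group [simp]: "\<one>\<^bsub>homeo_group\<^esub> = id"
  by (auto simp: homeo_group_def)

lemma inv_homeo_group [simp]: "h \<in> homeos \<Longrightarrow> inv\<^bsub>homeo_group\<^esub> h = finv h"
  by (rule homeo.inv_equality) (auto simp: homeos_inv)

lemma conj_by_eq: "h \<in> homeos \<Longrightarrow> conj_by h f = h \<circ> f \<circ> finv h"
  by (auto simp: conj_by_def)

lemma conj_by_homeos: "h \<in> homeos \<Longrightarrow> f \<in> homeos \<Longrightarrow> conj_by h f \<in> homeos"
  by (simp add: conj_by_eq homeos_comp homeos_inv)

lemma conj_by_comp:
  "h \<in> homeos \<Longrightarrow> k \<in> homeos \<Longrightarrow> conj_by h (conj_by k f) = conj_by (h \<circ> k) f"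
  by (simp add: conj_by_eq homeos_comp o_inv_distrib homeos_bij o_assoc)

lemma conj_by_id [simp]: "conj_by id f = f"
  by (simp add: conj_by_eq homeos_id)

lemma conj_by_inv_cancel [simp]:
  "h \<in> homeos \<Longrightarrow> conj_by (finv h) (conj_by h f) = f"
  "h \<in> homeos \<Longrightarrow> conj_by h (conj_by (finv h) f) = f"
  by (auto simp: conj_by_eq homeos_inv)

lemma conj_by_mult:
  "h \<in> homeos \<Longrightarrow> conj_by h (f \<circ> g) = conj_by h f \<circ> conj_by h g"
  by (auto simp: conj_by_eq)

lemma conj_by_inv:
  "h \<in> homeos \<Longrightarrow> f \<in> homeos \<Longrightarrow> conj_by h (finv f) = finv (conj_by h f)"
  by (simp add: conj_by_eq homeos_comp homeos_inv o_inv_distrib homeos_bij bij_comp bij_imp_bij_inv o_assoc)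

lemma conj_by_eqI:
  "h \<in> homeos \<Longrightarrow> h \<circ> f = g \<circ> h \<Longrightarrow> conj_by h f = g"
  by (auto simp: conj_by_eq fun_eq_iff)

lemma conj_by_apply: "h \<in> homeos \<Longrightarrow> conj_by h f (h x) = h (f x)"
  by (simp add: conj_by_eq)

text \<open>The product of \<^const>\<open>homeo_group\<close> is composition in the opposite order. For closure
  conditions the order is irrelevant, and the next two lemmas hide it.\<close>

lemma homeo_subgroupI:
  assumes "G \<subseteq> homeos" "id \<in> G" "\<And>f g. f \<in> G \<Longrightarrow> g \<in> G \<Longrightarrow> g \<circ> f \<in> G" "\<And>f. f \<in> G \<Longrightarrow> finv f \<in> G"
  shows "subgroup G homeo_group"
  using assms by (intro homeo.subgroupI) auto

lemma homeo_subgroupD: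
  assumes "subgroup G homeo_group"
  shows "G \<subseteq> homeos" "id \<in> G" "\<And>f g. f \<in> G \<Longrightarrow> g \<in> G \<Longrightarrow> g \<circ> f \<in> G" "\<And>f. f \<in> G \<Longrightarrow> finv f \<in> G"
proof -
  show 1: "G \<subseteq> homeos"
    using subgroup.subset[OF assms] by simp
  show "id \<in> G"
    using subgroup.one_closed[OF assms] by simp
  show "g \<circ> f \<in> G" if "f \<in> G" "g \<in> G" for f g
    using subgroup.m_closed[OF assms that] by simp
  show "finv f \<in> G" if "f \<in> G" for f
    using subgroup.m_inv_closed[OF assms that] 1 that by auto
qed

section \<open>The ring of \<open>n\<close>-adic fractions and its ideal generated by \<open>n - 1\<close>\<close>

lemma nadic_iff_scaled:
  assumes "n \<ge> 1"
  shows "x \<in> nadic n \<longleftrightarrow> (\<exists>k::nat. x * real n ^ k \<in> \<int>)"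
proof
  assume "x \<in> nadic n"
  then obtain a b where x: "x = of_int a * real n powi b"
    by (auto simp: nadic_def)
  define k where "k = nat \<bar>b\<bar>"
  have "x * real n ^ k = of_int a * real n powi (b + int k)"
    using assms by (simp add: x power_int_add)
  also have "b + int k = int (nat (b + int k))"
    by (simp add: k_def)
  also have "real_of_int a * real n powi int (nat (b + int k)) = of_int (a * int n ^ nat (b + int k))"
    by (simp only: power_int_of_nat of_int_mult of_int_power of_int_of_nat_eq)
  finally show "\<exists>k::nat. x * real n ^ k \<in> \<int>"
    by (metis Ints_of_int)
next
  assume "\<exists>k::nat. x * real n ^ k \<in> \<int>"
  then obtain k :: nat and a where a: "x * real n ^ k = of_int a"
    by (auto elim: Ints_cases)
  then have "x = of_int a * real n powi (- int k)"
    using assms by (simp add: power_int_minus field_simps)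
  then show "x \<in> nadic n"
    unfolding nadic_def by blast
qed

lemma nadic_of_int [simp]: "of_int a \<in> nadic n"
  unfolding nadic_def by (rule CollectI, rule exI[of _ a], rule exI[of _ 0]) simp

lemma nadic_add:
  assumes "n \<ge> 1" "x \<in> nadic n" "y \<in> nadic n"
  shows "x + y \<in> nadic n"
proof -
  obtain k l where "x * real n ^ k \<in> \<int>" "y * real n ^ l \<in> \<int>"
    using assms nadic_iff_scaled by blast
  then have "(x * real n ^ k) * of_int (int n ^ l) + (y * real n ^ l) * of_int (int n ^ k) \<in> \<int>"
    by (metis Ints_add Ints_mult Ints_of_int)
  then have "(x + y) * real n ^ (k + l) \<in> \<int>"
    by (simp add: power_add algebra_simps)
  then show ?thesis
    using assms nadic_iff_scaled by blast
qed

lemma nadic_mult: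
  assumes "n \<ge> 1" "x \<in> nadic n" "y \<in> nadic n"
  shows "x * y \<in> nadic n"
proof -
  obtain k l where "x * real n ^ k \<in> \<int>" "y * real n ^ l \<in> \<int>"
    using assms nadic_iff_scaled by blast
  then have "(x * real n ^ k) * (y * real n ^ l) \<in> \<int>"
    by (rule Ints_mult)
  then have "(x * y) * real n ^ (k + l) \<in> \<int>"
    by (simp add: power_add algebra_simps)
  then show ?thesis
    using assms nadic_iff_scaled by blast
qed

lemma nadic_powi [simp]: "real n powi k \<in> nadic n"
  unfolding nadic_def by (rule CollectI, rule exI[of _ 1], rule exI[of _ k]) simp

lemma nadic_uminus: "n \<ge> 1 \<Longrightarrow> x \<in> nadic n \<Longrightarrow> - x \<in> nadic n"
  using nadic_mult[OF _ _ nadic_of_int[of "-1" n], of x] by simp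

lemma nadic_diff: "n \<ge> 1 \<Longrightarrow> x \<in> nadic n \<Longrightarrow> y \<in> nadic n \<Longrightarrow> x - y \<in> nadic n"
  using nadic_add[of n x "-y"] nadic_uminus[of n y] by simp

text \<open>The ideal generated by \<open>n - 1\<close>, which is the kernel of \<open>\<phi>\<^sub>n\<close>.\<close>

definition znadic :: "nat \<Rightarrow> real set" where
  "znadic n = {(real n - 1) * z | z. z \<in> nadic n}"

lemma znadic_nadic: "n \<ge> 1 \<Longrightarrow> x \<in> znadic n \<Longrightarrow> x \<in> nadic n"
  using nadic_mult[of n "real n - 1"] nadic_of_int[of "int n - 1" n] by (auto simp: znadic_def)

lemma znadicI: "z \<in> nadic n \<Longrightarrow> x = (real n - 1) * z \<Longrightarrow> x \<in> znadic n"
  by (auto simp: znadic_def)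

lemma znadicE:
  assumes "x \<in> znadic n"
  obtains z where "z \<in> nadic n" "x = (real n - 1) * z"
  using assms by (auto simp: znadic_def)

lemma znadic_add:
  assumes "n \<ge> 1" "x \<in> znadic n" "y \<in> znadic n"
  shows "x + y \<in> znadic n"
proof -
  obtain z w where "z \<in> nadic n" "x = (real n - 1) * z" "w \<in> nadic n" "y = (real n - 1) * w"
    using assms by (metis znadicE)
  then show ?thesis
    using assms(1) by (intro znadicI[of "z + w"] nadic_add) (auto simp: algebra_simps)
qed

lemma znadic_mult:
  assumes "n \<ge> 1" "x \<in> nadic n" "y \<in> znadic n"
  shows "x * y \<in> znadic n"
proof -
  obtain w where "w \<in> nadic n" "y = (real n - 1) * w"
    using assms by (metis znadicE)
  then show ?thesis
    using assms by (intro znadicI[of "x * w"] nadic_mult) auto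
qed

lemma znadic_uminus: "n \<ge> 1 \<Longrightarrow> x \<in> znadic n \<Longrightarrow> - x \<in> znadic n"
  using znadic_mult[OF _ nadic_of_int[of "-1" n], of x] by simp

lemma znadic_diff: "n \<ge> 1 \<Longrightarrow> x \<in> znadic n \<Longrightarrow> y \<in> znadic n \<Longrightarrow> x - y \<in> znadic n"
  using znadic_add[of n x "-y"] znadic_uminus[of n y] by simp

lemma znadic_0 [simp]: "0 \<in> znadic n"
  unfolding znadic_def using nadic_of_int[of 0 n] by force

lemma znadic_mult_int: "(real n - 1) * of_int a \<in> znadic n"
  unfolding znadic_def by auto

text \<open>Powers of \<open>n\<close> are congruent to \<open>1\<close>; hence an affine map whose slope is a power of \<open>n\<close> preserves
  congruence of differences.\<close>

lemma znadic_powi_minus_1: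
  assumes "n \<ge> 2"
  shows "real n powi k - 1 \<in> znadic n"
proof -
  have pos: "real n ^ j - 1 \<in> znadic n" for j
  proof (induction j)
    case (Suc j)
    have "real n * (real n ^ j - 1) + (real n - 1) * of_int 1 \<in> znadic n"
      using assms Suc nadic_of_int[of "int n" n]
      by (intro znadic_add znadic_mult znadic_mult_int) auto
    then show ?case
      by (simp add: algebra_simps)
  qed simp
  show ?thesis
  proof (cases "k \<ge> 0")
    case True
    then show ?thesis
      using pos[of "nat k"] by (simp add: power_int_def)
  next
    case False
    have "- (real n powi k * (real n ^ nat (-k) - 1)) \<in> znadic n"
      using assms pos by (intro znadic_uminus znadic_mult) auto
    also have "- (real n powi k * (real n ^ nat (-k) - 1)) = real n powi k - 1"
      using False assms by (simp add: power_int_def field_simps)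
    finally show ?thesis .
  qed
qed

lemma znadic_scale_iff:
  assumes "n \<ge> 2"
  shows "real n powi k * x \<in> znadic n \<longleftrightarrow> x \<in> znadic n"
proof
  assume "real n powi k * x \<in> znadic n"
  then have "real n powi (-k) * (real n powi k * x) \<in> znadic n"
    using assms by (simp add: znadic_mult[OF _ nadic_powi])
  moreover have "real n powi (-k) * (real n powi k * x) = x"
    using assms by (simp add: power_int_minus field_simps)
  ultimately show "x \<in> znadic n"
    by simp
qed (use assms in \<open>auto intro!: znadic_mult\<close>)

lemma znadic_scale_diff:
  assumes "n \<ge> 2" "x \<in> nadic n"
  shows "real n powi k * x - x \<in> znadic n"
proof -
  have "x * (real n powi k - 1) \<in> znadic n"
    using assms by (intro znadic_mult znadic_powi_minus_1) auto
  then show ?thesis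
    by (simp add: algebra_simps)
qed

lemma znadic_of_int_iff:
  assumes "n \<ge> 2"
  shows "of_int a \<in> znadic n \<longleftrightarrow> (int n - 1) dvd a"
proof
  assume "of_int a \<in> znadic n"
  then obtain z where z: "z \<in> nadic n" "of_int a = (real n - 1) * z"
    by (auto simp: znadic_def)
  obtain k c where c: "z * real n ^ k = of_int c"
    using z assms nadic_iff_scaled[of n z] by (auto elim: Ints_cases)
  have "of_int (a * int n ^ k) = (of_int ((int n - 1) * c) :: real)"
    using z(2) c by simp
  then have "a * int n ^ k = (int n - 1) * c"
    by (simp only: of_int_eq_iff)
  moreover have "coprime (int n - 1) (int n ^ k)"
    using coprime_diff_one_left by (intro coprime_power_right_iff[THEN iffD2] disjI1) auto
  ultimately show "(int n - 1) dvd a"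
    by (metis coprime_dvd_mult_left_iff dvd_triv_left)
next
  assume "(int n - 1) dvd a"
  then show "of_int a \<in> znadic n"
    using znadic_mult_int[of n] by (auto elim!: dvdE)
qed

lemma dense_znadic:
  assumes "n \<ge> 2" "a < b"
  shows "\<exists>x\<in>znadic n. a < x \<and> x < b"
proof -
  obtain k where k: "(1 / real n) ^ k < (b - a) / real n"
    using assms real_arch_pow_inv[of "(b - a) / real n" "1 / real n"] by auto
  define c where "c = (real n - 1) / real n ^ k"
  have c: "c > 0" "c < b - a"
  proof -
    show "c > 0" using assms by (simp add: c_def)
    have "c \<le> real n * (1 / real n) ^ k"
      using assms by (simp add: c_def power_divide divide_right_mono)
    also have "\<dots> < b - a"
      using k assms by (simp add: field_simps)
    finally show "c < b - a" .
  qed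
  define j where "j = \<lfloor>a / c\<rfloor> + 1"
  have "of_int j > a / c" "of_int j \<le> a / c + 1"
    by (auto simp: j_def)
  then have "a < of_int j * c" "of_int j * c \<le> a + c"
    using c by (auto simp: field_simps)
  moreover have "of_int j * c \<in> znadic n"
  proof -
    have "of_int j * c = (real n powi (- int k)) * ((real n - 1) * of_int j)"
      using assms by (simp add: c_def power_int_minus field_simps)
    then show ?thesis
      using assms by (simp only: znadic_scale_iff znadic_mult_int)
  qed
  ultimately show ?thesis
    using c by force
qed

lemma closure_eq_UNIV_real:
  assumes "\<And>a b :: real. a < b \<Longrightarrow> \<exists>x\<in>D. a < x \<and> x < b"
  shows "closure D = UNIV"
  unfolding closure_approachable set_eq_iff
proof (clarsimp)
  fix x e :: real assume "e > 0"
  then show "\<exists>y\<in>D. dist y x < e"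
    using assms[of x "x + e"] by (force simp: dist_real_def)
qed

lemma closure_znadic: "n \<ge> 2 \<Longrightarrow> closure (znadic n) = UNIV"
  by (intro closure_eq_UNIV_real dense_znadic)

lemma phi_eq_iff:
  assumes n: "n \<ge> 2" and x: "x \<in> nadic n"
  shows "phi n x = r \<longleftrightarrow> r \<in> {0..<int n - 1} \<and> x - of_int r \<in> znadic n"
proof -
  have repr: "of_int a * real n powi b - of_int (a mod (int n - 1)) \<in> znadic n" for a b
  proof -
    have "(real n powi b * of_int a - of_int a) + of_int (a - a mod (int n - 1)) \<in> znadic n"
      using n znadic_of_int_iff[OF n]
      by (intro znadic_add znadic_scale_diff)
        (auto simp del: of_int_diff of_int_mult simp: minus_mod_eq_mult_div)
    then show ?thesis
      by (simp add: algebra_simps)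
  qed
  have uniq: "r = r'" if "r \<in> {0..<int n - 1}" "x - of_int r \<in> znadic n"
    "r' \<in> {0..<int n - 1}" "x - of_int r' \<in> znadic n" for r r' :: int
  proof -
    have "of_int (r' - r) \<in> znadic n"
      using znadic_diff[OF _ that(2) that(4)] n by simp
    then have "(int n - 1) dvd (r' - r)"
      using znadic_of_int_iff[OF n] by blast
    then have "r' mod (int n - 1) = r mod (int n - 1)"
      by (simp add: mod_eq_dvd_iff)
    then show ?thesis
      using that by simp
  qed
  obtain a b where ab: "x = of_int a * real n powi b"
    using x by (auto simp: nadic_def)
  define r0 where "r0 = a mod (int n - 1)"
  have r0: "r0 \<in> {0..<int n - 1}" "x - of_int r0 \<in> znadic n"
    using n repr by (auto simp: ab r0_def)
  have "phi n x = r0"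
    unfolding phi_def
  proof (rule the_equality)
    show "\<exists>a b. x = of_int a * real n powi b \<and> r0 = a mod (int n - 1)"
      using ab r0_def by blast
  next
    fix r assume "\<exists>a b. x = of_int a * real n powi b \<and> r = a mod (int n - 1)"
    then obtain a' b' where "x = of_int a' * real n powi b'" "r = a' mod (int n - 1)"
      by blast
    then show "r = r0"
      using uniq[of r r0] r0 n repr[of a' b'] by auto
  qed
  then show ?thesis
    using uniq r0 by metis
qed

lemma phi_diff_mod:
  assumes n: "n \<ge> 2" and xy: "x \<in> nadic n" "y \<in> nadic n"
  shows "x - y - of_int ((phi n x - phi n y) mod (int n - 1)) \<in> znadic n"
proof -
  have "(x - of_int (phi n x)) - (y - of_int (phi n y)) \<in> znadic n"
    using phi_eq_iff[OF n xy(1)] phi_eq_iff[OF n xy(2)] n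
      znadic_diff[of n "x - of_int (phi n x)" "y - of_int (phi n y)"] by fastforce
  moreover have "of_int ((phi n x - phi n y) - (phi n x - phi n y) mod (int n - 1)) \<in> znadic n"
    unfolding znadic_of_int_iff[OF n] by (simp add: minus_mod_eq_mult_div)
  ultimately show ?thesis
    using znadic_add[of n "(x - of_int (phi n x)) - (y - of_int (phi n y))"
      "of_int ((phi n x - phi n y) - (phi n x - phi n y) mod (int n - 1))"] n
    by (simp add: algebra_simps)
qed

section \<open>Germs of piecewise linear maps\<close>

definition germ :: "nat \<Rightarrow> (real \<Rightarrow> real) \<Rightarrow> real \<Rightarrow> int \<Rightarrow> int \<Rightarrow> bool" where
  "germ n f x k l \<longleftrightarrow>
     (\<forall>\<^sub>F y in nhds x. f y = f x + (if y < x then real n powi k else real n powi l) * (y - x))"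

lemma germ_cong:
  assumes "\<forall>\<^sub>F y in nhds x. f y = g y"
  shows "germ n f x k l \<longleftrightarrow> germ n g x k l"
proof -
  have *: "germ n g x k l" if "\<forall>\<^sub>F y in nhds x. f y = g y" "germ n f x k l" for f g
    using that(2,1) unfolding germ_def
    by (rule eventually_elim2) (use eventually_nhds_x_imp_x[OF that(1)] in auto)
  show ?thesis
    using *[of f g] *[of g f] assms by (auto simp: eq_commute)
qed

lemma eventually_nhds_homeo:
  "h \<in> homeos \<Longrightarrow> eventually P (nhds (h x)) \<Longrightarrow> \<forall>\<^sub>F y in nhds x. P (h y)"
  using homeos_filterlim filterlim_iff by blast

lemma two_slopes_less_0_iff:
  fixes a b x y :: real
  assumes "a > 0" "b > 0"
  shows "(if y < x then a else b) * (y - x) < 0 \<longleftrightarrow> y < x"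
  using assms by (auto simp: mult_less_0_iff not_less)

lemma germ_comp:
  assumes n: "n \<ge> 1" and f: "f \<in> homeos" "germ n f x k l" and g: "germ n g (f x) k' l'"
  shows "germ n (g \<circ> f) x (k + k') (l + l')"
proof -
  have "\<forall>\<^sub>F y in nhds x. g (f y) = g (f x) + (if f y < f x then real n powi k' else real n powi l') * (f y - f x)"
    by (rule eventually_nhds_homeo[OF f(1)]) (use g in \<open>simp add: germ_def\<close>)
  with f(2) show ?thesis
    unfolding germ_def
  proof eventually_elim
    case (elim y)
    have pos: "real n powi j > 0" for j
      using n by simp
    have fyx: "f y - f x = (if y < x then real n powi k else real n powi l) * (y - x)"
      using elim(1) by simp
    then have "f y < f x \<longleftrightarrow> y < x"
      using two_slopes_less_0_iff[OF pos pos, of y x k l] by linarith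
    then have "g (f y) = g (f x) + (if y < x then real n powi k' else real n powi l') *
        ((if y < x then real n powi k else real n powi l) * (y - x))"
      using elim(2) unfolding fyx by simp
    then show ?case
      using n by (cases "y < x") (simp_all add: power_int_add mult_ac)
  qed
qed

lemma germ_finv:
  assumes n: "n \<ge> 1" and f: "f \<in> homeos" "germ n f x k l"
  shows "germ n (finv f) (f x) (- k) (- l)"
proof -
  have "\<forall>\<^sub>F y in nhds (f x). f (finv f y) = f x + (if finv f y < x then real n powi k else real n powi l) * (finv f y - x)"
    by (rule eventually_nhds_homeo[OF homeos_inv[OF f(1)], of _ "f x"])
       (use f(2) in \<open>simp only: germ_def homeos_inv_apply[OF f(1)]\<close>)
  then show ?thesis
    unfolding germ_def
  proof eventually_elim
    case (elim y)
    have pos: "real n powi j > 0" for j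
      using n by simp
    have yx: "y - f x = (if finv f y < x then real n powi k else real n powi l) * (finv f y - x)"
      using elim f(1) by simp
    then have "y < f x \<longleftrightarrow> finv f y < x"
      using two_slopes_less_0_iff[OF pos pos, of "finv f y" x k l] by linarith
    moreover have "d = real n powi (- j) * (real n powi j * d)" for j d
      using pos[of j] n by (simp add: power_int_minus field_simps)
    from this[of "finv f y - x"] have "finv f y = x + real n powi (- j) * (real n powi j * (finv f y - x))" for j
      by (metis add.commute diff_add_cancel)
    ultimately show ?case
      unfolding yx using f(1) by (cases "finv f y < x") simp_all
  qed
qed

lemma germ_affine:
  assumes "\<forall>\<^sub>F y in nhds x. f y = real n powi k * y + b"
  shows "germ n f x k k"
  using assms unfolding germ_def
  by eventually_elim (use eventually_nhds_x_imp_x[OF assms] in \<open>auto simp: algebra_simps\<close>)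

lemma germ_interval:
  assumes "germ n f x k l"
  obtains e where "e > 0"
    "\<And>y. x - e \<le> y \<Longrightarrow> y \<le> x \<Longrightarrow> f y = f x + real n powi k * (y - x)"
    "\<And>y. x \<le> y \<Longrightarrow> y \<le> x + e \<Longrightarrow> f y = f x + real n powi l * (y - x)"
proof -
  obtain d where d: "d > 0" "\<And>y. dist y x < d \<Longrightarrow>
      f y = f x + (if y < x then real n powi k else real n powi l) * (y - x)"
    using assms by (auto simp: germ_def eventually_nhds_metric)
  show ?thesis
  proof (rule that[of "d / 2"])
    fix y assume "x - d / 2 \<le> y" "y \<le> x"
    then show "f y = f x + real n powi k * (y - x)"
      using d(2)[of y] d(1) by (cases "y = x") (auto simp: dist_real_def)
  next
    fix y assume "x \<le> y" "y \<le> x + d / 2"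
    then show "f y = f x + real n powi l * (y - x)"
      using d(2)[of y] d(1) by (auto simp: dist_real_def)
  qed (use d in auto)
qed

lemma affine_pieces_derivative:
  fixes f :: "real \<Rightarrow> real"
  assumes "e > 0"
    "\<And>y. y \<in> {x - e..x} \<Longrightarrow> f y = f x + p * (y - x)"
    "\<And>y. y \<in> {x..x + e} \<Longrightarrow> f y = f x + q * (y - x)"
  shows "y \<in> {x - e<..<x} \<Longrightarrow> (f has_real_derivative p) (at y)"
    and "y \<in> {x<..<x + e} \<Longrightarrow> (f has_real_derivative q) (at y)"
    and "(f has_real_derivative d) (at x) \<longleftrightarrow> p = d \<and> q = d"
proof -
  show "(f has_real_derivative p) (at y)" if "y \<in> {x - e<..<x}"
  proof (rule has_field_derivative_transform_within_open)
    show "((\<lambda>y. f x + p * (y - x)) has_real_derivative p) (at y)"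
      by (auto intro!: derivative_eq_intros)
    show "f x + p * (z - x) = f z" if "z \<in> {x - e<..<x}" for z
      using assms(2)[of z] that by simp
  qed (use that in auto)
  show "(f has_real_derivative q) (at y)" if "y \<in> {x<..<x + e}"
  proof (rule has_field_derivative_transform_within_open)
    show "((\<lambda>y. f x + q * (y - x)) has_real_derivative q) (at y)"
      by (auto intro!: derivative_eq_intros)
    show "f x + q * (z - x) = f z" if "z \<in> {x<..<x + e}" for z
      using assms(3)[of z] that by simp
  qed (use that in auto)
  have l: "((\<lambda>y. (f y - f x) / (y - x)) \<longlongrightarrow> p) (at_left x)"
  proof (rule tendsto_eventually)
    have "\<forall>\<^sub>F y in at_left x. y \<in> {x - e<..<x}"
      using assms(1) by (intro eventually_at_left_real) auto
    then show "\<forall>\<^sub>F y in at_left x. (f y - f x) / (y - x) = p"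
    proof eventually_elim
      case (elim y)
      then show ?case
        using assms(2)[of y] by simp
    qed
  qed
  have r: "((\<lambda>y. (f y - f x) / (y - x)) \<longlongrightarrow> q) (at_right x)"
  proof (rule tendsto_eventually)
    have "\<forall>\<^sub>F y in at_right x. y \<in> {x<..<x + e}"
      using assms(1) by (intro eventually_at_right_real) auto
    then show "\<forall>\<^sub>F y in at_right x. (f y - f x) / (y - x) = q"
    proof eventually_elim
      case (elim y)
      then show ?case
        using assms(3)[of y] by simp
    qed
  qed
  have "(f has_real_derivative d) (at x) \<longleftrightarrow> ((\<lambda>y. (f y - f x) / (y - x)) \<longlongrightarrow> d) (at x)"
    by (simp add: has_field_derivative_iff)
  also have "\<dots> \<longleftrightarrow> ((\<lambda>y. (f y - f x) / (y - x)) \<longlongrightarrow> d) (at_left x) \<and>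
      ((\<lambda>y. (f y - f x) / (y - x)) \<longlongrightarrow> d) (at_right x)"
    by (rule filterlim_at_split)
  also have "\<dots> \<longleftrightarrow> p = d \<and> q = d"
  proof (rule arg_cong2[where f = "(\<and>)"])
    show "((\<lambda>y. (f y - f x) / (y - x)) \<longlongrightarrow> d) (at_left x) \<longleftrightarrow> p = d"
      using l tendsto_unique[OF trivial_limit_at_left_real l] by blast
    show "((\<lambda>y. (f y - f x) / (y - x)) \<longlongrightarrow> d) (at_right x) \<longleftrightarrow> q = d"
      using r tendsto_unique[OF trivial_limit_at_right_real r] by blast
  qed
  finally show "(f has_real_derivative d) (at x) \<longleftrightarrow> p = d \<and> q = d" .
qed

text \<open>A homeomorphism of the line is strictly monotone, and a single right germ of positive slope decides
  in which direction.\<close>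

lemma germ_strict_mono:
  assumes "n \<ge> 1" "f \<in> homeos" "germ n f x k l"
  shows "strict_mono f"
proof (rule ccontr)
  assume "\<not> strict_mono f"
  then have anti: "strict_antimono_on UNIV f"
    using homeos_mono_or_antimono assms by blast
  obtain e where "e > 0" "\<And>y. x \<le> y \<Longrightarrow> y \<le> x + e \<Longrightarrow> f y = f x + real n powi l * (y - x)"
    using germ_interval[OF assms(3)] by metis
  from this(2)[of "x + e"] this(1) have "f (x + e) = f x + real n powi l * e"
    by simp
  moreover have "real n powi l * e > 0"
    using assms \<open>e > 0\<close> by simp
  moreover have "f (x + e) < f x"
    using anti \<open>e > 0\<close> by (simp add: monotone_on_def)
  ultimately show False
    by simp
qed

section \<open>Local description of \<open>A\<^sub>n(\<real>)\<close> and \<open>B\<^sub>n(\<real>)\<close>\<close>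

definition nadic_germs :: "nat \<Rightarrow> (real \<Rightarrow> real) \<Rightarrow> bool" where
  "nadic_germs n f \<longleftrightarrow> (\<forall>x. \<exists>k l. germ n f x k l \<and> (k \<noteq> l \<longrightarrow> x \<in> nadic n))"

lemma nadic_germsE:
  assumes "nadic_germs n f"
  obtains k l where "germ n f x k l" "k \<noteq> l \<longrightarrow> x \<in> nadic n"
  using assms unfolding nadic_germs_def by blast

lemma nadic_germs_comp:
  assumes "n \<ge> 1" "f \<in> homeos" "nadic_germs n f" "nadic_germs n g" "\<And>x. f x \<in> nadic n \<longleftrightarrow> x \<in> nadic n"
  shows "nadic_germs n (g \<circ> f)"
  unfolding nadic_germs_def
proof
  fix x
  obtain k l where 1: "germ n f x k l" "k \<noteq> l \<longrightarrow> x \<in> nadic n"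
    using assms(3) by (rule nadic_germsE)
  obtain k' l' where 2: "germ n g (f x) k' l'" "k' \<noteq> l' \<longrightarrow> f x \<in> nadic n"
    using assms(4) by (rule nadic_germsE)
  show "\<exists>k l. germ n (g \<circ> f) x k l \<and> (k \<noteq> l \<longrightarrow> x \<in> nadic n)"
  proof (intro exI conjI impI)
    show "germ n (g \<circ> f) x (k + k') (l + l')"
      by (rule germ_comp[OF assms(1,2) 1(1) 2(1)])
    assume "k + k' \<noteq> l + l'"
    then have "k \<noteq> l \<or> k' \<noteq> l'"
      by blast
    then show "x \<in> nadic n"
      using 1(2) 2(2) assms(5) by blast
  qed
qed

lemma nadic_germs_finv:
  assumes "n \<ge> 1" "f \<in> homeos" "nadic_germs n f" "\<And>x. f x \<in> nadic n \<longleftrightarrow> x \<in> nadic n"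
  shows "nadic_germs n (finv f)"
  unfolding nadic_germs_def
proof
  fix y
  obtain k l where 1: "germ n f (finv f y) k l" "k \<noteq> l \<longrightarrow> finv f y \<in> nadic n"
    using assms(3) by (rule nadic_germsE)
  then have "germ n (finv f) y (- k) (- l)"
    using germ_finv[OF assms(1,2) 1(1)] assms(2) by simp
  moreover have "- k \<noteq> - l \<longrightarrow> y \<in> nadic n"
    using 1(2) assms(2) assms(4)[of "finv f y"] by simp
  ultimately show "\<exists>k l. germ n (finv f) y k l \<and> (k \<noteq> l \<longrightarrow> y \<in> nadic n)"
    by blast
qed

lemma homeos_image_eq_iff:
  assumes "f \<in> homeos"
  shows "f ` S = S \<longleftrightarrow> (\<forall>x. f x \<in> S \<longleftrightarrow> x \<in> S)"
proof
  assume "f ` S = S"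
  moreover have "inj f"
    using assms by (simp add: homeos_bij bij_is_inj)
  ultimately show "\<forall>x. f x \<in> S \<longleftrightarrow> x \<in> S"
    using inj_image_mem_iff[of f _ S] by simp
next
  assume "\<forall>x. f x \<in> S \<longleftrightarrow> x \<in> S"
  moreover from this have "x \<in> f ` S" if "x \<in> S" for x
    using assms that by (intro image_eqI[of _ f "finv f x"]) (simp, metis homeos_apply_inv)
  ultimately show "f ` S = S"
    by blast
qed

text \<open>A break is exactly a point where the left and right slopes differ, so all conditions in the
  definition of \<open>A\<^sub>n(\<real>)\<close> except the invariance of the \<open>n\<close>-adic fractions are conditions on germs.\<close>

lemma A_R_iff:
  assumes n: "n \<ge> 2"
  shows "f \<in> A_R n \<longleftrightarrow> f \<in> homeos \<and> nadic_germs n f \<and> (\<forall>x. f x \<in> nadic n \<longleftrightarrow> x \<in> nadic n)"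
proof
  assume f: "f \<in> A_R n"
  then have h: "f \<in> homeos" and mono: "strict_mono f" and sl: "slopes f \<subseteq> npowers n"
    and br: "breaks f \<subseteq> nadic n" and pl: "piecewise_linear f" and im: "f ` nadic n = nadic n"
    by (auto simp: A_R_def)
  have "\<exists>k l. germ n f x k l \<and> (k \<noteq> l \<longrightarrow> x \<in> nadic n)" for x
  proof -
    obtain e p q where e: "e > 0" and
      p: "\<And>y. y \<in> {x - e..x} \<Longrightarrow> f y = f x + p * (y - x)" and
      q: "\<And>y. y \<in> {x..x + e} \<Longrightarrow> f y = f x + q * (y - x)"
      using pl unfolding piecewise_linear_def by meson
    note D = affine_pieces_derivative[OF e p q]
    have "p \<in> slopes f" "q \<in> slopes f"
      using D(1)[of "x - e / 2"] D(2)[of "x + e / 2"] e by (auto simp: slopes_def)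
    then have "\<exists>k. p = real n powi k" "\<exists>l. q = real n powi l"
      using sl by (auto simp: npowers_def subset_iff)
    then obtain k l where kl: "p = real n powi k" "q = real n powi l" "p = q \<longrightarrow> k = l"
      by metis
    have "germ n f x k l"
      unfolding germ_def eventually_nhds_metric
    proof (intro exI[of _ e] conjI allI impI e)
      fix y assume "dist y x < e"
      then show "f y = f x + (if y < x then real n powi k else real n powi l) * (y - x)"
        using p[of y] q[of y] kl by (cases "y < x") (auto simp: dist_real_def)
    qed
    moreover have "x \<in> nadic n" if "k \<noteq> l"
    proof -
      have "p \<noteq> q"
        using that kl by blast
      then have "\<not> f differentiable (at x)"
        using D(3) by (auto simp: real_differentiable_def)
      then show ?thesis
        using br by (auto simp: breaks_def)
    qed
    ultimately show ?thesis
      by blast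
  qed
  then show "f \<in> homeos \<and> nadic_germs n f \<and> (\<forall>x. f x \<in> nadic n \<longleftrightarrow> x \<in> nadic n)"
    using h im homeos_image_eq_iff by (auto simp: nadic_germs_def)
next
  assume "f \<in> homeos \<and> nadic_germs n f \<and> (\<forall>x. f x \<in> nadic n \<longleftrightarrow> x \<in> nadic n)"
  then have h: "f \<in> homeos" and g: "nadic_germs n f" and im: "f ` nadic n = nadic n"
    by (auto simp: homeos_image_eq_iff)
  have mono: "strict_mono f"
  proof -
    obtain k l where "germ n f 0 k l"
      using g by (rule nadic_germsE)
    then show ?thesis
      using germ_strict_mono[of n f 0 k l] h n by simp
  qed
  have loc: "\<exists>e>0. \<exists>k l. (\<forall>y\<in>{x - e..x}. f y = f x + real n powi k * (y - x)) \<and>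
      (\<forall>y\<in>{x..x + e}. f y = f x + real n powi l * (y - x)) \<and> (k \<noteq> l \<longrightarrow> x \<in> nadic n)" for x
  proof -
    obtain k l where "germ n f x k l" "k \<noteq> l \<longrightarrow> x \<in> nadic n"
      using g by (rule nadic_germsE)
    then show ?thesis
      using germ_interval[of n f x k l] by (metis atLeastAtMost_iff)
  qed
  have pl: "piecewise_linear f"
    unfolding piecewise_linear_def using loc by meson
  have sl: "slopes f \<subseteq> npowers n"
  proof
    fix d assume "d \<in> slopes f"
    then obtain x where x: "(f has_real_derivative d) (at x)"
      by (auto simp: slopes_def)
    obtain e k l where e: "e > 0" and
      p: "\<And>y. y \<in> {x - e..x} \<Longrightarrow> f y = f x + real n powi k * (y - x)" and
      q: "\<And>y. y \<in> {x..x + e} \<Longrightarrow> f y = f x + real n powi l * (y - x)"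
      using loc[of x] by metis
    show "d \<in> npowers n"
      using affine_pieces_derivative(3)[OF e p q, of d] x by (auto simp: npowers_def)
  qed
  have nobreak: "x \<notin> breaks f"
    if "\<And>y. y \<in> {a<..<b} \<Longrightarrow> (f has_real_derivative d) (at y)" "x \<in> {a<..<b}" for x a b d
  proof -
    have "\<forall>\<^sub>F y in nhds x. d = deriv f y"
      unfolding eventually_nhds
    proof (intro exI[of _ "{a<..<b}"] conjI ballI)
      fix y assume "y \<in> {a<..<b}"
      then show "d = deriv f y"
        using DERIV_imp_deriv[OF that(1)] by simp
    qed (use that in auto)
    then have "isCont (deriv f) x"
      using isCont_cong[of "\<lambda>_. d" "deriv f" x] by simp
    moreover have "f differentiable (at x)"
      using that(1)[OF that(2)] by (auto simp: real_differentiable_def)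
    ultimately show ?thesis
      by (simp add: breaks_def)
  qed
  have isol: "\<exists>e>0. (\<forall>y\<in>{x - e<..<x + e}. y \<in> breaks f \<longrightarrow> y = x) \<and> (x \<in> breaks f \<longrightarrow> x \<in> nadic n)" for x
  proof -
    obtain e k l where e: "e > 0" and
      p: "\<And>y. y \<in> {x - e..x} \<Longrightarrow> f y = f x + real n powi k * (y - x)" and
      q: "\<And>y. y \<in> {x..x + e} \<Longrightarrow> f y = f x + real n powi l * (y - x)" and
      kl: "k \<noteq> l \<longrightarrow> x \<in> nadic n"
      using loc[of x] by metis
    note D = affine_pieces_derivative[OF e p q]
    have "y \<notin> breaks f" if "y \<in> {x - e<..<x}" for y
      by (rule nobreak[OF D(1) that])
    moreover have "y \<notin> breaks f" if "y \<in> {x<..<x + e}" for y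
      by (rule nobreak[OF D(2) that])
    moreover have "x \<notin> breaks f" if "k = l"
    proof (rule nobreak)
      show "(f has_real_derivative real n powi k) (at z)" if "z \<in> {x - e<..<x + e}" for z
        using D(1)[of z] D(2)[of z] D(3)[of "real n powi k"] that \<open>k = l\<close>
        by (cases z x rule: linorder_cases) auto
    qed (use e in auto)
    ultimately show ?thesis
      using e kl by (intro exI[of _ e]) (auto, (metis greaterThanLessThan_iff linorder_neqE_linordered_idom)+)
  qed
  have "discrete (breaks f)"
    unfolding discrete_def isolated_in_dist_Ex_iff
  proof
    fix x assume x: "x \<in> breaks f"
    obtain e where e: "e > 0" "\<And>y. y \<in> {x - e<..<x + e} \<Longrightarrow> y \<in> breaks f \<Longrightarrow> y = x"
      using isol by blast
    show "x \<in> breaks f \<and> (\<exists>e>0. \<forall>y\<in>breaks f. dist x y < e \<longrightarrow> y = x)"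
    proof (intro conjI exI[of _ e] ballI impI)
      fix y assume "y \<in> breaks f" "dist x y < e"
      then show "y = x"
        by (intro e(2)) (auto simp: dist_real_def)
    qed (use x e in auto)
  qed
  moreover have "breaks f \<subseteq> nadic n"
    using isol by blast
  ultimately show "f \<in> A_R n"
    using h mono pl sl im by (auto simp: A_R_def)
qed

lemma A_R_subgroup:
  assumes n: "n \<ge> 2"
  shows "subgroup (A_R n) homeo_group"
proof (rule homeo_subgroupI)
  show "A_R n \<subseteq> homeos"
    by (auto simp: A_R_def)
  have "germ n id x 0 0" for x
    by (intro germ_affine[where b=0]) simp
  then show "id \<in> A_R n"
    by (auto simp: A_R_iff[OF n] homeos_id nadic_germs_def)
  show "g \<circ> f \<in> A_R n" if "f \<in> A_R n" "g \<in> A_R n" for f g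
    unfolding A_R_iff[OF n]
  proof (intro conjI allI)
    show "g \<circ> f \<in> homeos"
      using that by (simp add: A_R_iff[OF n] homeos_comp)
    show "nadic_germs n (g \<circ> f)"
      using that n by (intro nadic_germs_comp) (simp_all add: A_R_iff[OF n])
    show "(g \<circ> f) x \<in> nadic n \<longleftrightarrow> x \<in> nadic n" for x
      using that by (simp add: A_R_iff[OF n])
  qed
  show "finv f \<in> A_R n" if "f \<in> A_R n" for f
    unfolding A_R_iff[OF n]
  proof (intro conjI allI)
    show "finv f \<in> homeos"
      using that by (simp add: A_R_iff[OF n] homeos_inv)
    show "nadic_germs n (finv f)"
      using that n by (intro nadic_germs_finv) (simp_all add: A_R_iff[OF n])
    have "f (finv f x) \<in> nadic n \<longleftrightarrow> finv f x \<in> nadic n" for x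
      using that unfolding A_R_iff[OF n] by blast
    then show "finv f x \<in> nadic n \<longleftrightarrow> x \<in> nadic n" for x
      using that by (simp add: A_R_iff[OF n])
  qed
qed

text \<open>Slopes are powers of \<open>n\<close>, hence congruent to \<open>1\<close> modulo \<open>n - 1\<close>; so the displacement \<open>f x - x\<close> is constant
  modulo \<open>n - 1\<close> near every point, and the line is connected.\<close>

lemma A_R_displacement_const:
  assumes n: "n \<ge> 2" and f: "f \<in> A_R n" and x: "x \<in> nadic n" and y: "y \<in> nadic n"
  shows "(f y - y) - (f x - x) \<in> znadic n"
proof (rule connected_induction[of UNIV "\<lambda>z. z \<in> nadic n" "\<lambda>z. (f z - z) - (f x - x) \<in> znadic n" x y])
  show "connected (UNIV :: real set)"
    by simp
  fix T :: "real set" and a assume T: "openin (top_of_set UNIV) T" "a \<in> T"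
  then obtain e where e: "e > 0" "ball a e \<subseteq> T"
    by (metis open_contains_ball open_openin subtopology_UNIV)
  obtain z where "z \<in> znadic n" "a < z" "z < a + e"
    using dense_znadic[of n a "a + e"] n e by auto
  then show "\<exists>z. z \<in> T \<and> z \<in> nadic n"
    using e znadic_nadic[of n z] n by (auto intro!: exI[of _ z] simp: dist_real_def subset_iff)
next
  fix a :: real
  obtain k l where kl: "germ n f a k l" "k \<noteq> l \<longrightarrow> a \<in> nadic n"
    using f A_R_iff[OF n] nadic_germsE by metis
  obtain e where e: "e > 0"
    "\<And>y. a - e \<le> y \<Longrightarrow> y \<le> a \<Longrightarrow> f y = f a + real n powi k * (y - a)"
    "\<And>y. a \<le> y \<Longrightarrow> y \<le> a + e \<Longrightarrow> f y = f a + real n powi l * (y - a)"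
    using germ_interval[OF kl(1)] by metis
  have 1: "(f z - z) - (f w - w) \<in> znadic n"
    if "f z - f w = real n powi j * (z - w)" "z \<in> nadic n" "w \<in> nadic n" for z w j
  proof -
    have "real n powi j * (z - w) - (z - w) \<in> znadic n"
      using that n by (intro znadic_scale_diff nadic_diff) auto
    moreover have "(f z - z) - (f w - w) = real n powi j * (z - w) - (z - w)"
      using that(1) by simp
    ultimately show ?thesis
      by (rule back_subst[where P = "\<lambda>u. u \<in> znadic n", OF _ sym])
  qed
  have 2: "(f z - z) - (f w - w) \<in> znadic n"
    if "z \<in> nadic n" "w \<in> nadic n" "z \<in> {a - e<..<a + e}" "w \<in> {a - e<..<a + e}" for z w
  proof (cases "k = l")
    case True
    have "f v - f a = real n powi k * (v - a)" if v: "v \<in> {a - e<..<a + e}" for v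
    proof (cases "v \<le> a")
      case True
      then show ?thesis
        using e(2)[of v] v by simp
    next
      case False
      then show ?thesis
        using e(3)[of v] v \<open>k = l\<close> by simp
    qed
    from this[OF that(3)] this[OF that(4)] have "f z - f w = real n powi k * (z - w)"
      by (simp only: right_diff_distrib)
    then show ?thesis
      using that by (intro 1)
  next
    case False
    then have a: "a \<in> nadic n"
      using kl by blast
    have 3: "(f v - v) - (f a - a) \<in> znadic n" if v: "v \<in> nadic n" "v \<in> {a - e<..<a + e}" for v
    proof (cases "v \<le> a")
      case True
      then have "f v - f a = real n powi k * (v - a)"
        using e(2)[of v] v by simp
      then show ?thesis
        using v a by (intro 1)
    next
      case False
      then have "f v - f a = real n powi l * (v - a)"
        using e(3)[of v] v by simp
      then show ?thesis
        using v a by (intro 1)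
    qed
    have "((f z - z) - (f a - a)) - ((f w - w) - (f a - a)) \<in> znadic n"
      using n by (intro znadic_diff[OF _ 3[OF that(1,3)] 3[OF that(2,4)]]) simp
    moreover have "(f z - z) - (f w - w) = ((f z - z) - (f a - a)) - ((f w - w) - (f a - a))"
      by simp
    ultimately show ?thesis
      by (rule back_subst[where P = "\<lambda>u. u \<in> znadic n", OF _ sym])
  qed
  show "\<exists>T. openin (top_of_set UNIV) T \<and> a \<in> T \<and> (\<forall>z\<in>T. \<forall>w\<in>T. z \<in> nadic n \<and> w \<in> nadic n \<and>
      (f z - z) - (f x - x) \<in> znadic n \<longrightarrow> (f w - w) - (f x - x) \<in> znadic n)"
  proof (intro exI[of _ "{a - e<..<a + e}"] conjI ballI impI)
    fix z w assume zw: "z \<in> {a - e<..<a + e}" "w \<in> {a - e<..<a + e}"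
      "z \<in> nadic n \<and> w \<in> nadic n \<and> (f z - z) - (f x - x) \<in> znadic n"
    have "((f w - w) - (f z - z)) + ((f z - z) - (f x - x)) \<in> znadic n"
      using zw n by (intro znadic_add 2[of w z]) auto
    moreover have "((f w - w) - (f z - z)) + ((f z - z) - (f x - x)) = (f w - w) - (f x - x)"
      by simp
    ultimately show "(f w - w) - (f x - x) \<in> znadic n"
      by argo
  qed (use \<open>e > 0\<close> in auto)
qed (use x y in auto)

lemma B_R_iff:
  assumes n: "n \<ge> 2"
  shows "f \<in> B_R n \<longleftrightarrow> f \<in> A_R n \<and> (\<forall>x\<in>nadic n. f x - x \<in> znadic n)"
proof (cases "f \<in> A_R n")
  case True
  have fx: "f x \<in> nadic n" if "x \<in> nadic n" for x
    using True that by (simp add: A_R_iff[OF n])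
  define D where "D x = (phi n (f x) - phi n x) mod (int n - 1)" for x
  have D: "f x - x - of_int (D x) \<in> znadic n" "D x \<in> {0..<int n - 1}" if "x \<in> nadic n" for x
    using phi_diff_mod[OF n fx[OF that] that] n by (auto simp: D_def)
  have const: "D x = D 0" if x: "x \<in> nadic n" for x
  proof -
    have 0: "(0::real) \<in> nadic n"
      using nadic_of_int[of 0 n] by simp
    have "((f x - x) - (f 0 - 0)) - ((f x - x - of_int (D x)) - (f 0 - 0 - of_int (D 0))) \<in> znadic n"
      using x 0 n by (intro znadic_diff A_R_displacement_const True D) auto
    then have "of_int (D x - D 0) \<in> znadic n"
      by simp
    then have "(int n - 1) dvd (D x - D 0)"
      using znadic_of_int_iff[OF n] by blast
    then have "D x mod (int n - 1) = D 0 mod (int n - 1)"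
      by (simp add: mod_eq_dvd_iff)
    then show ?thesis
      using D(2)[OF x] D(2)[OF 0] by simp
  qed
  have "rho n f = D 0"
    unfolding rho_def
  proof (rule the_equality)
    show "\<forall>x\<in>nadic n. D 0 = (phi n (f x) - phi n x) mod (int n - 1)"
      using const unfolding D_def by simp
    show "r = D 0" if "\<forall>x\<in>nadic n. r = (phi n (f x) - phi n x) mod (int n - 1)" for r
      using that nadic_of_int[of 0 n] unfolding D_def by simp
  qed
  moreover have "D 0 = 0 \<longleftrightarrow> (\<forall>x\<in>nadic n. f x - x \<in> znadic n)"
  proof
    assume "D 0 = 0"
    then show "\<forall>x\<in>nadic n. f x - x \<in> znadic n"
      using const D by fastforce
  next
    assume *: "\<forall>x\<in>nadic n. f x - x \<in> znadic n"
    have 0: "(0::real) \<in> nadic n"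
      using nadic_of_int[of 0 n] by simp
    have "(f 0 - 0) - (f 0 - 0 - of_int (D 0)) \<in> znadic n"
      using znadic_diff[OF _ bspec[OF * 0] D(1)[OF 0]] n by simp
    then have "(int n - 1) dvd D 0"
      using znadic_of_int_iff[OF n, of "D 0"] by simp
    then show "D 0 = 0"
      using D(2)[OF 0] by (metis atLeastLessThan_iff mod_pos_pos_trivial dvd_imp_mod_0)
  qed
  ultimately show ?thesis
    using True by (simp add: B_R_def kernel_def)
qed (simp add: B_R_def kernel_def)

lemma B_R_subset_A_R: "B_R n \<subseteq> A_R n"
  by (auto simp: B_R_def kernel_def)

lemma B_R_subgroup:
  assumes n: "n \<ge> 2"
  shows "subgroup (B_R n) homeo_group"
proof (rule homeo_subgroupI)
  note A = homeo_subgroupD[OF A_R_subgroup[OF n]]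
  show "B_R n \<subseteq> homeos"
    using B_R_subset_A_R A(1) by blast
  show "id \<in> B_R n"
    using A(2) by (simp add: B_R_iff[OF n])
  show "g \<circ> f \<in> B_R n" if f: "f \<in> B_R n" and g: "g \<in> B_R n" for f g
  proof -
    have "(g (f x) - f x) + (f x - x) \<in> znadic n" if x: "x \<in> nadic n" for x
      using f g x n by (intro znadic_add) (auto simp: B_R_iff A_R_iff)
    then show ?thesis
      using f g A(3) by (auto simp: B_R_iff[OF n])
  qed
  show "finv f \<in> B_R n" if f: "f \<in> B_R n" for f
  proof -
    have h: "f \<in> homeos"
      using f A(1) B_R_subset_A_R by blast
    have "- (f (finv f x) - finv f x) \<in> znadic n" if x: "x \<in> nadic n" for x
    proof -
      have "finv f x \<in> nadic n"
        using f x h by (metis A_R_iff B_R_iff homeos_apply_inv n)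
      then show ?thesis
        using f n by (intro znadic_uminus) (auto simp: B_R_iff)
    qed
    then show ?thesis
      using f h A(4) by (auto simp: B_R_iff[OF n])
  qed
qed

section \<open>The group \<open>F\<^bsub>n,\<infinity>\<^esub>\<close>\<close>

lemma transl_homeos: "transl r \<in> homeos"
proof (rule strict_mono_surj_homeos)
  show "surj (transl r)"
    by (rule surjI[of _ "\<lambda>y. y - r"]) (simp add: transl_def)
qed (simp add: transl_def strict_mono_def)

lemma finv_transl: "finv (transl r) = transl (- r)"
  by (rule inv_equality) (auto simp: transl_def)

lemma transl_A_R:
  assumes n: "n \<ge> 2"
  shows "transl (of_int r) \<in> A_R n"
proof -
  have "germ n (transl (of_int r)) x 0 0" for x
    by (rule germ_affine[where b = "of_int r"]) (simp add: transl_def)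
  moreover have "x + of_int r \<in> nadic n \<longleftrightarrow> x \<in> nadic n" for x
    using nadic_add[of n x "of_int r"] nadic_diff[of n "x + of_int r" "of_int r"] n by auto
  ultimately show ?thesis
    by (auto simp: A_R_iff[OF n] transl_homeos nadic_germs_def transl_def)
qed

lemma transl_B_R:
  assumes n: "n \<ge> 2"
  shows "transl ((real n - 1) * of_int a) \<in> B_R n"
proof -
  have "transl (of_int ((int n - 1) * a)) \<in> A_R n"
    using n by (rule transl_A_R)
  then show ?thesis
    using znadic_mult_int[of n a] by (simp add: B_R_iff[OF n] transl_def)
qed

lemma pl_gen_simps:
  "x \<le> of_int i \<Longrightarrow> pl_gen n i x = x"
  "of_int i \<le> x \<Longrightarrow> x \<le> of_int i + 1 \<Longrightarrow> pl_gen n i x = of_int i + real n * (x - of_int i)"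
  "of_int i + 1 \<le> x \<Longrightarrow> pl_gen n i x = x + (real n - 1)"
  by (auto simp: pl_gen_def algebra_simps)

lemma pl_gen_floor: "pl_gen n \<lfloor>x\<rfloor> x = of_int \<lfloor>x\<rfloor> + real n * (x - of_int \<lfloor>x\<rfloor>)"
  by (rule pl_gen_simps) (auto intro: less_imp_le)

lemma pl_gen_mono:
  assumes n: "n \<ge> 1" and xy: "x < y"
  shows "pl_gen n i x < pl_gen n i y"
proof -
  consider "y \<le> of_int i" | "x \<le> of_int i" "of_int i < y" "y \<le> of_int i + 1"
    | "x \<le> of_int i" "of_int i + 1 < y" | "of_int i < x" "y \<le> of_int i + 1"
    | "of_int i < x" "x \<le> of_int i + 1" "of_int i + 1 < y" | "of_int i + 1 < x"
    using xy by linarith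
  then show ?thesis
  proof cases
    case 5
    have "real n * (x - of_int i) \<le> real n * 1"
      using 5 by (intro mult_left_mono) auto
    then show ?thesis
      using 5 by (simp add: pl_gen_simps)
  next
    case 2
    have "real n * (y - of_int i) > 0"
      using 2 n by simp
    then show ?thesis
      using 2 by (simp add: pl_gen_simps)
  qed (use n xy in \<open>simp_all add: pl_gen_simps\<close>)
qed

lemma pl_gen_surj:
  assumes n: "n \<ge> 1"
  shows "surj (pl_gen n i)"
proof (rule surjI)
  fix y
  show "pl_gen n i (if y \<le> of_int i then y else if y \<le> of_int i + real n then of_int i + (y - of_int i) / real n
      else y - (real n - 1)) = y"
    using n by (auto simp: pl_gen_simps field_simps)
qed

lemma pl_gen_homeos: "n \<ge> 1 \<Longrightarrow> pl_gen n i \<in> homeos"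
  using pl_gen_mono pl_gen_surj by (intro strict_mono_surj_homeos strict_monoI) auto

lemma germ_pl_gen:
  shows "germ n (pl_gen n i) (of_int i) 0 1"
    and "germ n (pl_gen n i) (of_int i + 1) 1 0"
    and "x < of_int i \<Longrightarrow> germ n (pl_gen n i) x 0 0"
    and "of_int i < x \<Longrightarrow> x < of_int i + 1 \<Longrightarrow> germ n (pl_gen n i) x 1 1"
    and "of_int i + 1 < x \<Longrightarrow> germ n (pl_gen n i) x 0 0"
proof -
  have ev: "\<forall>\<^sub>F y in nhds x. P y" if "open U" "x \<in> U" "\<And>y. y \<in> U \<Longrightarrow> P y" for x :: real and U P
    using that by (auto simp: eventually_nhds)
  show "germ n (pl_gen n i) (of_int i) 0 1"
    unfolding germ_def
    by (rule ev[of "{of_int i - 1<..<of_int i + 1}"]) (auto simp: pl_gen_simps)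
  show "germ n (pl_gen n i) (of_int i + 1) 1 0"
    unfolding germ_def
    by (rule ev[of "{of_int i<..<of_int i + 2}"]) (auto simp: pl_gen_simps algebra_simps)
  show "x < of_int i \<Longrightarrow> germ n (pl_gen n i) x 0 0"
    by (rule germ_affine[where b=0], rule ev[of "{..<of_int i}"]) (auto simp: pl_gen_simps)
  show "of_int i < x \<Longrightarrow> x < of_int i + 1 \<Longrightarrow> germ n (pl_gen n i) x 1 1"
    by (rule germ_affine[where b="of_int i - real n * of_int i"], rule ev[of "{of_int i<..<of_int i + 1}"])
       (auto simp: pl_gen_simps algebra_simps)
  show "of_int i + 1 < x \<Longrightarrow> germ n (pl_gen n i) x 0 0"
    by (rule germ_affine[where b="real n - 1"], rule ev[of "{of_int i + 1<..}"]) (auto simp: pl_gen_simps)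
qed

lemma pl_gen_nadic_iff:
  assumes n: "n \<ge> 2"
  shows "pl_gen n i x \<in> nadic n \<longleftrightarrow> x \<in> nadic n"
proof -
  consider "x \<le> of_int i" | "of_int i \<le> x" "x \<le> of_int i + 1" | "of_int i + 1 \<le> x"
    by linarith
  then show ?thesis
  proof cases
    case 2
    have eq: "pl_gen n i x = of_int i + real n powi 1 * (x - of_int i)"
      "x = of_int i + real n powi (-1) * (pl_gen n i x - of_int i)"
      using 2 n by (auto simp: pl_gen_simps power_int_minus field_simps)
    have "x \<in> nadic n" if "pl_gen n i x \<in> nadic n"
      by (subst eq(2)) (use n that in \<open>intro nadic_add nadic_mult nadic_powi nadic_diff nadic_of_int, auto\<close>)
    moreover have "pl_gen n i x \<in> nadic n" if "x \<in> nadic n"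
      by (subst eq(1)) (use n that in \<open>intro nadic_add nadic_mult nadic_powi nadic_diff nadic_of_int, auto\<close>)
    ultimately show ?thesis
      by blast
  next
    case 3
    have "x + of_int (int n - 1) \<in> nadic n \<longleftrightarrow> x \<in> nadic n"
      using nadic_add[of n x "of_int (int n - 1)"]
        nadic_diff[of n "x + of_int (int n - 1)" "of_int (int n - 1)"] n
        nadic_of_int[of "int n - 1" n] by auto
    then show ?thesis
      using 3 by (simp add: pl_gen_simps)
  qed (simp add: pl_gen_simps)
qed

lemma pl_gen_B_R:
  assumes n: "n \<ge> 2"
  shows "pl_gen n i \<in> B_R n"
proof -
  have germs: "\<exists>k l. germ n (pl_gen n i) x k l \<and> (k \<noteq> l \<longrightarrow> x \<in> nadic n)" for x
  proof -
    have "of_int i + 1 \<in> nadic n"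
      using nadic_of_int[of "i + 1" n] by simp
    then consider "x < of_int i" | "x = of_int i" "x \<in> nadic n" | "of_int i < x" "x < of_int i + 1"
      | "x = of_int i + 1" "x \<in> nadic n" | "of_int i + 1 < x"
      by (metis linorder_neqE_linordered_idom nadic_of_int)
    then show ?thesis
      by cases (use germ_pl_gen in blast)+
  qed
  have "pl_gen n i x - x \<in> znadic n" if x: "x \<in> nadic n" for x
  proof -
    consider "x \<le> of_int i" | "of_int i \<le> x" "x \<le> of_int i + 1" | "of_int i + 1 \<le> x"
      by linarith
    then show ?thesis
    proof cases
      case 2
      then have "pl_gen n i x - x = (real n - 1) * (x - of_int i)"
        by (simp add: pl_gen_simps algebra_simps)
      then show ?thesis
        using x n nadic_diff[of n x "of_int i"] by (auto intro: znadicI)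
    qed (use znadic_mult_int[of n 1] in \<open>auto simp: pl_gen_simps\<close>)
  qed
  then show ?thesis
    using n germs by (auto simp: B_R_iff A_R_iff pl_gen_homeos nadic_germs_def pl_gen_nadic_iff)
qed

lemma pl_gen_floor_scaled_iff:
  "pl_gen n \<lfloor>x\<rfloor> x * real n ^ k \<in> \<int> \<longleftrightarrow> x * real n ^ Suc k \<in> \<int>"
proof -
  have "pl_gen n \<lfloor>x\<rfloor> x * real n ^ k = of_int (\<lfloor>x\<rfloor> * int n ^ k - \<lfloor>x\<rfloor> * int n ^ Suc k) + x * real n ^ Suc k"
    by (simp add: pl_gen_floor algebra_simps)
  then show ?thesis
    by (metis Ints_add Ints_diff Ints_of_int add_diff_cancel_left')
qed

text \<open>Expanding the unit interval that contains a point lowers the power of \<open>n\<close> in its denominator, so the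
  point becomes an integer after finitely many expansions.\<close>

lemma nadic_induct [consumes 2, case_names int step]:
  assumes n: "n \<ge> 1" and x: "x \<in> nadic n"
    and int: "\<And>a::int. P (of_int a)"
    and step: "\<And>x. x \<in> nadic n \<Longrightarrow> x \<notin> \<int> \<Longrightarrow> P (pl_gen n \<lfloor>x\<rfloor> x) \<Longrightarrow> P x"
  shows "P x"
proof -
  obtain k :: nat where "x * real n ^ k \<in> \<int>"
    using x n nadic_iff_scaled by blast
  then show ?thesis
  proof (induction k arbitrary: x)
    case 0
    then show ?case
      using int by (auto elim: Ints_cases)
  next
    case (Suc k)
    show ?case
    proof (cases "x \<in> \<int>")
      case True
      then show ?thesis
        using int by (auto elim: Ints_cases)
    next
      case False
      show ?thesis
      proof (rule step)
        show "x \<in> nadic n"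
          using Suc.prems n nadic_iff_scaled by blast
        show "P (pl_gen n \<lfloor>x\<rfloor> x)"
          using Suc pl_gen_floor_scaled_iff by blast
      qed (rule False)
    qed
  qed
qed

definition F_gens :: "nat \<Rightarrow> (real \<Rightarrow> real) set" where
  "F_gens n = insert (transl (real n - 1)) (range (pl_gen n))"

lemma F_gens_B_R: "n \<ge> 2 \<Longrightarrow> F_gens n \<subseteq> B_R n"
  using transl_B_R[of n 1] pl_gen_B_R by (auto simp: F_gens_def)

lemma F_inf_eq:
  assumes "n \<ge> 2"
  shows "F_inf n = generate homeo_group (F_gens n)"
  unfolding F_inf_def F_gens_def[symmetric]
  using assms by (intro homeo.generate_consistent F_gens_B_R B_R_subgroup)

lemma F_inf_subgroup: "n \<ge> 2 \<Longrightarrow> subgroup (F_inf n) homeo_group"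
  using F_gens_B_R[of n] homeo_subgroupD(1)[OF B_R_subgroup[of n]]
  by (subst F_inf_eq) (auto intro!: homeo.generate_is_subgroup)

lemma F_inf_subset_B_R: "n \<ge> 2 \<Longrightarrow> F_inf n \<subseteq> B_R n"
  by (simp add: F_inf_eq F_gens_B_R B_R_subgroup homeo.generate_subgroup_incl)

lemma F_inf_induct [consumes 2, case_names id gen inv comp]:
  assumes n: "n \<ge> 2" and f: "f \<in> F_inf n"
    and "P id" and gen: "\<And>g. g \<in> F_gens n \<Longrightarrow> P g"
    and inverse: "\<And>g. g \<in> F_gens n \<Longrightarrow> P g \<Longrightarrow> P (finv g)"
    and comp: "\<And>f g. f \<in> F_inf n \<Longrightarrow> g \<in> F_inf n \<Longrightarrow> P f \<Longrightarrow> P g \<Longrightarrow> P (g \<circ> f)"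
  shows "P f"
proof -
  have "f \<in> generate homeo_group (F_gens n)"
    using f F_inf_eq[OF n] by simp
  then show ?thesis
  proof induction
    case one
    show ?case
      unfolding one_homeo_group by (rule assms(3))
  next
    case (incl h)
    then show ?case
      by (rule gen)
  next
    case (inv h)
    then have "h \<in> homeos"
      using F_gens_B_R[OF n] homeo_subgroupD(1)[OF B_R_subgroup[OF n]] by blast
    then show ?case
      using inverse[OF inv gen[OF inv]] by simp
  next
    case (eng h1 h2)
    then show ?case
      unfolding mult_homeo_group F_inf_eq[OF n, symmetric] by (intro comp)
  qed
qed

lemma F_inf_homeos: "n \<ge> 2 \<Longrightarrow> f \<in> F_inf n \<Longrightarrow> f \<in> homeos"
  using homeo_subgroupD(1)[OF F_inf_subgroup] by blast

lemma F_inf_id: "n \<ge> 2 \<Longrightarrow> id \<in> F_inf n"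
  using homeo_subgroupD(2)[OF F_inf_subgroup] .

lemma F_inf_comp: "n \<ge> 2 \<Longrightarrow> f \<in> F_inf n \<Longrightarrow> g \<in> F_inf n \<Longrightarrow> g \<circ> f \<in> F_inf n"
  using homeo_subgroupD(3)[OF F_inf_subgroup] .

lemma F_inf_finv: "n \<ge> 2 \<Longrightarrow> f \<in> F_inf n \<Longrightarrow> finv f \<in> F_inf n"
  using homeo_subgroupD(4)[OF F_inf_subgroup] .

lemma F_gens_F_inf: "n \<ge> 2 \<Longrightarrow> F_gens n \<subseteq> F_inf n"
  by (auto simp: F_inf_eq intro: generate.incl)

lemma pl_gen_F_inf: "n \<ge> 2 \<Longrightarrow> pl_gen n i \<in> F_inf n"
  using F_gens_F_inf by (auto simp: F_gens_def)

lemma transl_F_inf: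
  assumes n: "n \<ge> 2"
  shows "transl ((real n - 1) * of_int a) \<in> F_inf n"
proof -
  have t: "transl (real n - 1) \<in> F_inf n"
    using F_gens_F_inf[OF n] by (auto simp: F_gens_def)
  have pos: "transl ((real n - 1) * of_nat k) \<in> F_inf n" for k
  proof (induction k)
    case 0
    then show ?case
      using F_inf_id[OF n] by (simp add: transl_def[abs_def] id_def)
  next
    case (Suc k)
    have "transl (real n - 1) \<circ> transl ((real n - 1) * of_nat k) = transl ((real n - 1) * of_nat (Suc k))"
      by (auto simp: transl_def algebra_simps)
    then show ?case
      using F_inf_comp[OF n Suc t] by simp
  qed
  show ?thesis
  proof (cases "a \<ge> 0")
    case True
    then show ?thesis
      using pos[of "nat a"] by simp
  next
    case False
    have "transl ((real n - 1) * of_int a) = finv (transl ((real n - 1) * of_nat (nat (-a))))"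
      using False by (simp add: finv_transl)
    then show ?thesis
      using F_inf_finv[OF n pos] by simp
  qed
qed

lemma B_R_znadic_iff:
  assumes n: "n \<ge> 2" and f: "f \<in> B_R n"
  shows "f x \<in> znadic n \<longleftrightarrow> x \<in> znadic n"
proof -
  have 1: "g y \<in> znadic n" if "y \<in> znadic n" "g \<in> B_R n" for g y
  proof -
    have "(g y - y) + y \<in> znadic n"
      using that n znadic_nadic[of n y] by (intro znadic_add) (auto simp: B_R_iff)
    then show ?thesis
      by simp
  qed
  have "f \<in> homeos" "finv f \<in> B_R n"
    using homeo_subgroupD[OF B_R_subgroup[OF n]] f by auto
  then show ?thesis
    using 1[of x f] 1[of "f x" "finv f"] f by auto
qed

lemma F_inf_znadic_iff: "n \<ge> 2 \<Longrightarrow> f \<in> F_inf n \<Longrightarrow> f x \<in> znadic n \<longleftrightarrow> x \<in> znadic n"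
  using B_R_znadic_iff F_inf_subset_B_R by blast

lemma F_inf_orbit_0:
  assumes n: "n \<ge> 2" and z: "z \<in> znadic n"
  shows "\<exists>f\<in>F_inf n. f 0 = z"
proof -
  have n1: "n \<ge> 1"
    using n by simp
  have "z \<in> znadic n \<longrightarrow> (\<exists>f\<in>F_inf n. f 0 = z)" if "z \<in> nadic n" for z
    using n1 that
  proof (induction rule: nadic_induct)
    case (int a)
    show ?case
    proof
      assume "of_int a \<in> znadic n"
      then obtain b where "a = (int n - 1) * b"
        using znadic_of_int_iff[OF n] by (auto elim: dvdE)
      then show "\<exists>f\<in>F_inf n. f 0 = of_int a"
        using transl_F_inf[OF n, of b] by (intro bexI[of _ "transl ((real n - 1) * of_int b)"]) (auto simp: transl_def)
    qed
  next
    case (step x)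
    show ?case
    proof
      assume "x \<in> znadic n"
      then obtain f where f: "f \<in> F_inf n" "f 0 = pl_gen n \<lfloor>x\<rfloor> x"
        using step F_inf_znadic_iff[OF n pl_gen_F_inf[OF n]] by blast
      have "(finv (pl_gen n \<lfloor>x\<rfloor>) \<circ> f) 0 = x"
        using f pl_gen_homeos[of n] n by simp
      then show "\<exists>f\<in>F_inf n. f 0 = x"
        using F_inf_comp[OF n f(1) F_inf_finv[OF n pl_gen_F_inf[OF n]]] by blast
    qed
  qed
  then show ?thesis
    using z znadic_nadic[of n z] n by auto
qed

section \<open>The group \<open>B\<^sub>n(\<real>)\<close> is locally \<open>F\<^bsub>n,\<infinity>\<^esub>\<close>\<close>

text \<open>Expand successively the unit intervals that contain the given \<open>n\<close>-adic interval.\<close>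

lemma F_inf_expand_interval:
  assumes n: "n \<ge> 2"
  shows "\<exists>g\<in>F_inf n. \<exists>i::int. \<forall>y\<in>{of_int j / real n ^ l..(of_int j + 1) / real n ^ l}.
    g y = of_int i + real n ^ l * (y - of_int j / real n ^ l)"
proof (induction l arbitrary: j)
  case 0
  then show ?case
    using F_inf_id[OF n] by (intro bexI[of _ id] exI[of _ j]) auto
next
  case (Suc l)
  define i0 where "i0 = j div int n ^ Suc l"
  define j' where "j' = j - i0 * int n ^ Suc l + i0 * int n ^ l"
  obtain g i where g: "g \<in> F_inf n" "\<forall>y\<in>{of_int j' / real n ^ l..(of_int j' + 1) / real n ^ l}.
    g y = of_int i + real n ^ l * (y - of_int j' / real n ^ l)"
    using Suc.IH by blast
  have npos: "real n ^ k > 0" for k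
    using n by simp
  have i0: "i0 * int n ^ Suc l \<le> j" "j + 1 \<le> (i0 + 1) * int n ^ Suc l"
  proof -
    have N: "int n ^ Suc l > 0"
      using n by simp
    have *: "j = i0 * int n ^ Suc l + j mod int n ^ Suc l"
      using div_mult_mod_eq[of j "int n ^ Suc l"] by (simp only: i0_def)
    have "0 \<le> j mod int n ^ Suc l" "j mod int n ^ Suc l < int n ^ Suc l"
      using N by simp_all
    with * show "i0 * int n ^ Suc l \<le> j" "j + 1 \<le> (i0 + 1) * int n ^ Suc l"
      by (auto simp: algebra_simps)
  qed
  have i0r: "of_int i0 * real n ^ Suc l \<le> of_int j" "of_int j + 1 \<le> (of_int i0 + 1) * real n ^ Suc l"
    using i0[THEN of_int_le_iff[where 'a = real, THEN iffD2]] by simp_all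
  have "(g \<circ> pl_gen n i0) y = of_int i + real n ^ Suc l * (y - of_int j / real n ^ Suc l)"
    if y: "y \<in> {of_int j / real n ^ Suc l..(of_int j + 1) / real n ^ Suc l}" for y
  proof -
    have y': "of_int j \<le> y * real n ^ Suc l" "y * real n ^ Suc l \<le> of_int j + 1"
      using y npos[of "Suc l"] by (simp_all only: atLeastAtMost_iff pos_divide_le_eq pos_le_divide_eq)
    have "of_int i0 * real n ^ Suc l \<le> y * real n ^ Suc l" "y * real n ^ Suc l \<le> (of_int i0 + 1) * real n ^ Suc l"
      using y' i0r by linarith+
    then have "of_int i0 \<le> y" "y \<le> of_int i0 + 1"
      using npos[of "Suc l"] mult_le_cancel_right_pos by blast+
    then have p: "pl_gen n i0 y = of_int i0 + real n * (y - of_int i0)"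
      by (rule pl_gen_simps)
    have eq: "pl_gen n i0 y * real n ^ l = y * real n ^ Suc l + (of_int j' - of_int j)"
      by (simp add: p j'_def algebra_simps)
    have "of_int j' \<le> pl_gen n i0 y * real n ^ l" "pl_gen n i0 y * real n ^ l \<le> of_int j' + 1"
      using eq y' by linarith+
    then have "pl_gen n i0 y \<in> {of_int j' / real n ^ l..(of_int j' + 1) / real n ^ l}"
      using npos[of l] by (simp only: atLeastAtMost_iff pos_divide_le_eq pos_le_divide_eq)
    then have "g (pl_gen n i0 y) = of_int i + real n ^ l * (pl_gen n i0 y - of_int j' / real n ^ l)"
      using g by blast
    also have "\<dots> = of_int i + (pl_gen n i0 y * real n ^ l - of_int j')"
      using npos[of l] by (simp add: algebra_simps)
    also have "\<dots> = of_int i + real n ^ Suc l * (y - of_int j / real n ^ Suc l)"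
      unfolding eq using npos[of "Suc l"] n by (simp add: field_simps)
    finally show ?thesis
      by simp
  qed
  then show ?case
    using F_inf_comp[OF n pl_gen_F_inf[OF n] g(1)] by blast
qed

text \<open>Around an \<open>n\<close>-adic point the same expansions are affine on both sides, because the point stays
  in the interior of the expanded interval until it becomes an integer.\<close>

lemma F_inf_expand_nadic:
  assumes n: "n \<ge> 2" and x: "x \<in> nadic n"
  shows "\<exists>g\<in>F_inf n. \<exists>(i::int) c. g x = of_int i \<and> germ n g x c c"
proof -
  have "n \<ge> 1"
    using n by simp
  then show ?thesis
    using x
  proof (induction rule: nadic_induct)
    case (int a)
    have "germ n id (of_int a) 0 0"
      by (rule germ_affine[where b=0]) simp
    then show ?case
      using F_inf_id[OF n] by (metis id_apply)
  next
    case (step x)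
    then obtain g i c where g: "g \<in> F_inf n" "g (pl_gen n \<lfloor>x\<rfloor> x) = of_int i" "germ n g (pl_gen n \<lfloor>x\<rfloor> x) c c"
      by blast
    have "of_int \<lfloor>x\<rfloor> < x"
      using step by (metis Ints_of_int linorder_not_le of_int_floor_le order_antisym_conv)
    then have "germ n (pl_gen n \<lfloor>x\<rfloor>) x 1 1"
      by (intro germ_pl_gen) auto
    then have "germ n (g \<circ> pl_gen n \<lfloor>x\<rfloor>) x (1 + c) (1 + c)"
      using n g by (intro germ_comp pl_gen_homeos) auto
    then show ?case
      using g F_inf_comp[OF n pl_gen_F_inf[OF n] g(1)] by (metis comp_apply)
  qed
qed

text \<open>At an integer \<open>i\<close> the generators with indices \<open>i\<close> and \<open>i - 1\<close> have independent one-sided slopes,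
  so all pairs of one-sided slopes occur among elements fixing \<open>i\<close>.\<close>

lemma F_inf_germ_int:
  fixes i :: int
  assumes n: "n \<ge> 2"
  shows "\<exists>g\<in>F_inf n. g (of_int i) = of_int i \<and> germ n g (of_int i) a b"
proof -
  define P where "P a b \<longleftrightarrow> (\<exists>g\<in>F_inf n. g (of_int i) = of_int i \<and> germ n g (of_int i) a b)" for a b
  have plus: "P (a + a') (b + b')" if "P a b" "P a' b'" for a b a' b'
  proof -
    obtain f g where fg: "f \<in> F_inf n" "f (of_int i) = of_int i" "germ n f (of_int i) a b"
      "g \<in> F_inf n" "g (of_int i) = of_int i" "germ n g (of_int i) a' b'"
      using \<open>P a b\<close> \<open>P a' b'\<close> unfolding P_def by blast
    have "germ n (g \<circ> f) (of_int i) (a + a') (b + b')"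
      using fg n F_inf_homeos[OF n] by (intro germ_comp) auto
    then show ?thesis
      using F_inf_comp[OF n fg(1,4)] fg unfolding P_def by (metis comp_apply)
  qed
  have minus: "P (- a) (- b)" if "P a b" for a b
  proof -
    obtain f where f: "f \<in> F_inf n" "f (of_int i) = of_int i" "germ n f (of_int i) a b"
      using \<open>P a b\<close> unfolding P_def by blast
    have "germ n (finv f) (of_int i) (- a) (- b)"
      using germ_finv[OF _ F_inf_homeos[OF n f(1)] f(3)] n f by simp
    then show ?thesis
      using F_inf_finv[OF n f(1)] f homeos_inv_apply[OF F_inf_homeos[OF n f(1)], of "of_int i"]
      unfolding P_def by metis
  qed
  have "P 0 0"
    using F_inf_id[OF n] germ_affine[of id n 0 0 "of_int i"] unfolding P_def by (intro bexI[of _ id]) auto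
  have "P 0 1"
    using pl_gen_F_inf[OF n, of i] germ_pl_gen(1)[of n i] unfolding P_def
    by (intro bexI[of _ "pl_gen n i"]) (auto simp: pl_gen_simps)
  have "P 1 0"
  proof -
    have t: "transl ((real n - 1) * of_int (-1)) \<in> F_inf n"
      using transl_F_inf[OF n] .
    have "germ n (transl ((real n - 1) * of_int (-1))) y 0 0" for y
      by (rule germ_affine[where b = "1 - real n"]) (simp add: transl_def)
    then have "germ n (transl ((real n - 1) * of_int (-1)) \<circ> pl_gen n (i - 1)) (of_int (i - 1) + 1) (1 + 0) (0 + 0)"
      using n by (intro germ_comp germ_pl_gen pl_gen_homeos) auto
    then show ?thesis
      using F_inf_comp[OF n pl_gen_F_inf[OF n] t, of "i - 1"] unfolding P_def
      by (intro bexI[of _ "transl ((real n - 1) * of_int (-1)) \<circ> pl_gen n (i - 1)"])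
         (auto simp: transl_def pl_gen_simps)
  qed
  have r: "P 0 b" for b
  proof (induction b rule: int_induct[of _ 0])
    case (step2 c)
    then show ?case
      using plus[OF step2(2) minus[OF \<open>P 0 1\<close>]] by simp
  qed (use \<open>P 0 0\<close> plus[OF _ \<open>P 0 1\<close>] in \<open>auto simp: algebra_simps, fastforce?\<close>)
  have l: "P a 0" for a
  proof (induction a rule: int_induct[of _ 0])
    case (step2 c)
    then show ?case
      using plus[OF step2(2) minus[OF \<open>P 1 0\<close>]] by simp
  qed (use \<open>P 0 0\<close> plus[OF _ \<open>P 1 0\<close>] in \<open>auto simp: algebra_simps, fastforce?\<close>)
  have "P a b"
    using plus[OF l[of a] r[of b]] by simp
  then show ?thesis
    by (simp add: P_def)
qed

lemma germ_eqI:
  assumes "germ n f x k l" "germ n g x k l" "f x = g x"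
  shows "\<forall>\<^sub>F y in nhds x. f y = g y"
  using assms(1,2) unfolding germ_def by eventually_elim (use assms(3) in auto)

lemma znadic_int_diffE:
  assumes "n \<ge> 2" "of_int i - of_int j \<in> znadic n"
  obtains a where "i = j + (int n - 1) * a"
proof -
  have "of_int (i - j) \<in> znadic n"
    using assms by simp
  then have "(int n - 1) dvd (i - j)"
    using znadic_of_int_iff assms by blast
  then show ?thesis
    using that by (auto elim!: dvdE simp: algebra_simps) (metis add.commute diff_add_cancel)
qed

text \<open>Near an \<open>n\<close>-adic point, blow up source and target so that both become integers. These are
  congruent modulo \<open>n - 1\<close>, hence equal after a translation, and what remains is a germ fixing an
  integer. Any other point lies in the interior of a small \<open>n\<close>-adic interval on which the map is affine and
  whose image is again such an interval; blow up both to unit intervals.\<close>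

lemma B_R_locally_F_inf:
  assumes n: "n \<ge> 2" and f: "f \<in> B_R n"
  shows "\<exists>g\<in>F_inf n. \<forall>\<^sub>F y in nhds x. f y = g y"
proof -
  have fh: "f \<in> homeos" and fn: "\<And>x. f x \<in> nadic n \<longleftrightarrow> x \<in> nadic n"
    using f by (auto simp: B_R_iff[OF n] A_R_iff[OF n])
  obtain a b where ab: "germ n f x a b" "a \<noteq> b \<longrightarrow> x \<in> nadic n"
    using f B_R_iff[OF n] A_R_iff[OF n] nadic_germsE by metis
  note disp = B_R_iff[OF n, THEN iffD1, THEN conjunct2, rule_format]
  show ?thesis
  proof (cases "x \<in> nadic n")
    case True
    obtain g1 i1 c1 where g1: "g1 \<in> F_inf n" "g1 x = of_int i1" "germ n g1 x c1 c1"
      using F_inf_expand_nadic[OF n True] by blast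
    obtain g2 i2 c2 where g2: "g2 \<in> F_inf n" "g2 (f x) = of_int i2" "germ n g2 (f x) c2 c2"
      using F_inf_expand_nadic[OF n, of "f x"] True fn by blast
    have "((g2 (f x) - f x) + (f x - x)) - (g1 x - x) \<in> znadic n"
    proof (rule znadic_diff[OF _ znadic_add])
      show "g2 (f x) - f x \<in> znadic n" "f x - x \<in> znadic n" "g1 x - x \<in> znadic n"
        using True fn f g1(1) g2(1) F_inf_subset_B_R[OF n] by (auto intro!: disp)
    qed (use n in auto)
    then obtain k where k: "i2 = i1 + (int n - 1) * k"
      using g1 g2 by (auto intro: znadic_int_diffE[OF n])
    define T where "T = transl ((real n - 1) * of_int k)"
    have T: "T \<in> F_inf n" "germ n T y 0 0" "T (of_int i1) = of_int i2" for y
      using transl_F_inf[OF n] germ_affine[of T n 0 "(real n - 1) * of_int k" y]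
      by (auto simp: T_def transl_def k)
    obtain g3 where g3: "g3 \<in> F_inf n" "g3 (of_int i1) = of_int i1" "germ n g3 (of_int i1) (a + c2 - c1) (b + c2 - c1)"
      using F_inf_germ_int[OF n] by blast
    have 1: "germ n (g2 \<circ> f) x (a + c2) (b + c2)"
      using n fh ab g2 by (intro germ_comp) auto
    have "germ n (T \<circ> (g3 \<circ> g1)) x ((c1 + (a + c2 - c1)) + 0) ((c1 + (b + c2 - c1)) + 0)"
      using n g1 g3 T F_inf_homeos[OF n] by (intro germ_comp homeos_comp) auto
    then have 2: "germ n (T \<circ> (g3 \<circ> g1)) x (a + c2) (b + c2)"
      by simp
    have "\<forall>\<^sub>F y in nhds x. (g2 \<circ> f) y = (T \<circ> (g3 \<circ> g1)) y"
      by (rule germ_eqI[OF 1 2]) (simp add: g1 g2 g3 T)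
    then have "\<forall>\<^sub>F y in nhds x. f y = (finv g2 \<circ> (T \<circ> (g3 \<circ> g1))) y"
      by eventually_elim (metis F_inf_homeos[OF n g2(1)] comp_apply homeos_inv_apply)
    moreover have "finv g2 \<circ> (T \<circ> (g3 \<circ> g1)) \<in> F_inf n"
      using n g1 g2 g3 T by (intro F_inf_comp F_inf_finv)
    ultimately show ?thesis
      by blast
  next
    case False
    then have "germ n f x a a"
      using ab by auto
    then obtain e where e: "e > 0"
      "\<And>y. x - e \<le> y \<Longrightarrow> y \<le> x \<Longrightarrow> f y = f x + real n powi a * (y - x)"
      "\<And>y. x \<le> y \<Longrightarrow> y \<le> x + e \<Longrightarrow> f y = f x + real n powi a * (y - x)"
      using germ_interval by metis
    define \<beta> where "\<beta> = f x - real n powi a * x"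
    have fy: "f y = \<beta> + real n powi a * y" if "\<bar>y - x\<bar> \<le> e" for y
    proof (cases "y \<le> x")
      case True
      then have "f y = f x + real n powi a * (y - x)"
        using that by (intro e(2)) auto
      then show ?thesis
        by (simp add: \<beta>_def right_diff_distrib)
    next
      case False
      then have "f y = f x + real n powi a * (y - x)"
        using that by (intro e(3)) auto
      then show ?thesis
        by (simp add: \<beta>_def right_diff_distrib)
    qed
    have "\<beta> \<in> nadic n"
    proof -
      obtain z where z: "z \<in> znadic n" "x < z" "z < x + e"
        using dense_znadic[of n x "x + e"] n e(1) by auto
      then have "z \<in> nadic n"
        using znadic_nadic[of n z] n by auto
      then have "f z - real n powi a * z \<in> nadic n"
        using fn n by (intro nadic_diff nadic_mult) auto
      moreover have "f z = \<beta> + real n powi a * z"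
        using z by (intro fy) auto
      ultimately show ?thesis
        by simp
    qed
    then obtain k where k: "\<beta> * real n ^ k \<in> \<int>"
      using nadic_iff_scaled[of n] n by auto
    obtain l0 where l0: "(1 / real n) ^ l0 < e"
      using real_arch_pow_inv[of e "1 / real n"] n e(1) by auto
    \<comment> \<open>The interval around \<open>x\<close> of level \<open>l\<close> lies in the affine piece, and its image has level \<open>l2\<close>.\<close>
    define l where "l = l0 + k + nat \<bar>a\<bar>"
    define l2 where "l2 = nat (int l - a)"
    have l2: "int l2 = int l - a" "l2 \<ge> k"
      by (auto simp: l_def l2_def)
    define j where "j = \<lfloor>x * real n ^ l\<rfloor>"
    have npos: "real n ^ k > 0" for k
      using n by simp
    have le: "1 / real n ^ l < e"
    proof -
      have "(1 / real n) ^ l \<le> (1 / real n) ^ l0"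
        using n by (intro power_decreasing) (auto simp: l_def)
      then show ?thesis
        using l0 by (simp add: power_divide)
    qed
    have jx: "of_int j / real n ^ l < x" "x < (of_int j + 1) / real n ^ l"
    proof -
      have "of_int j / real n ^ l \<noteq> x"
      proof
        assume "of_int j / real n ^ l = x"
        then have "x * real n ^ l \<in> \<int>"
          using npos[of l] by auto
        then show False
          using False nadic_iff_scaled[of n x] n by auto
      qed
      moreover have "of_int j \<le> x * real n ^ l" "x * real n ^ l < of_int j + 1"
        by (auto simp: j_def)
      ultimately have "of_int j / real n ^ l \<noteq> x" "of_int j / real n ^ l \<le> x" "x < (of_int j + 1) / real n ^ l"
        using npos[of l] by (simp_all only: pos_less_divide_eq pos_divide_le_eq not_False_eq_True)
      then show "of_int j / real n ^ l < x" "x < (of_int j + 1) / real n ^ l"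
        by linarith+
    qed
    have near: "\<bar>y - x\<bar> \<le> e" if "y \<in> {of_int j / real n ^ l..(of_int j + 1) / real n ^ l}" for y
      using that jx le by (auto simp: add_divide_distrib)
    have "\<beta> * real n ^ l2 \<in> \<int>"
    proof -
      have "\<beta> * real n ^ l2 = (\<beta> * real n ^ k) * of_nat (n ^ (l2 - k))"
        using l2 by (simp add: flip: power_add)
      then show ?thesis
        using k by (metis Ints_mult Ints_of_nat)
    qed
    then obtain c where c: "\<beta> * real n ^ l2 = of_int c"
      by (auto elim: Ints_cases)
    define j2 where "j2 = c + j"
    have na: "real n powi a * real n ^ l2 = real n ^ l"
    proof -
      have "real n powi a * real n ^ l2 = real n powi (a + int l2)"
        using n by (simp add: power_int_add)
      then show ?thesis
        using l2 by simp
    qed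
    have fj: "f y * real n ^ l2 - of_int j2 = real n ^ l * (y - of_int j / real n ^ l)"
      if "y \<in> {of_int j / real n ^ l..(of_int j + 1) / real n ^ l}" for y
    proof -
      have "f y * real n ^ l2 = \<beta> * real n ^ l2 + (real n powi a * real n ^ l2) * y"
        using fy[OF near[OF that]] by (simp add: algebra_simps)
      then show ?thesis
        using npos[of l] by (simp add: c na j2_def algebra_simps)
    qed
    obtain g1 i1 where g1: "g1 \<in> F_inf n" "\<forall>y\<in>{of_int j / real n ^ l..(of_int j + 1) / real n ^ l}.
      g1 y = of_int i1 + real n ^ l * (y - of_int j / real n ^ l)"
      using F_inf_expand_interval[OF n] by blast
    obtain g2 i2 where g2: "g2 \<in> F_inf n" "\<forall>y\<in>{of_int j2 / real n ^ l2..(of_int j2 + 1) / real n ^ l2}.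
      g2 y = of_int i2 + real n ^ l2 * (y - of_int j2 / real n ^ l2)"
      using F_inf_expand_interval[OF n] by blast
    have g2f: "g2 (f y) = of_int i2 + real n ^ l * (y - of_int j / real n ^ l)"
      if y: "y \<in> {of_int j / real n ^ l..(of_int j + 1) / real n ^ l}" for y
    proof -
      have "0 \<le> real n ^ l * (y - of_int j / real n ^ l)" "real n ^ l * (y - of_int j / real n ^ l) \<le> 1"
      proof -
        have "real n ^ l * (y - of_int j / real n ^ l) = y * real n ^ l - of_int j"
          using npos[of l] by (simp add: right_diff_distrib)
        moreover have "of_int j \<le> y * real n ^ l" "y * real n ^ l \<le> of_int j + 1"
          using y npos[of l] by (simp_all only: atLeastAtMost_iff pos_divide_le_eq pos_le_divide_eq)
        ultimately show "0 \<le> real n ^ l * (y - of_int j / real n ^ l)" "real n ^ l * (y - of_int j / real n ^ l) \<le> 1"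
          by linarith+
      qed
      then have "of_int j2 \<le> f y * real n ^ l2" "f y * real n ^ l2 \<le> of_int j2 + 1"
        using fj[OF y] by linarith+
      then have "f y \<in> {of_int j2 / real n ^ l2..(of_int j2 + 1) / real n ^ l2}"
        using npos[of l2] by (simp only: atLeastAtMost_iff pos_divide_le_eq pos_le_divide_eq)
      then have "g2 (f y) = of_int i2 + real n ^ l2 * (f y - of_int j2 / real n ^ l2)"
        using g2 by blast
      also have "\<dots> = of_int i2 + (f y * real n ^ l2 - of_int j2)"
        using npos[of l2] by (simp add: algebra_simps)
      finally show ?thesis
        using fj[OF y] by simp
    qed
    define x0 where "x0 = of_int j / real n ^ l"
    have x0: "x0 \<in> {of_int j / real n ^ l..(of_int j + 1) / real n ^ l}"
      using npos[of l] by (auto simp: x0_def divide_right_mono)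
    have x0n: "x0 \<in> nadic n"
      using nadic_iff_scaled[of n x0] n npos[of l] by (auto simp: x0_def intro!: exI[of _ l])
    have "g1 x0 = of_int i1" "g2 (f x0) = of_int i2"
      using g1 g2f x0 by (auto simp: x0_def)
    moreover have "((g2 (f x0) - f x0) + (f x0 - x0)) - (g1 x0 - x0) \<in> znadic n"
    proof (rule znadic_diff[OF _ znadic_add])
      show "g2 (f x0) - f x0 \<in> znadic n" "f x0 - x0 \<in> znadic n" "g1 x0 - x0 \<in> znadic n"
        using x0n fn f g1(1) g2(1) F_inf_subset_B_R[OF n] by (auto intro!: disp)
    qed (use n in auto)
    ultimately obtain k where k: "i2 = i1 + (int n - 1) * k"
      by (auto intro: znadic_int_diffE[OF n])
    define T where "T = transl ((real n - 1) * of_int k)"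
    have "f y = (finv g2 \<circ> (T \<circ> g1)) y" if "y \<in> {of_int j / real n ^ l<..<(of_int j + 1) / real n ^ l}" for y
    proof -
      have "g2 (f y) = T (g1 y)"
        using g2f[of y] g1(2) that by (auto simp: T_def transl_def k)
      then show ?thesis
        by (metis F_inf_homeos[OF n g2(1)] comp_apply homeos_inv_apply)
    qed
    then have "\<forall>\<^sub>F y in nhds x. f y = (finv g2 \<circ> (T \<circ> g1)) y"
      unfolding eventually_nhds
      by (intro exI[of _ "{of_int j / real n ^ l<..<(of_int j + 1) / real n ^ l}"]) (use jx in auto)
    moreover have "finv g2 \<circ> (T \<circ> g1) \<in> F_inf n"
      using n g1 g2 unfolding T_def by (intro F_inf_comp F_inf_finv transl_F_inf)
    ultimately show ?thesis
      by blast
  qed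
qed

lemma locally_F_inf_B_R:
  assumes n: "n \<ge> 2" and f: "f \<in> homeos" and loc: "\<And>x. \<exists>g\<in>F_inf n. \<forall>\<^sub>F y in nhds x. f y = g y"
  shows "f \<in> B_R n"
proof -
  have "(\<exists>k l. germ n f x k l \<and> (k \<noteq> l \<longrightarrow> x \<in> nadic n)) \<and> (f x \<in> nadic n \<longleftrightarrow> x \<in> nadic n) \<and>
      (x \<in> nadic n \<longrightarrow> f x - x \<in> znadic n)" for x
  proof -
    obtain g where g: "g \<in> F_inf n" "\<forall>\<^sub>F y in nhds x. f y = g y"
      using loc by blast
    then have "g \<in> B_R n" "f x = g x"
      using F_inf_subset_B_R[OF n] eventually_nhds_x_imp_x[OF g(2)] by auto
    then show ?thesis
      using germ_cong[OF g(2)] by (simp add: B_R_iff[OF n] A_R_iff[OF n] nadic_germs_def)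
  qed
  then show ?thesis
    using f by (auto simp: B_R_iff[OF n] A_R_iff[OF n] nadic_germs_def)
qed

text \<open>Being locally in \<open>F\<^bsub>n,\<infinity>\<^esub>\<close> is preserved under conjugation by any homeomorphism that normalizes
  \<open>F\<^bsub>n,\<infinity>\<^esub>\<close>; so the normalizer of \<open>F\<^bsub>n,\<infinity>\<^esub>\<close> lies in that of \<open>B\<^sub>n(\<real>)\<close>.\<close>

lemma conj_by_preserves_B_R:
  assumes n: "n \<ge> 2" and h: "h \<in> homeos" and F: "\<And>f. f \<in> F_inf n \<Longrightarrow> conj_by h f \<in> F_inf n"
    and f: "f \<in> B_R n"
  shows "conj_by h f \<in> B_R n"
proof (rule locally_F_inf_B_R[OF n])
  have "f \<in> homeos"
    using f homeo_subgroupD(1)[OF B_R_subgroup[OF n]] by blast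
  then show "conj_by h f \<in> homeos"
    using h by (rule conj_by_homeos[rotated])
  fix x
  obtain g where g: "g \<in> F_inf n" "\<forall>\<^sub>F y in nhds (finv h x). f y = g y"
    using B_R_locally_F_inf[OF n f] by blast
  have "\<forall>\<^sub>F y in nhds x. f (finv h y) = g (finv h y)"
    using eventually_nhds_homeo[OF homeos_inv[OF h] g(2)] .
  then have "\<forall>\<^sub>F y in nhds x. conj_by h f y = conj_by h g y"
    by eventually_elim (simp add: conj_by_eq h)
  then show "\<exists>g\<in>F_inf n. \<forall>\<^sub>F y in nhds x. conj_by h f y = g y"
    using F[OF g(1)] by blast
qed

text \<open>Commuting with the translation forces a homeomorphism to be increasing, commuting with \<open>g\<^bsub>n,0\<^esub>\<close>, whose
  fixed points are those of \<open>(-\<infinity>, 0]\<close>, forces it to fix \<open>0\<close>; then it fixes the orbit of \<open>0\<close> pointwise, which is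
  dense.\<close>

lemma centralizer_F_inf:
  assumes n: "n \<ge> 2" and k: "k \<in> homeos" and comm: "\<And>f. f \<in> F_inf n \<Longrightarrow> conj_by k f = f"
  shows "k = id"
proof -
  have c: "k (f x) = f (k x)" if "f \<in> F_inf n" for f x
    using conj_by_apply[OF k, of f x] comm[OF that] by simp
  have mono: "strict_mono k"
    using c[OF transl_F_inf[OF n, of 1]] n
    by (intro homeos_commute_translation_mono[OF k, of "real n - 1"]) (auto simp: transl_def)
  have fix0: "y \<le> 0" if "pl_gen n 0 y = y" for y
  proof (rule ccontr)
    assume y: "\<not> y \<le> 0"
    have "pl_gen n 0 y > y"
    proof (cases "y \<le> 1")
      case True
      have "1 * y < real n * y"
        using y n by (intro mult_strict_right_mono) auto
      then show ?thesis
        using True y by (simp add: pl_gen_simps)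
    qed (use n in \<open>simp add: pl_gen_simps\<close>)
    then show False
      using that by simp
  qed
  have "k 0 = 0"
  proof (rule antisym)
    show "k 0 \<le> 0"
      using c[OF pl_gen_F_inf[OF n], of 0 0] by (intro fix0) (simp add: pl_gen_simps)
    have "k (pl_gen n 0 (finv k 0)) = k (finv k 0)"
      using c[OF pl_gen_F_inf[OF n], of 0 "finv k 0"] k by (simp add: pl_gen_simps)
    then have "finv k 0 \<le> 0"
      using mono by (intro fix0) (simp add: strict_mono_eq)
    then have "k (finv k 0) \<le> k 0"
      using mono by (simp add: strict_mono_less_eq)
    then show "0 \<le> k 0"
      using k by simp
  qed
  then have "k x = id x" if "x \<in> znadic n" for x
    using F_inf_orbit_0[OF n that] c by force
  then show ?thesis
    using homeos_eq_on_dense[OF k homeos_id closure_znadic[OF n]] by blast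
qed

section \<open>Blowing up the orbit of \<open>0\<close>\<close>

text \<open>The number of expansions of unit intervals after which \<open>x\<close> becomes an integer.\<close>

definition level :: "nat \<Rightarrow> real \<Rightarrow> nat" where
  "level m x = (LEAST k. x * real m ^ k \<in> \<int>)"

lemma level_Ints: "x \<in> \<int> \<Longrightarrow> level m x = 0"
  unfolding level_def by (rule Least_eq_0) simp

lemma level_pl_gen:
  assumes "m \<ge> 1" "x \<in> nadic m" "x \<notin> \<int>"
  shows "level m x = Suc (level m (pl_gen m \<lfloor>x\<rfloor> x))"
proof -
  obtain k where "x * real m ^ k \<in> \<int>"
    using assms nadic_iff_scaled by blast
  then show ?thesis
    unfolding level_def pl_gen_floor_scaled_iff by (rule Least_Suc) (use assms in simp)
qed

lemma level_add_int: "level m (x + of_int a) = level m x"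
proof -
  have "(x + of_int a) * real m ^ k \<in> \<int> \<longleftrightarrow> x * real m ^ k \<in> \<int>" for k
  proof -
    have "(x + of_int a) * real m ^ k = x * real m ^ k + of_int (a * int m ^ k)"
      by (simp add: algebra_simps)
    then show ?thesis
      by (metis Ints_add Ints_diff Ints_of_int add_diff_cancel_right')
  qed
  then show ?thesis
    by (simp add: level_def)
qed

lemma pl_gen_znadic_iff: "n \<ge> 2 \<Longrightarrow> pl_gen n i x \<in> znadic n \<longleftrightarrow> x \<in> znadic n"
  by (simp add: F_inf_znadic_iff pl_gen_F_inf)

lemma pl_gen_add_int:
  "pl_gen m (i + a) (x + of_int a) = pl_gen m i x + of_int a"
  by (simp add: pl_gen_def algebra_simps)

lemma not_Ints_floor_less: "x \<notin> \<int> \<Longrightarrow> of_int \<lfloor>x\<rfloor> < (x::real)"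
  by (metis Ints_of_int linorder_not_le of_int_floor_le order_antisym_conv)

locale gap_pair =
  fixes m n :: nat
  assumes m2: "2 \<le> m" and mn: "m < n"
begin

lemma n2: "2 \<le> n"
  using m2 mn by simp

lemma m1: "1 \<le> m" and n1: "1 \<le> n"
  using m2 mn by auto

text \<open>In every period of \<open>m - 1\<close> unit intervals the line on which \<open>F\<^bsub>m,\<infinity>\<^esub>\<close> acts is cut open, at
  its multiples of \<open>m - 1\<close>, and a gap of length \<open>n - m\<close> is inserted to the left of the cut. Then \<open>[i, i + 1]\<close> becomes
  \<open>[unit_pos i, unit_pos i + 1]\<close>.\<close>

definition unit_pos :: "int \<Rightarrow> int" where
  "unit_pos i = i + (int n - int m) * (i div (int m - 1))"

lemma unit_pos_shift: "unit_pos (i + (int m - 1) * a) = unit_pos i + (int n - 1) * a"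
proof -
  have "(i + (int m - 1) * a) div (int m - 1) = a + i div (int m - 1)"
    using m2 by (subst div_mult_self2) auto
  then show ?thesis
    by (simp add: unit_pos_def algebra_simps)
qed

lemma unit_pos_mult: "unit_pos ((int m - 1) * a) = (int n - 1) * a"
  using unit_pos_shift[of 0 a] by (simp add: unit_pos_def)

lemma unit_pos_mono: "i \<le> j \<Longrightarrow> unit_pos i \<le> unit_pos j"
  unfolding unit_pos_def using m2 mn
  by (intro add_mono mult_left_mono zdiv_mono1) auto

lemma unit_pos_less: "i < j \<Longrightarrow> unit_pos i + 1 \<le> unit_pos j"
proof -
  assume "i < j"
  then have "(int n - int m) * (i div (int m - 1)) \<le> (int n - int m) * (j div (int m - 1))"
    using m2 mn by (intro mult_left_mono zdiv_mono1) auto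
  then show ?thesis
    using \<open>i < j\<close> by (simp add: unit_pos_def)
qed

lemma unit_pos_less_gap:
  assumes "i < j" "(int m - 1) dvd j"
  shows "unit_pos i + 1 \<le> unit_pos j - (int n - int m)"
proof -
  have "i div (int m - 1) \<le> (j - 1) div (int m - 1)"
    using assms m2 by (intro zdiv_mono1) auto
  also have "(j - 1) div (int m - 1) < j div (int m - 1)"
  proof (rule ccontr)
    assume "\<not> (j - 1) div (int m - 1) < j div (int m - 1)"
    then have "(int m - 1) * (j div (int m - 1)) \<le> (int m - 1) * ((j - 1) div (int m - 1))"
      using m2 by (intro mult_left_mono) auto
    also have "\<dots> \<le> j - 1"
      using m2 mult_div_mod_eq[of "int m - 1" "j - 1"] pos_mod_sign[of "int m - 1" "j - 1"] by linarith
    finally show False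
      using assms(2) by simp
  qed
  finally have "(int n - int m) * (i div (int m - 1) + 1) \<le> (int n - int m) * (j div (int m - 1))"
    using mn by (intro mult_left_mono) auto
  then show ?thesis
    using assms(1) by (simp add: unit_pos_def algebra_simps)
qed

lemma unit_pos_cover:
  obtains i where "j = unit_pos i" | a where "(int n - 1) * a - (int n - int m) \<le> j" "j < (int n - 1) * a"
proof -
  define a where "a = j div (int n - 1)"
  define r where "r = j mod (int n - 1)"
  have j: "j = (int n - 1) * a + r" and r: "0 \<le> r" "r < int n - 1"
    using n2 by (auto simp: a_def r_def)
  show ?thesis
  proof (cases "r < int m - 1")
    case True
    then have "unit_pos (r + (int m - 1) * a) = j"
      unfolding unit_pos_shift using r by (simp add: unit_pos_def j)
    then show ?thesis
      using that(1) by metis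
  next
    case False
    then show ?thesis
      using r j by (intro that(2)[of "a + 1"]) (auto simp: algebra_simps)
  qed
qed

text \<open>The right end of the gap inserted at the point \<open>p\<close> of the orbit of \<open>0\<close>, and the scale of that
  gap: expanding \<open>[i, i + 1]\<close> by \<open>m\<close> below corresponds to expanding \<open>[unit_pos i, unit_pos i + 1]\<close> by
  \<open>n\<close> above.\<close>

function gap_end :: "real \<Rightarrow> real" where
  "gap_end p = (if p \<in> nadic m \<and> p \<notin> \<int>
     then of_int (unit_pos \<lfloor>p\<rfloor>) + (gap_end (pl_gen m \<lfloor>p\<rfloor> p) - of_int (unit_pos \<lfloor>p\<rfloor>)) / real n
     else of_int (unit_pos \<lfloor>p\<rfloor>))"
  by auto
termination
  by (relation "Wellfounded.measure (level m)") (auto simp: level_pl_gen[OF m1])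

declare gap_end.simps [simp del]

definition gap_scale :: "real \<Rightarrow> real" where
  "gap_scale p = real n powi (- int (level m p))"

definition gap_point :: "real \<Rightarrow> real \<Rightarrow> real" where
  "gap_point p v = gap_end p + gap_scale p * v"

abbreviation gap_width :: real where
  "gap_width \<equiv> real n - real m"

lemma gap_end_int: "gap_end (of_int i) = of_int (unit_pos i)"
  by (subst gap_end.simps) simp

lemma gap_end_step:
  "p \<in> nadic m \<Longrightarrow> p \<notin> \<int> \<Longrightarrow>
   gap_end p = of_int (unit_pos \<lfloor>p\<rfloor>) + (gap_end (pl_gen m \<lfloor>p\<rfloor> p) - of_int (unit_pos \<lfloor>p\<rfloor>)) / real n"
  by (subst gap_end.simps) simp

lemma gap_scale_int [simp]: "gap_scale (of_int i) = 1"
  by (simp add: gap_scale_def level_Ints)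

lemma gap_scale_pos [simp]: "gap_scale p > 0"
  using n2 by (simp add: gap_scale_def)

lemma gap_scale_step:
  "p \<in> nadic m \<Longrightarrow> p \<notin> \<int> \<Longrightarrow> gap_scale p = gap_scale (pl_gen m \<lfloor>p\<rfloor> p) / real n"
  using n2 level_pl_gen[OF m1, of p]
  by (simp add: gap_scale_def power_int_minus power_int_of_nat divide_inverse del: of_nat_Suc)

lemma gap_scale_add_int: "gap_scale (p + of_int a) = gap_scale p"
  by (simp add: gap_scale_def level_add_int)

lemma gap_end_shift:
  assumes "p \<in> nadic m"
  shows "gap_end (p + of_int ((int m - 1) * a)) = gap_end p + of_int ((int n - 1) * a)"
  using m1 assms
proof (induction rule: nadic_induct)
  case (int i)
  have "gap_end (of_int (i + (int m - 1) * a)) = of_int (unit_pos i + (int n - 1) * a)"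
    by (simp only: gap_end_int unit_pos_shift)
  then show ?case
    by (simp only: of_int_add gap_end_int)
next
  case (step p)
  define c where "c = (int m - 1) * a"
  have fl: "\<lfloor>p + of_int c\<rfloor> = \<lfloor>p\<rfloor> + c"
    by simp
  have c: "p + of_int c \<in> nadic m" "p + of_int c \<notin> \<int>"
    using step nadic_add[OF m1, of p "of_int c"] Ints_diff[of "p + of_int c" "of_int c"] by auto
  have "unit_pos (\<lfloor>p\<rfloor> + c) = unit_pos \<lfloor>p\<rfloor> + (int n - 1) * a"
    by (simp add: c_def unit_pos_shift)
  then have "gap_end (p + of_int c) = of_int (unit_pos \<lfloor>p\<rfloor> + (int n - 1) * a) +
      (gap_end (pl_gen m \<lfloor>p\<rfloor> p + of_int c) - of_int (unit_pos \<lfloor>p\<rfloor> + (int n - 1) * a)) / real n"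
    using gap_end_step[OF c] by (simp only: fl pl_gen_add_int)
  moreover have "gap_end (pl_gen m \<lfloor>p\<rfloor> p + of_int c) = gap_end (pl_gen m \<lfloor>p\<rfloor> p) + of_int ((int n - 1) * a)"
    using step.IH by (simp only: c_def)
  ultimately show ?case
    unfolding gap_end_step[OF step.hyps] c_def[symmetric] by simp
qed

lemma gap_point_shift:
  assumes "p \<in> nadic m"
  shows "gap_point (p + of_int ((int m - 1) * a)) v = gap_point p v + of_int ((int n - 1) * a)"
  unfolding gap_point_def gap_end_shift[OF assms] gap_scale_add_int by simp

text \<open>A gap that arises inside a unit interval stays in the interior of the image of that interval.
  This is where the sizes fit: the \<open>m\<close> pieces of \<open>[i, i + 1]\<close> contain exactly one new point of the
  orbit, and \<open>m\<close> pieces together with a gap of length \<open>n - m\<close> fill \<open>n\<close> pieces.\<close>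

lemma gap_end_bounds:
  assumes "p \<in> znadic m" "p \<notin> \<int>"
  shows "of_int (unit_pos \<lfloor>p\<rfloor>) < gap_end p - gap_width * gap_scale p \<and> gap_end p < of_int (unit_pos \<lfloor>p\<rfloor>) + 1"
proof -
  have "p \<in> nadic m"
    using znadic_nadic[OF m1 assms(1)] .
  with m1 have "p \<in> znadic m \<longrightarrow> p \<notin> \<int> \<longrightarrow>
    of_int (unit_pos \<lfloor>p\<rfloor>) < gap_end p - gap_width * gap_scale p \<and> gap_end p < of_int (unit_pos \<lfloor>p\<rfloor>) + 1"
  proof (induction rule: nadic_induct)
    case (step p)
    show ?case
    proof (intro impI)
      assume p: "p \<in> znadic m" "p \<notin> \<int>"
      define i where "i = \<lfloor>p\<rfloor>"
      define p' where "p' = pl_gen m i p"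
      have ip: "of_int i < p" "p < of_int i + 1"
        using not_Ints_floor_less[OF p(2)] by (auto simp: i_def)
      have p'_eq: "p' = of_int i + real m * (p - of_int i)"
        by (simp add: p'_def i_def pl_gen_floor)
      have "0 < real m * (p - of_int i)" "real m * (p - of_int i) < real m * 1"
        using ip m2 by (auto simp del: mult_1_right intro!: mult_strict_left_mono)
      then have p'_bounds: "of_int i < p'" "p' < of_int (i + int m)"
        by (auto simp: p'_eq)
      have p'Z: "p' \<in> znadic m"
        using p pl_gen_znadic_iff[OF m2] by (simp add: p'_def)
      have key: "of_int (unit_pos i) < gap_end p' - gap_width * gap_scale p' \<and> gap_end p' < of_int (unit_pos i) + real n"
      proof (cases "p' \<in> \<int>")
        case True
        then obtain j where j: "p' = of_int j"
          by (auto elim: Ints_cases)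
        then have "(int m - 1) dvd j"
          using p'Z znadic_of_int_iff[OF m2] by simp
        moreover have ij: "i < j" "j \<le> i + (int m - 1) * 1"
          using p'_bounds unfolding j of_int_less_iff by auto
        ultimately have "unit_pos i + 1 \<le> unit_pos j - (int n - int m)" "unit_pos j \<le> unit_pos i + (int n - 1) * 1"
          using unit_pos_less_gap unit_pos_mono[OF ij(2)] unfolding unit_pos_shift by auto
        then have "real_of_int (unit_pos i + 1) \<le> of_int (unit_pos j - (int n - int m))"
          "real_of_int (unit_pos j) \<le> of_int (unit_pos i + (int n - 1) * 1)"
          unfolding of_int_le_iff by auto
        then show ?thesis
          by (simp add: j gap_end_int)
      next
        case False
        define i' where "i' = \<lfloor>p'\<rfloor>"
        have "of_int i' < p'" "p' < of_int i' + 1"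
          using not_Ints_floor_less[OF False] by (auto simp: i'_def)
        then have "of_int i < real_of_int (i' + 1)" "of_int i' < real_of_int (i + int m)"
          using p'_bounds by linarith+
        then have "i \<le> i'" "i' \<le> i + (int m - 1) * 1"
          unfolding of_int_less_iff by auto
        then have "unit_pos i \<le> unit_pos i'" "unit_pos i' \<le> unit_pos i + (int n - 1) * 1"
          using unit_pos_mono[of i i'] unit_pos_mono[of i' "i + (int m - 1) * 1"] unfolding unit_pos_shift by auto
        then have "real_of_int (unit_pos i) \<le> of_int (unit_pos i')"
          "real_of_int (unit_pos i') \<le> of_int (unit_pos i + (int n - 1) * 1)"
          unfolding of_int_le_iff by auto
        moreover have "of_int (unit_pos i') < gap_end p' - gap_width * gap_scale p' \<and> gap_end p' < of_int (unit_pos i') + 1"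
          using step.IH False p'Z by (simp add: i'_def p'_def i_def)
        ultimately show ?thesis
          by simp
      qed
      have s: "gap_end p = of_int (unit_pos i) + (gap_end p' - of_int (unit_pos i)) / real n"
        "gap_scale p = gap_scale p' / real n"
        using gap_end_step[OF step.hyps] gap_scale_step[OF step.hyps] by (simp_all add: p'_def i_def)
      have n0: "real n > 0"
        using n2 by simp
      have "gap_end p - gap_width * gap_scale p - of_int (unit_pos i) =
          (gap_end p' - gap_width * gap_scale p' - of_int (unit_pos i)) / real n"
        by (simp add: s diff_divide_distrib)
      moreover have "\<dots> > 0"
        using key n0 by (intro divide_pos_pos) auto
      moreover have "(gap_end p' - of_int (unit_pos i)) / real n < 1"
        using key n0 by (simp add: pos_divide_less_eq)
      ultimately show "of_int (unit_pos \<lfloor>p\<rfloor>) < gap_end p - gap_width * gap_scale p \<and> gap_end p < of_int (unit_pos \<lfloor>p\<rfloor>) + 1"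
        unfolding i_def[symmetric] using s(1) by linarith
    qed
  qed auto
  then show ?thesis
    using assms by blast
qed

lemma gap_start_ge:
  assumes p: "p \<in> znadic m" "of_int i + 1 \<le> p"
  shows "of_int (unit_pos i) + 1 \<le> gap_end p - gap_width * gap_scale p"
proof (cases "p \<in> \<int>")
  case True
  then obtain j where j: "p = of_int j"
    by (auto elim: Ints_cases)
  then have "(int m - 1) dvd j"
    using p znadic_of_int_iff[OF m2] by simp
  moreover have "of_int (i + 1) \<le> real_of_int j"
    using p j by simp
  then have "i < j"
    unfolding of_int_le_iff by simp
  ultimately have "real_of_int (unit_pos i + 1) \<le> of_int (unit_pos j - (int n - int m))"
    unfolding of_int_le_iff by (intro unit_pos_less_gap)
  then show ?thesis
    by (simp add: j gap_end_int)
next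
  case False
  have "i + 1 \<le> \<lfloor>p\<rfloor>"
    using p by (simp add: le_floor_iff)
  then have "real_of_int (unit_pos i + 1) \<le> of_int (unit_pos \<lfloor>p\<rfloor>)"
    unfolding of_int_le_iff by (intro unit_pos_less) auto
  then show ?thesis
    using gap_end_bounds[OF p(1) False] by simp
qed

lemma gap_start_greater:
  assumes p: "p \<in> znadic m" "of_int i < p"
  shows "of_int (unit_pos i) < gap_end p - gap_width * gap_scale p"
proof (cases "of_int i + 1 \<le> p")
  case True
  then show ?thesis
    using gap_start_ge[OF p(1)] by fastforce
next
  case False
  then have fl: "\<lfloor>p\<rfloor> = i"
    using p by (auto simp: floor_unique)
  moreover have "p \<notin> \<int>"
    using p fl by (auto elim!: Ints_cases)
  ultimately show ?thesis
    using gap_end_bounds[OF p(1)] by auto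
qed

lemma gap_end_less:
  assumes p: "p \<in> znadic m" "p < of_int i + 1"
  shows "gap_end p < of_int (unit_pos i) + 1"
proof -
  have fl: "\<lfloor>p\<rfloor> \<le> i"
    using p by (simp add: floor_le_iff)
  then have "real_of_int (unit_pos \<lfloor>p\<rfloor>) \<le> of_int (unit_pos i)"
    unfolding of_int_le_iff by (rule unit_pos_mono)
  moreover have "gap_end p < of_int (unit_pos \<lfloor>p\<rfloor>) + 1"
  proof (cases "p \<in> \<int>")
    case True
    then show ?thesis
      by (auto elim!: Ints_cases simp: gap_end_int)
  qed (use gap_end_bounds[OF p(1)] in auto)
  ultimately show ?thesis
    by linarith
qed

lemma gap_end_le:
  assumes p: "p \<in> znadic m" "p \<le> of_int i"
  shows "gap_end p \<le> of_int (unit_pos i)"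
proof (cases "p = of_int i")
  case True
  then show ?thesis
    by (simp add: gap_end_int)
next
  case False
  then have "gap_end p < of_int (unit_pos (i - 1)) + 1"
    using p by (intro gap_end_less) auto
  moreover have "real_of_int (unit_pos (i - 1) + 1) \<le> of_int (unit_pos i)"
    unfolding of_int_le_iff by (rule unit_pos_less) simp
  ultimately show ?thesis
    by simp
qed

text \<open>Points separated by an integer have gaps separated by the image of a unit interval; points in a
  common unit interval are expanded together until an integer separates them.\<close>

lemma gap_ordered:
  assumes "p \<in> znadic m" "q \<in> znadic m" "p < q"
  shows "gap_end p < gap_end q - gap_width * gap_scale q"
proof -
  have "p \<in> nadic m"
    using znadic_nadic[OF m1 assms(1)] .
  with m1 have "p \<in> znadic m \<longrightarrow> (\<forall>q\<in>znadic m. p < q \<longrightarrow> gap_end p < gap_end q - gap_width * gap_scale q)"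
  proof (induction rule: nadic_induct)
    case (int i)
    then show ?case
      using gap_start_greater by (auto simp: gap_end_int)
  next
    case (step p)
    show ?case
    proof (intro impI ballI)
      fix q assume p: "p \<in> znadic m" and q: "q \<in> znadic m" "p < q"
      define i where "i = \<lfloor>p\<rfloor>"
      have ip: "of_int i < p" "p < of_int i + 1"
        using not_Ints_floor_less[OF step.hyps(2)] by (auto simp: i_def)
      show "gap_end p < gap_end q - gap_width * gap_scale q"
      proof (cases "of_int i + 1 \<le> q")
        case True
        then show ?thesis
          using gap_end_less[OF p ip(2)] gap_start_ge[OF q(1)] by fastforce
      next
        case False
        then have fl: "\<lfloor>q\<rfloor> = i"
          using q ip by (auto simp: floor_unique)
        have qn: "q \<in> nadic m" "q \<notin> \<int>"
          using q ip fl znadic_nadic[OF m1 q(1)] by (auto elim!: Ints_cases)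
        define p' q' where "p' = pl_gen m i p" and "q' = pl_gen m i q"
        have "p' < q'"
          unfolding p'_def q'_def by (rule pl_gen_mono[OF m1 q(2)])
        moreover have "q' \<in> znadic m" "p' \<in> znadic m"
          using p q pl_gen_znadic_iff[OF m2] by (auto simp: p'_def q'_def)
        ultimately have "gap_end p' < gap_end q' - gap_width * gap_scale q'"
          using step.IH by (simp add: p'_def i_def)
        then have "(gap_end p' - of_int (unit_pos i)) / real n < (gap_end q' - gap_width * gap_scale q' - of_int (unit_pos i)) / real n"
          using n2 by (intro divide_strict_right_mono) auto
        then show ?thesis
          using gap_end_step[OF step.hyps] gap_end_step[OF qn] gap_scale_step[OF qn]
          unfolding fl i_def[symmetric] p'_def[symmetric] q'_def[symmetric] by (simp add: diff_divide_distrib)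
      qed
    qed
  qed
  then show ?thesis
    using assms by blast
qed

lemma gap_point_le: "v \<le> 0 \<Longrightarrow> gap_point p v \<le> gap_end p"
  using mult_nonneg_nonpos[OF less_imp_le[OF gap_scale_pos[of p]], of v] by (simp add: gap_point_def)

lemma gap_point_ge: "- gap_width \<le> v \<Longrightarrow> gap_end p - gap_width * gap_scale p \<le> gap_point p v"
  using mult_left_mono[of "- gap_width" v "gap_scale p"] gap_scale_pos[of p]
  by (simp add: gap_point_def algebra_simps)

lemma gap_point_mono: "v < w \<Longrightarrow> gap_point p v < gap_point p w"
  by (simp add: gap_point_def)

lemma gap_point_ordered:
  assumes "p \<in> znadic m" "q \<in> znadic m" "p < q" "v \<le> 0" "- gap_width \<le> w"
  shows "gap_point p v < gap_point q w"
  using gap_ordered[OF assms(1-3)] gap_point_le[OF assms(4), of p] gap_point_ge[OF assms(5), of q] by linarith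

lemma gap_point_int: "gap_point (of_int i) v = of_int (unit_pos i) + v"
  by (simp add: gap_point_def gap_end_int)

lemma gap_point_0: "gap_point 0 v = v"
  using gap_point_int[of 0 v] unit_pos_mult[of 0] by simp

text \<open>Blowing up intertwines the generators of \<open>F\<^bsub>m,\<infinity>\<^esub>\<close> with generators of \<open>F\<^bsub>n,\<infinity>\<^esub>\<close>, which map gaps
  to gaps in the canonical affine way.\<close>

lemma gap_point_pl_gen:
  assumes p: "p \<in> znadic m" and v: "- gap_width \<le> v" "v \<le> 0"
  shows "gap_point (pl_gen m i p) v = pl_gen n (unit_pos i) (gap_point p v)"
proof -
  note b = gap_point_le[OF v(2), of p] gap_point_ge[OF v(1), of p]
  consider "p \<le> of_int i" | "of_int i < p" "p < of_int i + 1" | "of_int i + 1 \<le> p"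
    by linarith
  then show ?thesis
  proof cases
    case 1
    then have "gap_point p v \<le> of_int (unit_pos i)"
      using gap_end_le[OF p 1] b by linarith
    then show ?thesis
      using 1 by (simp add: pl_gen_simps)
  next
    case 2
    then have fl: "\<lfloor>p\<rfloor> = i"
      by (auto simp: floor_unique)
    have pn: "p \<in> nadic m" "p \<notin> \<int>"
      using 2 fl znadic_nadic[OF m1 p] by (auto elim!: Ints_cases)
    have "of_int (unit_pos i) \<le> gap_point p v" "gap_point p v \<le> of_int (unit_pos i) + 1"
      using gap_end_bounds[OF p pn(2)] b unfolding fl by linarith+
    then have "pl_gen n (unit_pos i) (gap_point p v) =
        of_int (unit_pos i) + real n * (gap_point p v - of_int (unit_pos i))"
      by (rule pl_gen_simps)
    also have "\<dots> = gap_point (pl_gen m i p) v"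
      unfolding gap_point_def gap_end_step[OF pn] gap_scale_step[OF pn] fl
      using n2 by (simp add: field_simps)
    finally show ?thesis ..
  next
    case 3
    then have "of_int (unit_pos i) + 1 \<le> gap_point p v"
      using gap_start_ge[OF p 3] b by linarith
    moreover have "pl_gen m i p = p + of_int ((int m - 1) * 1)"
      using 3 by (simp add: pl_gen_simps)
    ultimately show ?thesis
      using gap_point_shift[of p 1 v] znadic_nadic[OF m1 p] by (simp add: pl_gen_simps)
  qed
qed

definition lifts :: "(real \<Rightarrow> real) \<Rightarrow> (real \<Rightarrow> real) \<Rightarrow> bool" where
  "lifts f F \<longleftrightarrow> (\<forall>p\<in>znadic m. \<forall>v. - gap_width \<le> v \<longrightarrow> v \<le> 0 \<longrightarrow> F (gap_point p v) = gap_point (f p) v)"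

lemma lifts_transl: "lifts (transl (real m - 1)) (transl (real n - 1))"
  unfolding lifts_def transl_def using gap_point_shift[of _ 1] znadic_nadic[OF m1] by simp

lemma lifts_pl_gen: "lifts (pl_gen m i) (pl_gen n (unit_pos i))"
  by (simp add: lifts_def gap_point_pl_gen)

lemma lift_exists:
  assumes "f \<in> F_inf m"
  shows "\<exists>F\<in>F_inf n. lifts f F"
  using m2 assms
proof (induction rule: F_inf_induct)
  case id
  then show ?case
    using F_inf_id[OF n2] by (intro bexI[of _ id]) (auto simp: lifts_def)
next
  case (gen g)
  then show ?case
    using lifts_transl lifts_pl_gen pl_gen_F_inf[OF n2] transl_F_inf[OF n2, of 1]
    by (auto simp: F_gens_def)
next
  case (inv g)
  then obtain G where G: "G \<in> F_inf n" "lifts g G"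
    by blast
  have g: "g \<in> F_inf m" "g \<in> homeos"
    using inv F_gens_F_inf[OF m2] F_inf_homeos[OF m2] by auto
  have "lifts (finv g) (finv G)"
    unfolding lifts_def
  proof (intro ballI allI impI)
    fix p v assume p: "p \<in> znadic m" and v: "- gap_width \<le> v" "v \<le> 0"
    have "finv g p \<in> znadic m"
      using F_inf_znadic_iff[OF m2 F_inf_finv[OF m2 g(1)]] p by simp
    then have "G (gap_point (finv g p) v) = gap_point p v"
      using G(2) v g(2) by (simp add: lifts_def)
    then show "finv G (gap_point p v) = gap_point (finv g p) v"
      using F_inf_homeos[OF n2 G(1)] by (metis homeos_inv_apply)
  qed
  then show ?case
    using F_inf_finv[OF n2 G(1)] by blast
next
  case (comp f g)
  then obtain F G where FG: "F \<in> F_inf n" "lifts f F" "G \<in> F_inf n" "lifts g G"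
    by blast
  then have "lifts (g \<circ> f) (G \<circ> F)"
    using F_inf_znadic_iff[OF m2 comp.hyps(1)] by (simp add: lifts_def)
  then show ?case
    using F_inf_comp[OF n2 FG(1,3)] by blast
qed

end

section \<open>Extending order isomorphisms between dense sets\<close>

text \<open>The extension sends \<open>x\<close> to the supremum of the values at points up to \<open>x\<close>. Since the range is dense, this
  function has no jumps.\<close>

lemma dense_correspondence_extends:
  fixes R :: "real \<Rightarrow> real \<Rightarrow> bool"
  assumes ord: "\<And>x y x' y'. R x y \<Longrightarrow> R x' y' \<Longrightarrow> x < x' \<longleftrightarrow> y < y'"
    and dom: "\<And>a b. a < b \<Longrightarrow> \<exists>x y. R x y \<and> a < x \<and> x < b"
    and ran: "\<And>a b. a < b \<Longrightarrow> \<exists>x y. R x y \<and> a < y \<and> y < b"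
  obtains h where "h \<in> homeos" "strict_mono h" "\<And>x y. R x y \<Longrightarrow> h x = y"
proof -
  define L where "L z = {y. \<exists>x\<le>z. R x y}" for z
  define h where "h z = Sup (L z)" for z
  have ne: "L z \<noteq> {}" for z
    using dom[of "z - 1" z] by (force simp: L_def)
  have ub: "y < y'" if "y \<in> L z" "R x' y'" "z < x'" for y z x' y'
    using that ord by (fastforce simp: L_def)
  have bdd: "bdd_above (L z)" for z
  proof -
    obtain x' y' where "R x' y'" "z < x'"
      using dom[of z "z + 1"] by auto
    then show ?thesis
      using ub[of _ z x' y'] by (intro bdd_aboveI[of _ y']) fastforce
  qed
  have R: "h x = y" if "R x y" for x y
    unfolding h_def
  proof (rule cSup_eq_maximum)
    show "y \<in> L x"
      using that by (auto simp: L_def)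
    show "z \<le> y" if z: "z \<in> L x" for z
    proof -
      obtain x' where "x' \<le> x" "R x' z"
        using z by (auto simp: L_def)
      then show ?thesis
        using ord[OF \<open>R x y\<close> \<open>R x' z\<close>] by fastforce
    qed
  qed
  have mono: "h x \<le> h z" if "x \<le> z" for x z
    unfolding h_def by (rule cSup_subset_mono[OF ne bdd]) (use that in \<open>auto simp: L_def intro: order_trans\<close>)
  have smono: "strict_mono h"
  proof (rule strict_monoI)
    fix x z :: real assume "x < z"
    obtain a c where a: "R a c" "x < a" "a < z"
      using dom[OF \<open>x < z\<close>] by blast
    obtain b d where b: "R b d" "a < b" "b < z"
      using dom[OF \<open>a < z\<close>] by blast
    have "h x \<le> h a" "h b \<le> h z"
      using a b by (auto intro: mono)
    moreover have "c < d"
      using ord[OF a(1) b(1)] b by blast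
    ultimately show "h x < h z"
      using R[OF a(1)] R[OF b(1)] by simp
  qed
  have "surj h"
    unfolding surj_def
  proof
    fix y
    define S where "S = {x. h x < y}"
    obtain a c where a: "R a c" "y - 1 < c" "c < y"
      using ran[of "y - 1" y] by auto
    obtain b d where b: "R b d" "y < d"
      using ran[of y "y + 1"] by auto
    have Sne: "S \<noteq> {}"
      using a R[OF a(1)] by (auto simp: S_def)
    have Sub: "x < b" if "x \<in> S" for x
    proof -
      have "h x < h b"
        using that R[OF b(1)] b by (simp add: S_def)
      then show ?thesis
        using smono by (simp add: strict_mono_less)
    qed
    have Sbdd: "bdd_above S"
      using Sub by (intro bdd_aboveI[of _ b]) (auto intro: less_imp_le)
    have "h (Sup S) = y"
    proof (rule antisym; rule ccontr)
      assume "\<not> h (Sup S) \<le> y"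
      then obtain a' c' where a': "R a' c'" "y < c'" "c' < h (Sup S)"
        using ran[of y "h (Sup S)"] by auto
      then have "h a' < h (Sup S)"
        using R by simp
      then have "a' < Sup S"
        using smono by (simp add: strict_mono_less)
      then obtain x where "x \<in> S" "a' < x"
        using less_cSup_iff[OF Sne Sbdd] by blast
      then have "h a' < h x" "h x < y"
        using smono by (auto simp: strict_mono_less S_def)
      then show False
        using R[OF a'(1)] a' by simp
    next
      assume "\<not> y \<le> h (Sup S)"
      then obtain a' c' where a': "R a' c'" "h (Sup S) < c'" "c' < y"
        using ran[of "h (Sup S)" y] by auto
      then have "a' \<in> S"
        using R[OF a'(1)] by (simp add: S_def)
      then have "h a' \<le> h (Sup S)"
        using Sbdd by (intro mono cSup_upper)
      then show False
        using R[OF a'(1)] a' by simp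
    qed
    then show "\<exists>x. y = h x"
      by metis
  qed
  then have "h \<in> homeos"
    using smono by (intro strict_mono_surj_homeos)
  then show ?thesis
    using that smono R by blast
qed

section \<open>Transporting exotic homeomorphisms to the blown up line\<close>

text \<open>The homeomorphisms that implement the elements of \<open>Aut\<^sup>0(F\<^bsub>m,\<infinity>\<^esub>, t\<^bsub>m-1\<^esub>)\<close>.\<close>

definition exotics :: "nat \<Rightarrow> (real \<Rightarrow> real) set" where
  "exotics m = {h \<in> homeos. (\<forall>x. h (x + (real m - 1)) = h x + (real m - 1)) \<and> h 0 = 0 \<and>
     (\<forall>f\<in>F_inf m. conj_by h f \<in> F_inf m) \<and> (\<forall>f\<in>F_inf m. conj_by (finv h) f \<in> F_inf m)}"

lemma exoticsD:
  assumes "h \<in> exotics m"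
  shows "h \<in> homeos" "h (x + (real m - 1)) = h x + (real m - 1)" "h 0 = 0"
    "f \<in> F_inf m \<Longrightarrow> conj_by h f \<in> F_inf m" "f \<in> F_inf m \<Longrightarrow> conj_by (finv h) f \<in> F_inf m"
  using assms by (auto simp: exotics_def)

lemma exotics_id: "id \<in> exotics m"
proof -
  have "finv id = id"
    by (rule inv_equality) auto
  then show ?thesis
    by (simp add: exotics_def homeos_id)
qed

lemma exotics_finv:
  assumes h: "h \<in> exotics m"
  shows "finv h \<in> exotics m"
proof -
  note D = exoticsD[OF h]
  have "finv h (x + (real m - 1)) = finv h x + (real m - 1)" for x
    using D(2)[of "finv h x"] homeos_apply_inv[OF D(1), of x] homeos_inv_apply[OF D(1)] by metis
  moreover have "finv h 0 = 0"
    using homeos_inv_apply[OF D(1), of 0] D(3) by simp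
  ultimately show ?thesis
    using D(1,4,5) by (simp add: exotics_def homeos_inv)
qed

lemma exotics_comp:
  assumes h: "h \<in> exotics m" and k: "k \<in> exotics m"
  shows "h \<circ> k \<in> exotics m"
proof -
  note H = exoticsD[OF h] and K = exoticsD[OF k]
  have "finv (h \<circ> k) = finv k \<circ> finv h"
    using H(1) K(1) by (simp add: o_inv_distrib homeos_bij)
  then show ?thesis
    using H K by (simp add: exotics_def homeos_comp homeos_inv conj_by_comp[symmetric])
qed

lemma exotics_strict_mono: "m \<ge> 2 \<Longrightarrow> h \<in> exotics m \<Longrightarrow> strict_mono h"
  using exoticsD[of h m] by (intro homeos_commute_translation_mono[of h "real m - 1"]) auto

lemma exotics_shift:
  assumes m: "m \<ge> 2" and h: "h \<in> exotics m"
  shows "h (x + of_int ((int m - 1) * a)) = h x + of_int ((int m - 1) * a)"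
proof (induction a arbitrary: x rule: int_induct[of _ 0])
  case (step1 i)
  have "h (x + of_int ((int m - 1) * i) + (real m - 1)) = h x + of_int ((int m - 1) * i) + (real m - 1)"
    unfolding exoticsD(2)[OF h] step1 ..
  then show ?case
    using m by (simp add: algebra_simps)
next
  case (step2 i)
  have "h ((x - (real m - 1)) + (real m - 1)) = h (x - (real m - 1)) + (real m - 1)"
    using exoticsD(2)[OF h] .
  then have "h (x - (real m - 1)) = h x - (real m - 1)"
    by simp
  moreover have "h ((x - (real m - 1)) + of_int ((int m - 1) * i)) = h (x - (real m - 1)) + of_int ((int m - 1) * i)"
    by (rule step2)
  ultimately show ?case
    using m by (simp add: algebra_simps)
qed simp

text \<open>The image \<open>h (f 0)\<close> of a point of the orbit of \<open>0\<close> is the image of \<open>h 0 = 0\<close> under the conjugate of \<open>f\<close>,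
  which is again in \<open>F\<^bsub>m,\<infinity>\<^esub>\<close>.\<close>

lemma exotics_znadic:
  assumes m: "m \<ge> 2" and h: "h \<in> exotics m" and p: "p \<in> znadic m"
  shows "h p \<in> znadic m"
proof -
  obtain f where f: "f \<in> F_inf m" "f 0 = p"
    using F_inf_orbit_0[OF m p] by blast
  have "h p = conj_by h f (h 0)"
    using conj_by_apply[OF exoticsD(1)[OF h]] f by simp
  also have "\<dots> = conj_by h f 0"
    using exoticsD(3)[OF h] by simp
  finally show ?thesis
    using F_inf_znadic_iff[OF m exoticsD(4)[OF h f(1)], of 0] by simp
qed

lemma strict_mono_less_fixed:
  fixes h :: "real \<Rightarrow> real"
  assumes "strict_mono h" "h c = c"
  shows "h x < c \<longleftrightarrow> x < c" "c < h x \<longleftrightarrow> c < x"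
  using assms strict_mono_less[of h] by metis+

lemma znadic_int_mult: "k \<ge> 2 \<Longrightarrow> of_int ((int k - 1) * a) \<in> znadic k"
  by (simp only: znadic_of_int_iff dvd_triv_left)

context gap_pair
begin

text \<open>The graph of \<open>hat h\<close> on the orbit of \<open>0\<close> under \<open>F\<^bsub>n,\<infinity>\<^esub>\<close>. It permutes the gaps as \<open>h\<close> permutes the
  points of the orbit of \<open>0\<close> under \<open>F\<^bsub>m,\<infinity>\<^esub>\<close>, and inside a gap, on the unit interval \<open>[q, q + 1]\<close> of the gap at \<open>0\<close>, it is
  a copy of itself on \<open>[q, q + n]\<close>; this self-similarity makes it commute with the expansions of
  the intervals in the gaps. The bounds on \<open>w\<close> keep the definition symmetric in the two coordinates: the
  graph for the inverse of \<open>h\<close> is the converse relation.\<close>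

inductive hat_graph :: "(real \<Rightarrow> real) \<Rightarrow> real \<Rightarrow> real \<Rightarrow> bool" for h where
  ends: "p \<in> znadic m \<Longrightarrow> hat_graph h (gap_point p 0) (gap_point (h p) 0)"
| gap: "p \<in> znadic m \<Longrightarrow> - (int n - int m) \<le> q \<Longrightarrow> q < 0 \<Longrightarrow> of_int q < v \<Longrightarrow> v < of_int q + 1 \<Longrightarrow>
    of_int q < w \<Longrightarrow> w < of_int q + 1 \<Longrightarrow>
    hat_graph h (of_int q + real n * (v - of_int q)) (of_int q + real n * (w - of_int q)) \<Longrightarrow>
    hat_graph h (gap_point p v) (gap_point (h p) w)"

abbreviation gap_graph :: "(real \<Rightarrow> real) \<Rightarrow> real \<Rightarrow> real \<Rightarrow> bool" where
  "gap_graph h v w \<equiv> (v = 0 \<and> w = 0) \<or> (\<exists>q. - (int n - int m) \<le> q \<and> q < 0 \<and> of_int q < v \<and> v < of_int q + 1 \<and>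
        of_int q < w \<and> w < of_int q + 1 \<and>
        hat_graph h (of_int q + real n * (v - of_int q)) (of_int q + real n * (w - of_int q)))"

lemma gap_bounds:
  assumes "- (int n - int m) \<le> q" "q < 0" "of_int q < v" "v < of_int q + 1"
  shows "- gap_width \<le> v" "v \<le> 0"
proof -
  have "real_of_int (- (int n - int m)) \<le> of_int q" "real_of_int (q + 1) \<le> of_int 0"
    unfolding of_int_le_iff using assms by auto
  then show "- gap_width \<le> v" "v \<le> 0"
    using assms by auto
qed

lemma hat_graph_cases:
  assumes "hat_graph h x y"
  obtains p v w where "p \<in> znadic m" "x = gap_point p v" "y = gap_point (h p) w"
    "- gap_width \<le> v" "v \<le> 0" "- gap_width \<le> w" "w \<le> 0"
    "gap_graph h v w"
  using assms
proof cases
  case (ends p)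
  then show ?thesis
    using mn by (intro that[of p 0 0]) auto
next
  case (gap p q v w)
  then show ?thesis
    using gap_bounds[of q v] gap_bounds[of q w] by (intro that[of p v w]) blast+
qed

lemma hat_graph_sym:
  assumes h: "h \<in> exotics m"
  shows "hat_graph h x y \<Longrightarrow> hat_graph (finv h) y x"
proof (induction rule: hat_graph.induct)
  case (ends p)
  then show ?case
    using hat_graph.ends[OF exotics_znadic[OF m2 h ends], of "finv h"] exoticsD(1)[OF h] by simp
next
  case (gap p q v w)
  then show ?case
    using hat_graph.gap[OF exotics_znadic[OF m2 h gap.hyps(1)] gap.hyps(2,3,6,7,4,5) gap.IH] exoticsD(1)[OF h] by simp
qed

text \<open>Points in different gaps are ordered like the gaps, which \<open>h\<close> permutes monotonically. For two points in
  one gap, pass to the gap at \<open>0\<close> and compare unit intervals; within a unit interval the claim is inherited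
  from the expanded points.\<close>

lemma hat_graph_mono:
  assumes h: "h \<in> exotics m"
  shows "hat_graph h x y \<Longrightarrow> hat_graph h x' y' \<Longrightarrow> x < x' \<Longrightarrow> y < y'"
proof (induction arbitrary: x' y' rule: hat_graph.induct)
  case (ends p)
  from ends(2) obtain p' v' w' where c: "p' \<in> znadic m" "x' = gap_point p' v'" "y' = gap_point (h p') w'"
    "- gap_width \<le> v'" "v' \<le> 0" "- gap_width \<le> w'" "w' \<le> 0"
    by (rule hat_graph_cases) blast
  consider "p < p'" | "p = p'" | "p' < p"
    by linarith
  then show ?case
  proof cases
    case 1
    then have "h p < h p'"
      using exotics_strict_mono[OF m2 h] by (simp add: strict_mono_less)
    then show ?thesis
      unfolding c using c exotics_znadic[OF m2 h] ends(1) by (intro gap_point_ordered) auto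
  next
    case 2
    have "gap_point p 0 < gap_point p v'"
      using ends(3) c 2 by simp
    then show ?thesis
      using gap_point_le[OF c(5), of p] by (simp add: gap_point_def)
  next
    case 3
    have "gap_point p' v' < gap_point p 0"
      using 3 c ends(1) mn by (intro gap_point_ordered) auto
    then show ?thesis
      using ends(3) c by simp
  qed
next
  case (gap p q v w)
  note b = gap_bounds[OF gap.hyps(2-5)] gap_bounds[OF gap.hyps(2,3,6,7)]
  from gap.prems(1) obtain p' v' w' where c: "p' \<in> znadic m" "x' = gap_point p' v'" "y' = gap_point (h p') w'"
    "- gap_width \<le> v'" "v' \<le> 0" "- gap_width \<le> w'" "w' \<le> 0"
    "gap_graph h v' w'"
    by (rule hat_graph_cases)
  consider "p < p'" | "p = p'" | "p' < p"
    by linarith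
  then show ?case
  proof cases
    case 1
    then have "h p < h p'"
      using exotics_strict_mono[OF m2 h] by (simp add: strict_mono_less)
    then show ?thesis
      unfolding c using c b exotics_znadic[OF m2 h] gap.hyps(1) by (intro gap_point_ordered) auto
  next
    case 2
    have vv: "v < v'"
    proof (rule ccontr)
      assume "\<not> v < v'"
      then have "gap_point p v' \<le> gap_point p v"
        using gap_point_mono[of v' v p] by (cases "v' = v") auto
      then show False
        using gap.prems(2) c 2 by simp
    qed
    have "w < w'"
      using c(8)
    proof (elim disjE conjE exE)
      assume "v' = 0" "w' = 0"
      moreover have "real_of_int (q + 1) \<le> 0"
        using gap.hyps(3) by linarith
      ultimately show ?thesis
        using gap.hyps by simp
    next
      fix q' assume q': "of_int q' < v'" "v' < of_int q' + 1" "of_int q' < w'" "w' < of_int q' + 1"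
        "hat_graph h (of_int q' + real n * (v' - of_int q')) (of_int q' + real n * (w' - of_int q'))"
      have "real_of_int q < of_int (q' + 1)"
        using vv q' gap.hyps by simp
      then have "q \<le> q'"
        unfolding of_int_less_iff by simp
      then consider "q = q'" | "q + 1 \<le> q'"
        by linarith
      then show ?thesis
      proof cases
        case 1
        have "of_int q + real n * (v - of_int q) < of_int q + real n * (v' - of_int q)"
          using vv n2 by simp
        then have "of_int q + real n * (w - of_int q) < of_int q + real n * (w' - of_int q)"
          using gap.IH[of "of_int q + real n * (v' - of_int q)" "of_int q + real n * (w' - of_int q)"] q' 1 by simp
        then show ?thesis
          using n2 by simp
      next
        case 2
        then have "real_of_int (q + 1) \<le> of_int q'"
          unfolding of_int_le_iff .
        then show ?thesis
          using q' gap.hyps by simp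
      qed
    qed
    then show ?thesis
      unfolding c 2 by (rule gap_point_mono)
  next
    case 3
    have "gap_point p' v' < gap_point p v"
      using 3 c gap.hyps(1) b by (intro gap_point_ordered) auto
    then show ?thesis
      using gap.prems(2) c by simp
  qed
qed

lemma hat_graph_order:
  assumes h: "h \<in> exotics m" and xy: "hat_graph h x y" "hat_graph h x' y'"
  shows "x < x' \<longleftrightarrow> y < y'"
  using hat_graph_mono[OF h xy] hat_graph_mono[OF exotics_finv[OF h] hat_graph_sym[OF h xy(1)] hat_graph_sym[OF h xy(2)]]
  by blast

text \<open>Lifts of elements of \<open>F\<^bsub>m,\<infinity>\<^esub>\<close> change only the gap and not the position in it, whereas the graph
  relates positions independently of the gap.\<close>

lemma hat_graph_lift:
  assumes h: "h \<in> exotics m" and f: "f \<in> F_inf m" "lifts f F" "lifts (conj_by h f) F'"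
    and xy: "hat_graph h x y"
  shows "hat_graph h (F x) (F' y)"
  using xy
proof cases
  case (ends p)
  have "F x = gap_point (f p) 0"
    using f(2) ends mn by (simp add: lifts_def)
  moreover have "F' y = gap_point (conj_by h f (h p)) 0"
    using f(3) ends mn exotics_znadic[OF m2 h] by (simp add: lifts_def)
  moreover have "f p \<in> znadic m"
    using F_inf_znadic_iff[OF m2 f(1)] ends by simp
  ultimately show ?thesis
    using hat_graph.ends[of "f p" h] conj_by_apply[OF exoticsD(1)[OF h]] by simp
next
  case (gap p q v w)
  note b = gap_bounds[OF gap(4-7)] gap_bounds[OF gap(4,5,8,9)]
  have "F x = gap_point (f p) v"
    using f(2) gap b by (simp add: lifts_def)
  moreover have "F' y = gap_point (conj_by h f (h p)) w"
    using f(3) gap b exotics_znadic[OF m2 h] by (simp add: lifts_def)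
  moreover have "f p \<in> znadic m"
    using F_inf_znadic_iff[OF m2 f(1)] gap by simp
  ultimately show ?thesis
    using hat_graph.gap[OF _ gap(4-10), of "f p"] conj_by_apply[OF exoticsD(1)[OF h]] by simp
qed

lemma hat_graph_shift:
  assumes h: "h \<in> exotics m" and xy: "hat_graph h x y"
  shows "hat_graph h (x + of_int ((int n - 1) * a)) (y + of_int ((int n - 1) * a))"
proof -
  have T: "lifts (transl (of_int ((int m - 1) * a))) (transl (of_int ((int n - 1) * a)))"
    using gap_point_shift znadic_nadic[OF m1] by (simp add: lifts_def transl_def)
  have "conj_by h (transl (of_int ((int m - 1) * a))) = transl (of_int ((int m - 1) * a))"
    using exotics_shift[OF m2 h, of _ a] by (intro conj_by_eqI exoticsD(1)[OF h]) (auto simp: transl_def)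
  then show ?thesis
    using hat_graph_lift[OF h _ T _ xy, of "transl (of_int ((int n - 1) * a))"] T transl_F_inf[OF m2, of a]
    by (simp add: transl_def)
qed

text \<open>The integers that bound the unit intervals of the gap at \<open>0\<close> will be fixed by the homeomorphism.
  They are limits of the domain of the graph but need not belong to it, so this is expressed by
  the order.\<close>

lemma hat_graph_gap_integer:
  assumes h: "h \<in> exotics m" and xy: "hat_graph h x y" and j: "- (int n - int m) \<le> j" "j \<le> 0"
  shows "x < of_int j \<longleftrightarrow> y < of_int j" "of_int j < x \<longleftrightarrow> of_int j < y"
proof -
  obtain p v w where c: "p \<in> znadic m" "x = gap_point p v" "y = gap_point (h p) w"
    "- gap_width \<le> v" "v \<le> 0" "- gap_width \<le> w" "w \<le> 0"
    "gap_graph h v w"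
    using xy by (rule hat_graph_cases)
  have "real_of_int (- (int n - int m)) \<le> of_int j" "real_of_int j \<le> of_int 0"
    unfolding of_int_le_iff using j by auto
  then have jr: "- gap_width \<le> of_int j" "real_of_int j \<le> 0"
    by auto
  have h0: "h 0 = 0" and hp: "h p \<in> znadic m"
    using exoticsD(3)[OF h] exotics_znadic[OF m2 h c(1)] by auto
  have sign: "h p < 0 \<longleftrightarrow> p < 0" "0 < h p \<longleftrightarrow> 0 < p"
    using strict_mono_less_fixed[OF exotics_strict_mono[OF m2 h] h0] by auto
  consider "p < 0" | "p = 0" | "0 < p"
    by linarith
  then have "(x < of_int j \<longleftrightarrow> y < of_int j) \<and> (of_int j < x \<longleftrightarrow> of_int j < y)"
  proof cases
    case 1
    then have "gap_point p v < gap_point 0 (of_int j)" "gap_point (h p) w < gap_point 0 (of_int j)"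
      using c jr hp sign by (auto intro!: gap_point_ordered)
    then show ?thesis
      by (simp add: c gap_point_0)
  next
    case 3
    then have "gap_point 0 (of_int j) < gap_point p v" "gap_point 0 (of_int j) < gap_point (h p) w"
      using c jr hp sign by (auto intro!: gap_point_ordered)
    then show ?thesis
      by (simp add: c gap_point_0)
  next
    case 2
    then have xy: "x = v" "y = w"
      using c h0 by (simp_all add: gap_point_0)
    show ?thesis
      using c(8)
    proof (elim disjE conjE exE)
      fix q assume q: "of_int q < v" "v < of_int q + 1" "of_int q < w" "w < of_int q + 1"
      have "j \<le> q \<or> q + 1 \<le> j"
        by linarith
      then have "real_of_int j \<le> of_int q \<or> real_of_int (q + 1) \<le> of_int j"
        unfolding of_int_le_iff .
      then show ?thesis
        using q unfolding xy of_int_add of_int_1 by linarith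
    qed (simp add: xy)
  qed
  then show "x < of_int j \<longleftrightarrow> y < of_int j" "of_int j < x \<longleftrightarrow> of_int j < y"
    by auto
qed

lemma hat_graph_expanded:
  assumes h: "h \<in> exotics m" and q: "- (int n - int m) \<le> q" "q < 0" and v: "of_int q < v" "v < of_int q + 1"
    and R: "hat_graph h (of_int q + real n * (v - of_int q)) y"
  obtains w where "of_int q < w" "w < of_int q + 1" "y = of_int q + real n * (w - of_int q)"
proof -
  have "real_of_int q < of_int q + real n * (v - of_int q)" "of_int q + real n * (v - of_int q) < of_int q + real n"
    using v n2 mult_strict_left_mono[of "v - of_int q" 1 "real n"] by auto
  then have y: "of_int q < y" "y < of_int q + real n"
    using hat_graph_gap_integer(2)[OF h R, of q] hat_graph_gap_integer(1)[OF h hat_graph_shift[OF h R, of "- 1"], of "q + 1"] q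
    by auto
  show ?thesis
  proof (rule that[of "of_int q + (y - of_int q) / real n"])
    show "of_int q < of_int q + (y - of_int q) / real n" "of_int q + (y - of_int q) / real n < of_int q + 1"
      using y n2 by (auto simp: pos_divide_less_eq)
    show "y = of_int q + real n * (of_int q + (y - of_int q) / real n - of_int q)"
      using n2 by simp
  qed
qed

text \<open>By induction on the level: a point of an interval with active index is pulled back along a
  lifted generator, and a point of a gap is covered by the recursion in the definition of the graph.\<close>

lemma hat_graph_total:
  assumes h: "h \<in> exotics m" and x: "x \<in> znadic n"
  shows "\<exists>y. hat_graph h x y"
proof -
  have "x \<in> nadic n"
    using znadic_nadic[OF n1 x] .
  with n1 have "x \<in> znadic n \<longrightarrow> (\<exists>y. hat_graph h x y)"
  proof (induction rule: nadic_induct)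
    case (int i)
    show ?case
    proof
      assume "of_int i \<in> znadic n"
      then have "(int n - 1) dvd i"
        using znadic_of_int_iff[OF n2] by blast
      then obtain a where "i = (int n - 1) * a"
        by (elim dvdE)
      then have "of_int i = gap_point (of_int ((int m - 1) * a)) 0"
        unfolding gap_point_int unit_pos_mult by simp
      moreover have "of_int ((int m - 1) * a) \<in> znadic m"
        by (rule znadic_int_mult[OF m2])
      ultimately show "\<exists>y. hat_graph h (of_int i) y"
        using hat_graph.ends by metis
    qed
  next
    case (step x)
    show ?case
    proof
      assume x: "x \<in> znadic n"
      define j where "j = \<lfloor>x\<rfloor>"
      have jx: "of_int j < x" "x < of_int j + 1"
        using not_Ints_floor_less[OF step.hyps(2)] by (auto simp: j_def)
      have "pl_gen n j x \<in> znadic n"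
        using x pl_gen_znadic_iff[OF n2] by simp
      then obtain y where y: "hat_graph h (pl_gen n j x) y"
        using step.IH by (auto simp: j_def)
      show "\<exists>y. hat_graph h x y"
      proof (cases rule: unit_pos_cover[of j])
        case (1 i)
        define g where "g = finv (pl_gen m i)"
        have g: "g \<in> F_inf m"
          unfolding g_def by (intro F_inf_finv pl_gen_F_inf m2)
        obtain G where G: "G \<in> F_inf n" "lifts (conj_by h g) G"
          using lift_exists exoticsD(4)[OF h g] by blast
        have "lifts g (finv (pl_gen n j))"
          unfolding lifts_def
        proof (intro ballI allI impI)
          fix p v assume p: "p \<in> znadic m" and v: "- gap_width \<le> v" "v \<le> 0"
          have "g p \<in> znadic m"
            using F_inf_znadic_iff[OF m2 g] p by simp
          then have "gap_point (pl_gen m i (g p)) v = pl_gen n j (gap_point (g p) v)"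
            using gap_point_pl_gen v 1 by simp
          moreover have "pl_gen m i (g p) = p"
            using pl_gen_homeos[OF m1] by (simp add: g_def)
          ultimately show "finv (pl_gen n j) (gap_point p v) = gap_point (g p) v"
            using pl_gen_homeos[OF n1] by simp
        qed
        then have "hat_graph h (finv (pl_gen n j) (pl_gen n j x)) (G y)"
          using hat_graph_lift[OF h g _ G(2) y] by blast
        then show ?thesis
          using pl_gen_homeos[OF n1] by auto
      next
        case (2 a)
        define q where "q = j - (int n - 1) * a"
        define v where "v = x - of_int ((int n - 1) * a)"
        define y' where "y' = y - of_int ((int n - 1) * a)"
        have q: "- (int n - int m) \<le> q" "q < 0" and v: "of_int q < v" "v < of_int q + 1"
          using 2 jx by (auto simp: q_def v_def)
        have "pl_gen n j x = of_int j + real n * (x - of_int j)"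
          using jx by (intro pl_gen_simps) auto
        then have "hat_graph h (of_int j + real n * (x - of_int j) + of_int ((int n - 1) * (- a))) (y + of_int ((int n - 1) * (- a)))"
          using hat_graph_shift[OF h y, of "- a"] by simp
        moreover have "of_int j + real n * (x - of_int j) + of_int ((int n - 1) * (- a)) = of_int q + real n * (v - of_int q)"
          by (simp add: q_def v_def)
        moreover have "y + of_int ((int n - 1) * (- a)) = y'"
          by (simp add: y'_def)
        ultimately have R: "hat_graph h (of_int q + real n * (v - of_int q)) y'"
          by simp
        obtain w where w: "of_int q < w" "w < of_int q + 1" "y' = of_int q + real n * (w - of_int q)"
          using hat_graph_expanded[OF h q v R] .
        have "hat_graph h (gap_point (of_int ((int m - 1) * a)) v) (gap_point (h (of_int ((int m - 1) * a))) w)"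
        proof (rule hat_graph.gap[OF _ q v w(1,2)])
          show "of_int ((int m - 1) * a) \<in> znadic m"
            by (rule znadic_int_mult[OF m2])
          show "hat_graph h (of_int q + real n * (v - of_int q)) (of_int q + real n * (w - of_int q))"
            using R w(3) by simp
        qed
        moreover have "gap_point (of_int ((int m - 1) * a)) v = x"
          unfolding gap_point_int unit_pos_mult by (simp add: v_def)
        ultimately show ?thesis
          by metis
      qed
    qed
  qed
  then show ?thesis
    using x by blast
qed

lemma hat_graph_comp:
  assumes h: "h \<in> exotics m" and k: "k \<in> exotics m"
  shows "hat_graph k x y \<Longrightarrow> \<exists>z. hat_graph h y z \<and> hat_graph (h \<circ> k) x z"
proof (induction rule: hat_graph.induct)
  case (ends p)
  have "hat_graph (h \<circ> k) (gap_point p 0) (gap_point (h (k p)) 0)"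
    using hat_graph.ends[OF ends, of "h \<circ> k"] unfolding comp_apply .
  then show ?case
    using hat_graph.ends[OF exotics_znadic[OF m2 k ends], of h] by blast
next
  case (gap p q v w)
  then obtain z where z: "hat_graph h (of_int q + real n * (w - of_int q)) z"
    "hat_graph (h \<circ> k) (of_int q + real n * (v - of_int q)) z"
    by blast
  obtain u where u: "of_int q < u" "u < of_int q + 1" "z = of_int q + real n * (u - of_int q)"
    using hat_graph_expanded[OF h gap.hyps(2,3,6,7) z(1)] .
  have "hat_graph h (gap_point (k p) w) (gap_point (h (k p)) u)"
    using z(1) u(3) hat_graph.gap[OF exotics_znadic[OF m2 k gap.hyps(1)] gap.hyps(2,3,6,7) u(1,2)] by simp
  moreover have "hat_graph (h \<circ> k) (gap_point p v) (gap_point (h (k p)) u)"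
    using hat_graph.gap[OF gap.hyps(1-5) u(1,2) z(2)[unfolded u(3)]] unfolding comp_apply .
  ultimately show ?case
    by blast
qed

definition hat :: "(real \<Rightarrow> real) \<Rightarrow> real \<Rightarrow> real" where
  "hat h = (SOME \<phi>. \<phi> \<in> homeos \<and> strict_mono \<phi> \<and> (\<forall>x y. hat_graph h x y \<longrightarrow> \<phi> x = y))"

lemma hat:
  assumes h: "h \<in> exotics m"
  shows "hat h \<in> homeos" "strict_mono (hat h)" "hat_graph h x y \<Longrightarrow> hat h x = y"
proof -
  have dom: "\<exists>x y. hat_graph h x y \<and> a < x \<and> x < b" if "h \<in> exotics m" "a < b" for h a b
    using dense_znadic[OF n2 that(2)] hat_graph_total[OF that(1)] by blast
  have ran: "\<exists>x y. hat_graph h x y \<and> a < y \<and> y < b" if ab: "a < b" for a b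
  proof -
    obtain y x where "hat_graph (finv h) y x" "a < y" "y < b"
      using dom[OF exotics_finv[OF h] ab] by blast
    moreover from this have "hat_graph (finv (finv h)) x y"
      using hat_graph_sym[OF exotics_finv[OF h]] by blast
    ultimately show ?thesis
      using exoticsD(1)[OF h] by auto
  qed
  have "\<exists>\<phi>. \<phi> \<in> homeos \<and> strict_mono \<phi> \<and> (\<forall>x y. hat_graph h x y \<longrightarrow> \<phi> x = y)"
    using dense_correspondence_extends[of "hat_graph h", OF hat_graph_order[OF h] dom[OF h] ran] by metis
  then have "hat h \<in> homeos \<and> strict_mono (hat h) \<and> (\<forall>x y. hat_graph h x y \<longrightarrow> hat h x = y)"
    unfolding hat_def by (rule someI_ex)
  then show "hat h \<in> homeos" "strict_mono (hat h)" "hat_graph h x y \<Longrightarrow> hat h x = y"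
    by auto
qed

lemma homeos_eq_on_hat_graph:
  assumes h: "h \<in> exotics m" and "f \<in> homeos" "g \<in> homeos" "\<And>x y. hat_graph h x y \<Longrightarrow> f x = g x"
  shows "f = g"
  using hat_graph_total[OF h] by (intro homeos_eq_on_dense[OF assms(2,3) closure_znadic[OF n2]]) (use assms(4) in blast)

lemma hat_comp:
  assumes h: "h \<in> exotics m" and k: "k \<in> exotics m"
  shows "hat (h \<circ> k) = hat h \<circ> hat k"
proof (rule homeos_eq_on_hat_graph[OF k])
  show "hat (h \<circ> k) \<in> homeos" "hat h \<circ> hat k \<in> homeos"
    using hat(1) h k exotics_comp homeos_comp by auto
  fix x y assume xy: "hat_graph k x y"
  then show "hat (h \<circ> k) x = (hat h \<circ> hat k) x"
    using hat_graph_comp[OF h k xy] hat(3)[OF h] hat(3)[OF k xy] hat(3)[OF exotics_comp[OF h k]] by force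
qed

lemma hat_graph_id: "hat_graph id x y \<Longrightarrow> y = x"
proof (induction rule: hat_graph.induct)
  case (gap p q v w)
  then show ?case
    using n2 by simp
qed simp

lemma hat_id: "hat id = id"
  using hat[OF exotics_id] hat_graph_id by (intro homeos_eq_on_hat_graph[OF exotics_id]) (auto simp: homeos_id)

lemma hat_finv:
  assumes h: "h \<in> exotics m"
  shows "hat (finv h) = finv (hat h)"
proof -
  have "hat h \<circ> hat (finv h) = id"
    using hat_comp[OF h exotics_finv[OF h]] hat_id exoticsD(1)[OF h] by (simp add: comp_def id_def[symmetric])
  then have "finv (hat h) \<circ> (hat h \<circ> hat (finv h)) = finv (hat h)"
    by simp
  then show ?thesis
    using hat(1)[OF h] by (simp add: fun_eq_iff)
qed

lemma hat_inj:
  assumes h: "h \<in> exotics m" and k: "k \<in> exotics m" and eq: "hat h = hat k"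
  shows "h = k"
proof (rule homeos_eq_on_dense[OF exoticsD(1)[OF h] exoticsD(1)[OF k] closure_znadic[OF m2]])
  fix p assume p: "p \<in> znadic m"
  have "gap_point (h p) 0 = gap_point (k p) 0"
    using hat(3)[OF h hat_graph.ends[OF p]] hat(3)[OF k hat_graph.ends[OF p]] eq by simp
  then show "h p = k p"
    using gap_point_ordered[OF exotics_znadic[OF m2 h p] exotics_znadic[OF m2 k p], of 0 0]
      gap_point_ordered[OF exotics_znadic[OF m2 k p] exotics_znadic[OF m2 h p], of 0 0] mn
    by (cases "h p" "k p" rule: linorder_cases) auto
qed

lemma hat_lift:
  assumes h: "h \<in> exotics m" and f: "f \<in> F_inf m" "lifts f F" "lifts (conj_by h f) F'"
    and F: "F \<in> homeos" "F' \<in> homeos"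
  shows "conj_by (hat h) F = F'"
proof (rule conj_by_eqI[OF hat(1)[OF h]])
  show "hat h \<circ> F = F' \<circ> hat h"
  proof (rule homeos_eq_on_hat_graph[OF h])
    fix x y assume xy: "hat_graph h x y"
    show "(hat h \<circ> F) x = (F' \<circ> hat h) x"
      using hat(3)[OF h hat_graph_lift[OF h f xy]] hat(3)[OF h xy] by simp
  qed (use F hat(1)[OF h] homeos_comp in auto)
qed

lemma hat_shift:
  assumes h: "h \<in> exotics m"
  shows "hat h (x + of_int ((int n - 1) * a)) = hat h x + of_int ((int n - 1) * a)"
proof -
  define T where "T = transl (of_int ((int n - 1) * a))"
  have "hat h \<circ> T = T \<circ> hat h"
  proof (rule homeos_eq_on_hat_graph[OF h])
    fix x y assume xy: "hat_graph h x y"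
    show "(hat h \<circ> T) x = (T \<circ> hat h) x"
      using hat(3)[OF h hat_graph_shift[OF h xy, of a]] hat(3)[OF h xy] by (simp add: T_def transl_def)
  qed (use hat(1)[OF h] homeos_comp transl_homeos in \<open>auto simp: T_def\<close>)
  from fun_cong[OF this, of x] show ?thesis
    by (simp add: T_def transl_def)
qed

lemma hat_gap_integer:
  assumes h: "h \<in> exotics m" and j: "- (int n - int m) \<le> j" "j \<le> 0"
  shows "hat h (of_int j) = of_int j"
proof -
  have *: "hat k (of_int j) \<le> of_int j" if k: "k \<in> exotics m" for k
  proof (rule ccontr)
    assume "\<not> hat k (of_int j) \<le> of_int j"
    then obtain y where y: "y \<in> znadic n" "of_int j < y" "y < hat k (of_int j)"
      using dense_znadic[OF n2, of "of_int j" "hat k (of_int j)"] by auto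
    then obtain x where "hat_graph (finv k) y x"
      using hat_graph_total[OF exotics_finv[OF k]] by blast
    then have x: "hat_graph k x y"
      using hat_graph_sym[OF exotics_finv[OF k]] exoticsD(1)[OF k] by fastforce
    then have "hat k x < hat k (of_int j)"
      using hat(3)[OF k] y by simp
    then have "x < of_int j"
      using hat(2)[OF k] by (simp add: strict_mono_less)
    then show False
      using hat_graph_gap_integer(1)[OF k x j] y by simp
  qed
  have "hat (finv h) (of_int j) \<le> of_int j"
    using *[OF exotics_finv[OF h]] .
  then have "hat h (finv (hat h) (of_int j)) \<le> hat h (of_int j)"
    using hat(2)[OF h] by (simp add: hat_finv[OF h] strict_mono_less_eq)
  then show ?thesis
    using *[OF h] hat(1)[OF h] by simp
qed

text \<open>On \<open>[q, q + 1]\<close> this is the recursion in the definition of \<^const>\<open>hat_graph\<close>. To the left and to the right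
  of this interval the generator is the identity and a translation with which \<^term>\<open>hat h\<close> commutes.\<close>

lemma hat_commute_gap_gen_base:
  assumes h: "h \<in> exotics m" and q: "- (int n - int m) \<le> q" "q < 0"
  shows "hat h \<circ> pl_gen n q = pl_gen n q \<circ> hat h"
proof (rule homeos_eq_on_hat_graph[OF h])
  fix x y assume xy: "hat_graph h x y"
  note y = hat(3)[OF h xy]
  consider "x \<le> of_int q" | "of_int q < x" "x < of_int q + 1" | "of_int q + 1 \<le> x"
    by linarith
  then have "hat h (pl_gen n q x) = pl_gen n q y"
  proof cases
    case 1
    then have "y \<le> of_int q"
      using hat_graph_gap_integer(2)[OF h xy, of q] q by auto
    then show ?thesis
      using 1 y by (simp add: pl_gen_simps)
  next
    case 3
    then have "of_int q + 1 \<le> y"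
      using hat_graph_gap_integer(1)[OF h xy, of "q + 1"] q by auto
    then show ?thesis
      using 3 y hat_shift[OF h, of x 1] by (simp add: pl_gen_simps)
  next
    case 2
    have q': "real_of_int (- (int n - int m)) \<le> of_int q" "real_of_int (q + 1) \<le> of_int 0"
      unfolding of_int_le_iff using q by auto
    obtain p v w where c: "p \<in> znadic m" "x = gap_point p v" "y = gap_point (h p) w"
      "- gap_width \<le> v" "v \<le> 0" "- gap_width \<le> w" "w \<le> 0"
      "gap_graph h v w"
      using xy by (rule hat_graph_cases)
    have "\<not> p < 0"
      using gap_point_ordered[OF c(1) znadic_0, of v "- gap_width"] c 2 q' by (auto simp: gap_point_0)
    moreover have "\<not> 0 < p"
      using gap_point_ordered[OF znadic_0 c(1), of 0 v] c 2 q' by (auto simp: gap_point_0)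
    ultimately have p: "p = 0"
      by linarith
    then have xv: "x = v" "y = w"
      using c exoticsD(3)[OF h] by (simp_all add: gap_point_0)
    have "v \<noteq> 0"
      using 2 q' xv by auto
    then obtain q0 where q0: "of_int q0 < v" "v < of_int q0 + 1" "of_int q0 < w" "w < of_int q0 + 1"
        "hat_graph h (of_int q0 + real n * (v - of_int q0)) (of_int q0 + real n * (w - of_int q0))"
      using c(8) by blast
    have "q0 = q"
      using 2 q0 xv by linarith
    then show ?thesis
      using hat(3)[OF h q0(5)] q0 xv by (simp add: pl_gen_simps)
  qed
  then show "(hat h \<circ> pl_gen n q) x = (pl_gen n q \<circ> hat h) x"
    using y by simp
qed (use hat(1)[OF h] homeos_comp pl_gen_homeos[OF n1] in auto)

lemma hat_commute_gap_gen:
  assumes h: "h \<in> exotics m" and j: "(int n - 1) * a - (int n - int m) \<le> j" "j < (int n - 1) * a"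
  shows "hat h (pl_gen n j x) = pl_gen n j (hat h x)"
proof -
  define q where "q = j - (int n - 1) * a"
  define c where "c = (int n - 1) * a"
  have q: "- (int n - int m) \<le> q" "q < 0" "j = q + c"
    using j by (auto simp: q_def c_def)
  have e: "pl_gen n j (z + of_int c) = pl_gen n q z + of_int c" for z
    unfolding q(3) by (rule pl_gen_add_int)
  define z where "z = x - of_int c"
  have x: "x = z + of_int c"
    by (simp add: z_def)
  have "hat h (pl_gen n j x) = hat h (pl_gen n q z + of_int c)"
    by (simp only: x e)
  also have "\<dots> = hat h (pl_gen n q z) + of_int c"
    unfolding c_def by (rule hat_shift[OF h])
  also have "hat h (pl_gen n q z) = pl_gen n q (hat h z)"
    using fun_cong[OF hat_commute_gap_gen_base[OF h q(1,2)], of z] by simp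
  also have "pl_gen n q (hat h z) + of_int c = pl_gen n j (hat h z + of_int c)"
    by (rule e[symmetric])
  also have "hat h z + of_int c = hat h x"
    unfolding x c_def by (rule hat_shift[OF h, symmetric])
  finally show ?thesis .
qed

text \<open>A generator with active index is a lift, hence conjugated to the lift of a conjugate;
  the translation and the generators with inactive index are fixed.\<close>

lemma hat_preserves_F_inf:
  assumes h: "h \<in> exotics m" and f: "f \<in> F_inf n"
  shows "conj_by (hat h) f \<in> F_inf n"
  using n2 f
proof (induction rule: F_inf_induct)
  case id
  have "conj_by (hat h) id = id"
    by (rule conj_by_eqI[OF hat(1)[OF h]]) simp
  show ?case
    unfolding \<open>conj_by (hat h) id = id\<close> by (rule F_inf_id[OF n2])
next
  case (gen g)
  then consider "g = transl (real n - 1)" | j where "g = pl_gen n j"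
    by (auto simp: F_gens_def)
  then show ?case
  proof cases
    case 1
    have "conj_by (hat h) g = g"
      using hat_shift[OF h, of _ 1] by (intro conj_by_eqI[OF hat(1)[OF h]]) (auto simp: 1 transl_def)
    then show ?thesis
      using transl_F_inf[OF n2, of 1] 1 by simp
  next
    case (2 j)
    show ?thesis
    proof (cases rule: unit_pos_cover[of j])
      case i: (1 i)
      obtain F' where F': "F' \<in> F_inf n" "lifts (conj_by h (pl_gen m i)) F'"
        using lift_exists exoticsD(4)[OF h pl_gen_F_inf[OF m2]] by blast
      have "conj_by (hat h) g = F'"
        unfolding 2 i using F' F_inf_homeos[OF n2] pl_gen_homeos[OF n1]
        by (intro hat_lift[OF h pl_gen_F_inf[OF m2] lifts_pl_gen]) auto
      then show ?thesis
        using F' by simp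
    next
      case a: (2 a)
      have "conj_by (hat h) g = g"
        using hat_commute_gap_gen[OF h a] by (intro conj_by_eqI[OF hat(1)[OF h]]) (auto simp: 2)
      then show ?thesis
        using pl_gen_F_inf[OF n2] 2 by simp
    qed
  qed
next
  case (inv g)
  then have "g \<in> homeos"
    using F_gens_F_inf[OF n2] F_inf_homeos[OF n2] by blast
  then show ?case
    using inv F_inf_finv[OF n2] conj_by_inv[OF hat(1)[OF h]] by simp
next
  case (comp f g)
  show ?case
    unfolding conj_by_mult[OF hat(1)[OF h]] by (rule F_inf_comp[OF n2 comp.IH])
qed

lemma hat_gap_point:
  assumes h: "h \<in> exotics m" and p: "p \<in> znadic m" and v: "- gap_width \<le> v" "v \<le> 0"
  shows "hat h (gap_point p v) = gap_point (h p) (hat h v)"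
proof -
  obtain f where f: "f \<in> F_inf m" "f 0 = p"
    using F_inf_orbit_0[OF m2 p] by blast
  obtain F where F: "F \<in> F_inf n" "lifts f F"
    using lift_exists[OF f(1)] by blast
  obtain F' where F': "F' \<in> F_inf n" "lifts (conj_by h f) F'"
    using lift_exists exoticsD(4)[OF h f(1)] by blast
  have "conj_by (hat h) F = F'"
    using F F' F_inf_homeos[OF n2] by (intro hat_lift[OF h f(1)]) auto
  then have "hat h (F v) = F' (hat h v)"
    using conj_by_apply[OF hat(1)[OF h], of F v] by simp
  moreover have "F v = gap_point p v"
    using F(2) v f(2) znadic_0[of m] unfolding lifts_def by (metis gap_point_0)
  moreover have "F' (hat h v) = gap_point (h p) (hat h v)"
  proof -
    have "hat h (of_int (- (int n - int m))) \<le> hat h v" "hat h v \<le> hat h (of_int 0)"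
      using v hat(2)[OF h] by (simp_all add: strict_mono_less_eq)
    then have "- gap_width \<le> hat h v" "hat h v \<le> 0"
      using hat_gap_integer[OF h, of "- (int n - int m)"] hat_gap_integer[OF h, of 0] mn by auto
    then have "F' (gap_point 0 (hat h v)) = gap_point (conj_by h f 0) (hat h v)"
      using F'(2) unfolding lifts_def by simp
    moreover have "conj_by h f 0 = h p"
      using conj_by_apply[OF exoticsD(1)[OF h], of f 0] exoticsD(3)[OF h] f by simp
    ultimately show ?thesis
      by (simp add: gap_point_0)
  qed
  ultimately show ?thesis
    by simp
qed

end

section \<open>Rigidity: no exotic homeomorphism normalizes \<open>A\<^sub>n(\<real>)\<close>\<close>

context gap_pair
begin

lemma hat_self_similar:
  assumes h: "h \<in> exotics m" and q: "- (int n - int m) \<le> q" "q < 0" and u: "0 \<le> u" "u \<le> real n"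
  shows "hat h (of_int q + u / real n ^ k) - of_int q = (hat h (of_int q + u) - of_int q) / real n ^ k"
proof (induction k)
  case (Suc k)
  define z where "z = u / real n ^ Suc k"
  have "real n * 1 \<le> real n * real n ^ k"
    using n2 by (intro mult_left_mono one_le_power) auto
  then have "u \<le> real n * real n ^ k"
    using u(2) by simp
  then have z: "0 \<le> z" "z \<le> 1"
    using u n2 by (auto simp: z_def pos_divide_le_eq)
  have q01: "hat h (of_int q) = of_int q" "hat h (of_int (q + 1)) = of_int (q + 1)"
    using hat_gap_integer[OF h, of q] hat_gap_integer[OF h, of "q + 1"] q by auto
  have "hat h (of_int q) \<le> hat h (of_int q + z)" "hat h (of_int q + z) \<le> hat h (of_int (q + 1))"
    using z hat(2)[OF h] by (simp_all add: strict_mono_less_eq)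
  then have img: "of_int q \<le> hat h (of_int q + z)" "hat h (of_int q + z) \<le> of_int q + 1"
    using q01 by auto
  have "hat h (pl_gen n q (of_int q + z)) = pl_gen n q (hat h (of_int q + z))"
    using fun_cong[OF hat_commute_gap_gen_base[OF h q], of "of_int q + z"] by simp
  then have "hat h (of_int q + real n * z) = of_int q + real n * (hat h (of_int q + z) - of_int q)"
    using z img by (simp add: pl_gen_simps)
  moreover have "real n * z = u / real n ^ k"
    using n2 by (simp add: z_def)
  ultimately have "hat h (of_int q + u / real n ^ k) - of_int q = real n * (hat h (of_int q + z) - of_int q)"
    by simp
  then have "real n * (hat h (of_int q + z) - of_int q) = (hat h (of_int q + u) - of_int q) / real n ^ k"
    using Suc.IH by simp
  then have "hat h (of_int q + z) - of_int q = (hat h (of_int q + u) - of_int q) / real n ^ k / real n"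
    using n2 by (simp add: eq_divide_eq mult_ac)
  then show ?case
    by (simp add: z_def mult.commute)
qed simp

lemma exists_small_scale:
  assumes "\<delta> > 0"
  obtains k where "real n / real n ^ k \<le> \<delta>"
proof -
  obtain k where "(1 / real n) ^ k < \<delta> / real n"
    using real_arch_pow_inv[of "\<delta> / real n" "1 / real n"] assms n2 by auto
  then have "real n / real n ^ k \<le> \<delta>"
    using n2 by (simp add: power_divide field_simps)
  then show ?thesis
    using that by blast
qed

text \<open>The first point of the orbit of \<open>0\<close> that is met to the right of \<open>i\<close> when \<open>[i, i + m / m\<^sup>k]\<close> is divided
  into \<open>m\<close> pieces. These points converge to \<open>i\<close>, and so do the gaps at them.\<close>

lemma gaps_right_of_integer:
  assumes i: "0 \<le> i" "i \<le> int m - 2"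
  defines "p \<equiv> \<lambda>k. of_int i + (real m - 1 - of_int i) / real m ^ k"
  shows "p k \<in> znadic m \<and> gap_end (p k) = of_int i + (real n - 1 - of_int i) / real n ^ k \<and>
    gap_scale (p k) = 1 / real n ^ k"
proof (induction k)
  case 0
  have p0: "p 0 = of_int ((int m - 1) * 1)"
    by (simp add: p_def)
  have "gap_end (p 0) = of_int ((int n - 1) * 1)"
    unfolding p0 gap_end_int unit_pos_mult ..
  then show ?case
    using znadic_int_mult[OF m2, of 1] gap_scale_int[of "(int m - 1) * 1"] unfolding p0[symmetric] by simp
next
  case (Suc k)
  have "real_of_int i \<le> of_int (int m - 2)" "real_of_int 0 \<le> of_int i"
    unfolding of_int_le_iff using i by auto
  then have ir: "real_of_int i \<le> real m - 2" "0 \<le> real_of_int i"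
    by auto
  have mk: "real m ^ k \<ge> 1"
    using m2 by (intro one_le_power) auto
  have d: "0 < (real m - 1 - of_int i) / real m ^ Suc k" "(real m - 1 - of_int i) / real m ^ Suc k < 1"
  proof -
    have "real m - 1 - of_int i < real m * 1"
      using ir by simp
    also have "\<dots> \<le> real m * real m ^ k"
      using mk by (intro mult_left_mono) auto
    finally show "(real m - 1 - of_int i) / real m ^ Suc k < 1"
      using m2 by (simp add: pos_divide_less_eq)
    show "0 < (real m - 1 - of_int i) / real m ^ Suc k"
      using ir m2 by simp
  qed
  have b: "of_int i < p (Suc k)" "p (Suc k) < of_int i + 1"
    using d by (auto simp: p_def)
  then have fl: "\<lfloor>p (Suc k)\<rfloor> = i"
    by (auto simp: floor_unique)
  have nint: "p (Suc k) \<notin> \<int>"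
    using b fl by (auto elim!: Ints_cases)
  have pl: "pl_gen m i (p (Suc k)) = p k"
    using pl_gen_floor[of m "p (Suc k)"] m2 unfolding fl by (simp add: p_def)
  have Z: "p (Suc k) \<in> znadic m"
    using Suc.IH pl_gen_znadic_iff[OF m2, of i "p (Suc k)"] unfolding pl by simp
  have ui: "unit_pos i = i"
    using i m2 by (simp add: unit_pos_def)
  note N = znadic_nadic[OF m1 Z]
  have "gap_end (p (Suc k)) = of_int i + (gap_end (p k) - of_int i) / real n"
    using gap_end_step[OF N nint] unfolding fl ui pl .
  moreover have "gap_scale (p (Suc k)) = gap_scale (p k) / real n"
    using gap_scale_step[OF N nint] unfolding fl pl .
  ultimately show ?case
    using Z Suc.IH by simp
qed

text \<open>If the transported homeomorphism conjugates translations into \<open>A\<^sub>n(\<real>)\<close>, then up to affine maps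
  whose slopes are powers of \<open>n\<close> it has the same germ to the right of every integer. In a gap this germ is
  self-similar and determines everything; call the resulting function on a unit interval \<open>Q\<close>. The
  other unit intervals of a period are \<open>[r, r + 1]\<close> with \<open>0 \<le> r \<le> m - 2\<close>. The germ to the right of
  \<open>m - 2 - r\<close> is a copy of the germ to the right of \<open>-1\<close>, and where the latter repeats \<open>[r, r + 1]\<close> the former
  has the first interval of a gap; so \<open>[r, r + 1]\<close> carries an affine copy of \<open>Q\<close> too. Hence the images of
  these \<open>m - 1\<close> intervals have lengths that are powers of \<open>n\<close>. The lengths add up to \<open>m - 1 < n\<close>, so none
  exceeds \<open>1\<close>, and therefore all are \<open>1\<close>.
  Now \<open>Q\<close> on \<open>[0, 1]\<close> consists of \<open>n\<close> copies of itself, which makes it the identity.\<close>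

lemma hat_rigid:
  assumes h: "h \<in> exotics m" and A: "\<And>r::int. conj_by (hat h) (transl (of_int r)) \<in> A_R n"
  shows "hat h = id"
proof -
  note hom = hat(1)[OF h] and mono = hat(2)[OF h]
  define Q where "Q u = hat h (of_int (- 1) + u) - of_int (- 1)" for u
  have n0: "real n > 0" and npos: "real n ^ k > 0" "real n powi c > 0" for k c
    using n2 by auto
  have fixed: "hat h (of_int j) = of_int j" if "- (int n - int m) \<le> j" "j \<le> 0" for j
    using hat_gap_integer[OF h that] .
  have Q01: "Q 0 = 0" "Q 1 = 1"
    using fixed[of "- 1"] fixed[of 0] mn by (auto simp: Q_def)
  have Qmono: "Q u < Q v \<longleftrightarrow> u < v" "Q u \<le> Q v \<longleftrightarrow> u \<le> v" for u v
    using mono by (auto simp: Q_def strict_mono_less strict_mono_less_eq)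
  have Qsim: "Q (u / real n ^ k) = Q u / real n ^ k" if "0 \<le> u" "u \<le> real n" for u k
    using hat_self_similar[OF h, of "- 1" u k] that mn by (simp add: Q_def)

  have germs: "\<exists>c. \<exists>\<delta>>0. \<forall>u\<in>{0..\<delta>}. hat h (of_int i + u) = hat h (of_int i) + real n powi c * Q u" for i :: int
  proof -
    define f where "f = conj_by (hat h) (transl (of_int (i + 1)))"
    have f: "f (hat h x) = hat h (x + of_int (i + 1))" for x
      using conj_by_apply[OF hom] by (simp add: f_def transl_def)
    obtain k c where "germ n f (- 1) k c"
      using A[of "i + 1"] A_R_iff[OF n2] nadic_germsE unfolding f_def by metis
    then obtain e where e: "e > 0" "\<And>y. - 1 \<le> y \<Longrightarrow> y \<le> - 1 + e \<Longrightarrow> f y = f (- 1) + real n powi c * (y - - 1)"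
      using germ_interval by metis
    define \<delta> where "\<delta> = finv (hat h) (- 1 + e) + 1"
    have h1: "hat h (- 1) = - 1"
      using fixed[of "- 1"] mn by simp
    have "hat h (- 1) < hat h (finv (hat h) (- 1 + e))"
      using h1 e(1) hom by simp
    then have "\<delta> > 0"
      using mono by (simp add: strict_mono_less \<delta>_def)
    have fm1: "f (- 1) = hat h (of_int i)"
      using f[of "- 1"] h1 by simp
    have "hat h (of_int i + u) = hat h (of_int i) + real n powi c * Q u" if u: "u \<in> {0..\<delta>}" for u
    proof -
      have "hat h (- 1) \<le> hat h (- 1 + u)" "hat h (- 1 + u) \<le> hat h (finv (hat h) (- 1 + e))"
        using u mono by (auto simp: strict_mono_less_eq \<delta>_def)
      then have "- 1 \<le> hat h (- 1 + u)" "hat h (- 1 + u) \<le> - 1 + e"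
        using h1 hom by auto
      then have "f (hat h (- 1 + u)) = f (- 1) + real n powi c * (hat h (- 1 + u) - - 1)"
        by (rule e(2))
      then show ?thesis
        using f[of "- 1 + u"] fm1 by (simp add: Q_def add.commute)
    qed
    then show ?thesis
      using \<open>\<delta> > 0\<close> by blast
  qed

  have gap_units: "hat h (of_int q + u) = of_int q + Q u"
    if q: "- (int n - int m) \<le> q" "q < 0" and u: "0 \<le> u" "u \<le> 1" for q u
  proof -
    obtain c \<delta> where c: "\<delta> > 0" "\<And>u. u \<in> {0..\<delta>} \<Longrightarrow> hat h (of_int q + u) = hat h (of_int q) + real n powi c * Q u"
      using germs[of q] by blast
    obtain k where k: "real n / real n ^ k \<le> \<delta>"
      using exists_small_scale[OF c(1)] .
    have qq: "hat h (of_int q) = of_int q" "hat h (of_int q + 1) = of_int q + 1"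
      using fixed[of q] fixed[of "q + 1"] q by auto
    have *: "hat h (of_int q + u) - of_int q = real n powi c * Q u" if u: "0 \<le> u" "u \<le> 1" for u
    proof -
      have un: "u \<le> real n"
        using u n2 by simp
      then have "u / real n ^ k \<le> real n / real n ^ k"
        using npos(1)[of k] by (intro divide_right_mono) auto
      then have "u / real n ^ k \<in> {0..\<delta>}"
        using k u npos(1)[of k] by auto
      then have "hat h (of_int q + u / real n ^ k) - of_int q = real n powi c * Q (u / real n ^ k)"
        using c(2) qq(1) by simp
      then have "(hat h (of_int q + u) - of_int q) / real n ^ k = (real n powi c * Q u) / real n ^ k"
        using hat_self_similar[OF h q u(1) un, of k] Qsim[OF u(1) un, of k] by simp
      then show ?thesis
        using n2 by simp
    qed
    have "real n powi c = 1"
      using *[of 1] qq Q01 by simp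
    then show ?thesis
      using *[OF u] by simp
  qed

  have active_units: "\<exists>c. \<forall>u\<in>{0..1}. hat h (of_int r + u) = hat h (of_int r) + real n powi c * Q u"
    if r: "0 \<le> r" "r \<le> int m - 2" for r
  proof -
    \<comment> \<open>When \<open>[i, i + n / n\<^sup>k]\<close> is divided into \<open>n\<close> pieces, a gap starts with piece number \<open>r + 1\<close>, counted from \<open>0\<close>. In
      \<open>[-1, n - 1]\<close> this is the place of \<open>[r, r + 1]\<close>.\<close>
    define i where "i = int m - 2 - r"
    have i: "0 \<le> i" "i \<le> int m - 2"
      using r by (auto simp: i_def)
    obtain c \<delta> where c: "\<delta> > 0" "\<And>u. u \<in> {0..\<delta>} \<Longrightarrow> hat h (of_int i + u) = hat h (of_int i) + real n powi c * Q u"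
      using germs[of i] by blast
    obtain k where k: "real n / real n ^ k \<le> \<delta>"
      using exists_small_scale[OF c(1)] .
    define p where "p = of_int i + (real m - 1 - of_int i) / real m ^ k"
    have p: "p \<in> znadic m" "gap_end p = of_int i + (real n - 1 - of_int i) / real n ^ k" "gap_scale p = 1 / real n ^ k"
      using gaps_right_of_integer[OF i, of k] by (auto simp: p_def)
    have eq: "hat h (of_int i) + real n powi c * ((hat h (of_int r + u) + 1) / real n ^ k) =
        gap_end (h p) + gap_scale (h p) * (- gap_width + Q u)" if u: "u \<in> {0..1}" for u
    proof -
      define v where "v = of_int (- (int n - int m)) + u"
      have "real (m + 1) \<le> real n"
        unfolding of_nat_le_iff using mn by simp
      then have v: "- gap_width \<le> v" "v \<le> 0"
        using u by (auto simp: v_def)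
      have "gap_point p v = of_int i + ((real n - 1 - of_int i) + v) / real n ^ k"
        unfolding gap_point_def p by (simp add: add_divide_distrib)
      also have "(real n - 1 - of_int i) + v = of_int r + 1 + u"
        by (simp add: v_def i_def)
      finally have gp: "gap_point p v = of_int i + (of_int r + 1 + u) / real n ^ k" .
      have "real_of_int 0 \<le> of_int r" "real_of_int r \<le> of_int (int m - 2)"
        unfolding of_int_le_iff using r by auto
      then have ru: "0 \<le> of_int r + 1 + u" "of_int r + 1 + u \<le> real n"
        using u mn by auto
      then have "(of_int r + 1 + u) / real n ^ k \<le> real n / real n ^ k"
        using npos(1)[of k] by (intro divide_right_mono) auto
      then have "(of_int r + 1 + u) / real n ^ k \<in> {0..\<delta>}"
        using k ru npos(1)[of k] by auto
      then have "hat h (gap_point p v) = hat h (of_int i) + real n powi c * (Q (of_int r + 1 + u) / real n ^ k)"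
        unfolding gp using c(2) Qsim[OF ru, of k] by simp
      also have "Q (of_int r + 1 + u) = hat h (of_int r + u) + 1"
        by (simp add: Q_def add_ac)
      finally have "hat h (gap_point p v) = hat h (of_int i) + real n powi c * ((hat h (of_int r + u) + 1) / real n ^ k)" .
      moreover have "hat h v = - gap_width + Q u"
        using gap_units[of "- (int n - int m)" u] u mn by (simp add: v_def)
      then have "hat h (gap_point p v) = gap_end (h p) + gap_scale (h p) * (- gap_width + Q u)"
        using hat_gap_point[OF h p(1) v] by (simp add: gap_point_def)
      ultimately show ?thesis
        by simp
    qed
    define b where "b = int k - int (level m (h p)) - c"
    have b: "real n powi b = gap_scale (h p) * real n ^ k / real n powi c"
      using n2 by (simp add: b_def gap_scale_def power_int_diff power_int_minus power_int_add field_simps)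
    have "hat h (of_int r + u) = hat h (of_int r) + real n powi b * Q u" if u: "u \<in> {0..1}" for u
    proof -
      have "real n powi c * ((hat h (of_int r + u) + 1) / real n ^ k) - real n powi c * ((hat h (of_int r) + 1) / real n ^ k) =
          gap_scale (h p) * (- gap_width + Q u) - gap_scale (h p) * (- gap_width)"
        using eq[OF u] eq[of 0] Q01 by simp
      moreover have "real n powi c * ((hat h (of_int r + u) + 1) / real n ^ k) - real n powi c * ((hat h (of_int r) + 1) / real n ^ k) =
          real n powi c * ((hat h (of_int r + u) - hat h (of_int r)) / real n ^ k)"
        by (simp flip: right_diff_distrib diff_divide_distrib)
      moreover have "gap_scale (h p) * (- gap_width + Q u) - gap_scale (h p) * (- gap_width) = gap_scale (h p) * Q u"
        by (simp flip: right_diff_distrib)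
      ultimately have "real n powi c * ((hat h (of_int r + u) - hat h (of_int r)) / real n ^ k) = gap_scale (h p) * Q u"
        by argo
      then have "hat h (of_int r + u) - hat h (of_int r) = gap_scale (h p) * real n ^ k / real n powi c * Q u"
        using n2 by (simp add: field_simps)
      then show ?thesis
        unfolding b by simp
    qed
    then show ?thesis
      by blast
  qed

  have fix_m1: "hat h (real m - 1) = real m - 1"
    using hat_shift[OF h, of "of_int (- (int n - int m))" 1] fixed[of "- (int n - int m)"] mn by simp
  have h0: "hat h 0 = 0"
    using fixed[of 0] mn by simp
  have len: "hat h (of_int r + 1) - hat h (of_int r) \<le> 1" if r: "0 \<le> r" "r \<le> int m - 2" for r
  proof -
    obtain c where c: "hat h (of_int r + u) = hat h (of_int r) + real n powi c * Q u" if "u \<in> {0..1}" for u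
      using active_units[OF r] by blast
    have "real_of_int 0 \<le> of_int r" "real_of_int r \<le> of_int (int m - 2)"
      unfolding of_int_le_iff using r by auto
    then have "hat h 0 \<le> hat h (of_int r)" "hat h (of_int r + 1) \<le> hat h (real m - 1)"
      using mono by (auto simp: strict_mono_less_eq)
    then have "real n powi c \<le> real m - 1"
      using c[of 1] h0 fix_m1 Q01 by simp
    also have "\<dots> < real n powi 1"
      using mn by simp
    finally have "\<not> 1 \<le> c"
      using n2 power_int_increasing[of 1 c "real n"] by auto
    then have "real n powi c \<le> real n powi 0"
      using n2 by (intro power_int_increasing) auto
    then show ?thesis
      using c[of 1] Q01 by simp
  qed
  have below: "hat h (of_int r) \<le> of_int r" if "0 \<le> r" "r \<le> int m - 1" for r
    using that
  proof (induction r rule: int_ge_induct)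
    case base
    then show ?case
      using h0 by simp
  next
    case (step r)
    then show ?case
      using len[of r] by simp
  qed
  have above: "of_int (int m - 1 - s) \<le> hat h (of_int (int m - 1 - s))" if "0 \<le> s" "s \<le> int m - 1" for s
    using that
  proof (induction s rule: int_ge_induct)
    case base
    then show ?case
      using fix_m1 by simp
  next
    case (step s)
    define r where "r = int m - 1 - (s + 1)"
    have r: "real_of_int (int m - 1 - s) = of_int r + 1"
      by (simp add: r_def)
    have "hat h (of_int r + 1) - hat h (of_int r) \<le> 1"
      using step by (intro len) (auto simp: r_def)
    moreover have "of_int r + 1 \<le> hat h (of_int r + 1)"
      using step unfolding r by simp
    ultimately show ?case
      unfolding r_def[symmetric] by linarith
  qed
  have fix_active: "hat h (of_int r) = of_int r" if "0 \<le> r" "r \<le> int m - 1" for r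
    using below[OF that] above[of "int m - 1 - r"] that by simp
  have units: "hat h (of_int j + u) = of_int j + Q u" if j: "- 1 \<le> j" "j \<le> int n - 2" and u: "0 \<le> u" "u \<le> 1" for j u
  proof -
    consider "j = - 1" | "0 \<le> j" "j \<le> int m - 2" | "int m - 1 \<le> j"
      using j by linarith
    then show ?thesis
    proof cases
      case 1
      then show ?thesis
        using gap_units[of "- 1" u] u mn by simp
    next
      case 2
      obtain c where c: "hat h (of_int j + u) = hat h (of_int j) + real n powi c * Q u" if "u \<in> {0..1}" for u
        using active_units[OF 2] by blast
      have "hat h (of_int (j + 1)) = of_int (j + 1)" "hat h (of_int j) = of_int j"
        using fix_active[of j] fix_active[of "j + 1"] 2 by auto
      then have "real n powi c = 1"
        using c[of 1] Q01 by simp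
      then show ?thesis
        using c[of u] u \<open>hat h (of_int j) = of_int j\<close> by simp
    next
      case 3
      define q where "q = j - (int n - 1)"
      have "hat h (of_int q + u + of_int ((int n - 1) * 1)) = of_int q + Q u + of_int ((int n - 1) * 1)"
        unfolding hat_shift[OF h] using gap_units[of q u] 3 j u by (simp add: q_def)
      then show ?thesis
        by (simp add: q_def algebra_simps)
    qed
  qed

  have Q_near: "\<bar>Q u - u\<bar> \<le> 1 / real n ^ k" if "0 \<le> u" "u \<le> 1" for u k
    using that
  proof (induction k arbitrary: u)
    case 0
    then have "Q 0 \<le> Q u" "Q u \<le> Q 1"
      using Qmono by auto
    then show ?case
      using 0 Q01 by auto
  next
    case (Suc k)
    show ?case
    proof (cases "u = 1")
      case True
      then show ?thesis
        using Q01 npos(1)[of "Suc k"] by simp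
    next
      case False
      define j where "j = \<lfloor>real n * u\<rfloor>"
      define u' where "u' = real n * u - of_int j"
      have nu: "0 \<le> real n * u" "real n * u < real n"
        using Suc.prems False n2 by auto
      have u': "0 \<le> u'" "u' \<le> 1"
        unfolding u'_def j_def by linarith+
      have j: "0 \<le> j" "j < int n"
        using nu by (auto simp: j_def floor_less_iff)
      have "Q (of_int j + u') = of_int j + Q u'"
        using units[of "j - 1" u'] j u' by (simp add: Q_def add_ac)
      moreover have "Q u = Q (real n * u) / real n"
        using Qsim[of "real n * u" 1] nu n2 by simp
      moreover have "real n * u = of_int j + u'"
        by (simp add: u'_def)
      ultimately have "Q u - u = (Q u' - u') / real n"
        using n2 by (simp add: field_simps)
      then have "\<bar>Q u - u\<bar> = \<bar>Q u' - u'\<bar> / real n"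
        by simp
      also have "\<dots> \<le> 1 / real n ^ k / real n"
        using Suc.IH[OF u'] n2 by (intro divide_right_mono) auto
      finally show ?thesis
        by (simp add: field_simps)
    qed
  qed
  have Qid: "Q u = u" if u: "0 \<le> u" "u \<le> 1" for u
  proof (rule ccontr)
    assume "Q u \<noteq> u"
    then obtain k where "(1 / real n) ^ k < \<bar>Q u - u\<bar>"
      using real_arch_pow_inv[of "\<bar>Q u - u\<bar>" "1 / real n"] n2 by auto
    then show False
      using Q_near[OF u, of k] by (simp add: power_divide)
  qed
  show ?thesis
  proof
    fix x :: real
    define a where "a = \<lfloor>x\<rfloor> div (int n - 1)"
    define j where "j = \<lfloor>x\<rfloor> mod (int n - 1)"
    define u where "u = x - of_int \<lfloor>x\<rfloor>"
    have j: "0 \<le> j" "j \<le> int n - 2" "\<lfloor>x\<rfloor> = (int n - 1) * a + j"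
    proof -
      show "0 \<le> j"
        using n2 by (simp add: j_def)
      have "j < int n - 1"
        using n2 unfolding j_def by (intro pos_mod_bound) simp
      then show "j \<le> int n - 2"
        by simp
      show "\<lfloor>x\<rfloor> = (int n - 1) * a + j"
        by (simp add: j_def a_def)
    qed
    have u: "0 \<le> u" "u \<le> 1"
      unfolding u_def by linarith+
    have x: "x = of_int j + u + of_int ((int n - 1) * a)"
      using j(3) by (simp add: u_def)
    have "hat h x = hat h (of_int j + u) + of_int ((int n - 1) * a)"
      unfolding x by (rule hat_shift[OF h])
    also have "hat h (of_int j + u) = of_int j + u"
      using units[of j u] j u Qid[OF u] by simp
    finally show "hat h x = id x"
      using x by simp
  qed
qed

end

section \<open>Automorphisms given by conjugation\<close>

definition conj_aut :: "(real \<Rightarrow> real) set \<Rightarrow> (real \<Rightarrow> real) \<Rightarrow> (real \<Rightarrow> real) \<Rightarrow> (real \<Rightarrow> real)" where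
  "conj_aut G h = restrict (conj_by h) G"

definition normalizes :: "(real \<Rightarrow> real) \<Rightarrow> (real \<Rightarrow> real) set \<Rightarrow> bool" where
  "normalizes h G \<longleftrightarrow> h \<in> homeos \<and> conj_by h ` G = G"

lemma normalizesI:
  assumes "h \<in> homeos" "\<And>f. f \<in> G \<Longrightarrow> conj_by h f \<in> G" "\<And>f. f \<in> G \<Longrightarrow> conj_by (finv h) f \<in> G"
  shows "normalizes h G"
  unfolding normalizes_def
proof (intro conjI assms(1) equalityI subsetI)
  fix f assume "f \<in> G"
  then show "f \<in> conj_by h ` G"
    using assms by (intro image_eqI[of _ _ "conj_by (finv h) f"]) auto
qed (use assms in auto)

lemma group_Aut: "subgroup G homeo_group \<Longrightarrow> group (Aut G)"
  by (simp add: group.AutoGroup homeo.subgroup_imp_group)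

lemma carrier_Aut: "carrier (Aut G) = hom (homeo_subgroup G) (homeo_subgroup G) \<inter> Bij G"
  by (simp add: AutoGroup_def auto_def)

lemma mult_Aut: "\<alpha> \<in> Bij G \<Longrightarrow> \<beta> \<in> Bij G \<Longrightarrow> \<alpha> \<otimes>\<^bsub>Aut G\<^esub> \<beta> = compose G \<alpha> \<beta>"
  by (simp add: AutoGroup_def BijGroup_def)

lemma one_Aut: "\<one>\<^bsub>Aut G\<^esub> = conj_aut G id"
  unfolding conj_aut_def conj_by_id by (simp add: AutoGroup_def BijGroup_def)

lemma conj_aut_Bij:
  assumes h: "normalizes h G"
  shows "conj_aut G h \<in> Bij G"
proof -
  have "inj_on (conj_by h) G"
    using h by (intro inj_on_inverseI[of _ "conj_by (finv h)"]) (simp add: normalizes_def)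
  then have "bij_betw (conj_by h) G G"
    using h by (simp add: bij_betw_def normalizes_def)
  then have "bij_betw (conj_aut G h) G G"
    by (subst bij_betw_cong[where g = "conj_by h"]) (auto simp: conj_aut_def)
  then show ?thesis
    by (simp add: Bij_def conj_aut_def)
qed

lemma conj_aut_Aut:
  assumes G: "subgroup G homeo_group" and h: "normalizes h G"
  shows "conj_aut G h \<in> carrier (Aut G)"
proof -
  have hh: "h \<in> homeos" and im: "\<And>f. f \<in> G \<Longrightarrow> conj_by h f \<in> G"
    using h by (auto simp: normalizes_def)
  have "conj_aut G h \<in> hom (homeo_subgroup G) (homeo_subgroup G)"
  proof (rule homI)
    fix f g assume "f \<in> carrier (homeo_subgroup G)" "g \<in> carrier (homeo_subgroup G)"
    then have fg: "f \<in> G" "g \<in> G" "g \<circ> f \<in> G"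
      using homeo_subgroupD(3)[OF G] by auto
    have "conj_aut G h (g \<circ> f) = conj_aut G h g \<circ> conj_aut G h f"
      unfolding conj_aut_def restrict_apply'[OF fg(1)] restrict_apply'[OF fg(2)] restrict_apply'[OF fg(3)]
      by (rule conj_by_mult[OF hh])
    moreover have "f \<otimes>\<^bsub>homeo_subgroup G\<^esub> g = g \<circ> f" for f g
      using mult_homeo_group[of f g] by simp
    ultimately show "conj_aut G h (f \<otimes>\<^bsub>homeo_subgroup G\<^esub> g) =
        conj_aut G h f \<otimes>\<^bsub>homeo_subgroup G\<^esub> conj_aut G h g"
      by metis
  qed (use im in \<open>simp add: conj_aut_def\<close>)
  then show ?thesis
    using conj_aut_Bij[OF h] by (simp add: carrier_Aut)
qed

lemma conj_aut_mult:
  assumes h: "normalizes h G" and k: "normalizes k G"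
  shows "conj_aut G h \<otimes>\<^bsub>Aut G\<^esub> conj_aut G k = conj_aut G (h \<circ> k)"
proof -
  have hk: "h \<in> homeos" "k \<in> homeos" "\<And>f. f \<in> G \<Longrightarrow> conj_by k f \<in> G"
    using h k by (auto simp: normalizes_def)
  have "compose G (conj_aut G h) (conj_aut G k) = conj_aut G (h \<circ> k)"
    using hk by (auto simp: compose_def conj_aut_def restrict_def fun_eq_iff conj_by_comp simp del: comp_apply)
  then show ?thesis
    using mult_Aut[OF conj_aut_Bij[OF h] conj_aut_Bij[OF k]] by simp
qed

lemma implements_conj_aut:
  assumes "implements h G \<alpha>" "\<alpha> \<in> carrier (Aut G)"
  shows "\<alpha> = conj_aut G h" "normalizes h G"
proof -
  have \<alpha>: "\<alpha> \<in> extensional G" "bij_betw \<alpha> G G"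
    using assms(2) by (auto simp: carrier_Aut Bij_def)
  show 1: "\<alpha> = conj_aut G h"
    unfolding conj_aut_def
    by (rule extensionalityI[OF \<alpha>(1) restrict_extensional]) (use assms(1) in \<open>simp add: implements_def\<close>)
  have "\<alpha> ` G = conj_by h ` G"
    by (rule image_cong) (use assms(1) in \<open>auto simp: implements_def\<close>)
  then show "normalizes h G"
    using assms(1) \<alpha>(2) by (simp add: normalizes_def implements_def bij_betw_def)
qed

lemma conj_aut_inj:
  assumes n: "n \<ge> 2" and G: "F_inf n \<subseteq> G" and h: "h \<in> homeos" and k: "k \<in> homeos"
    and eq: "conj_aut G h = conj_aut G k"
  shows "h = k"
proof -
  have "conj_by (finv k \<circ> h) f = f" if "f \<in> F_inf n" for f
  proof -
    have "f \<in> G"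
      using G that by blast
    then have "conj_by h f = conj_by k f"
      using fun_cong[OF eq, of f] by (simp add: conj_aut_def)
    then show ?thesis
      using h k conj_by_comp[OF homeos_inv[OF k] h, of f] by simp
  qed
  then have "finv k \<circ> h = id"
    using h k by (intro centralizer_F_inf[OF n] homeos_comp homeos_inv)
  then have "k \<circ> (finv k \<circ> h) = k"
    by simp
  then show ?thesis
    using k by (simp add: fun_eq_iff)
qed

text \<open>Conjugations compose like the homeomorphisms that implement them, so an injective homomorphism \<open>\<Phi>\<close>
  on a group \<open>K\<close> of homeomorphisms becomes one between groups of automorphisms.\<close>

lemma conj_aut_embedding:
  assumes G: "subgroup G homeo_group" and G': "subgroup G' homeo_group"
    and K: "id \<in> K" "\<And>h k. h \<in> K \<Longrightarrow> k \<in> K \<Longrightarrow> h \<circ> k \<in> K" "\<And>h. h \<in> K \<Longrightarrow> finv h \<in> K" "K \<subseteq> homeos"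
    and norm: "\<And>h. h \<in> K \<Longrightarrow> normalizes h G" "\<And>h. h \<in> K \<Longrightarrow> normalizes (\<Phi> h) G'"
    and hom: "\<And>h k. h \<in> K \<Longrightarrow> k \<in> K \<Longrightarrow> \<Phi> (h \<circ> k) = \<Phi> h \<circ> \<Phi> k" "\<Phi> id = id"
    and inj: "inj_on (conj_aut G) K" "inj_on (\<lambda>h. conj_aut G' (\<Phi> h)) K"
  defines "H \<equiv> (\<lambda>h. conj_aut G' (\<Phi> h)) ` K"
  shows "subgroup H (Aut G')" "(Aut G)\<lparr>carrier := conj_aut G ` K\<rparr> \<cong> (Aut G')\<lparr>carrier := H\<rparr>"
proof -
  have mult: "conj_aut G' (\<Phi> h) \<otimes>\<^bsub>Aut G'\<^esub> conj_aut G' (\<Phi> k) = conj_aut G' (\<Phi> (h \<circ> k))"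
    if "h \<in> K" "k \<in> K" for h k
    using conj_aut_mult[OF norm(2) norm(2)] that hom by simp
  show "subgroup H (Aut G')"
  proof (rule group.subgroupI[OF group_Aut[OF G']])
    show "H \<subseteq> carrier (Aut G')"
      using conj_aut_Aut[OF G' norm(2)] by (auto simp: H_def)
    show "H \<noteq> {}"
      using K(1) by (auto simp: H_def)
    show "\<alpha> \<otimes>\<^bsub>Aut G'\<^esub> \<beta> \<in> H" if "\<alpha> \<in> H" "\<beta> \<in> H" for \<alpha> \<beta>
      using that mult K(2) unfolding H_def by force
    show "inv\<^bsub>Aut G'\<^esub> \<alpha> \<in> H" if "\<alpha> \<in> H" for \<alpha>
    proof -
      obtain h where h: "h \<in> K" "\<alpha> = conj_aut G' (\<Phi> h)"
        using \<open>\<alpha> \<in> H\<close> by (auto simp: H_def)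
      have "finv h \<circ> h = id"
        using h K(4) by (auto simp: fun_eq_iff)
      then have eq: "conj_aut G' (\<Phi> (finv h)) \<otimes>\<^bsub>Aut G'\<^esub> conj_aut G' (\<Phi> h) = \<one>\<^bsub>Aut G'\<^esub>"
        using mult[OF K(3)[OF h(1)] h(1)] hom(2) one_Aut by metis
      have "inv\<^bsub>Aut G'\<^esub> \<alpha> = conj_aut G' (\<Phi> (finv h))"
        unfolding h(2)
        by (rule group.inv_equality[OF group_Aut[OF G'] eq conj_aut_Aut[OF G' norm(2)[OF h(1)]]
              conj_aut_Aut[OF G' norm(2)[OF K(3)[OF h(1)]]]])
      then show ?thesis
        using K(3) h by (auto simp: H_def)
    qed
  qed
  define \<Psi> where "\<Psi> \<alpha> = conj_aut G' (\<Phi> (the_inv_into K (conj_aut G) \<alpha>))" for \<alpha>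
  have \<Psi>: "\<Psi> (conj_aut G h) = conj_aut G' (\<Phi> h)" if "h \<in> K" for h
    using the_inv_into_f_f[OF inj(1) that] by (simp add: \<Psi>_def)
  have "\<Psi> \<in> iso ((Aut G)\<lparr>carrier := conj_aut G ` K\<rparr>) ((Aut G')\<lparr>carrier := H\<rparr>)"
  proof (rule isoI)
    show "\<Psi> \<in> hom ((Aut G)\<lparr>carrier := conj_aut G ` K\<rparr>) ((Aut G')\<lparr>carrier := H\<rparr>)"
    proof (rule homI)
      fix \<alpha> \<beta> assume "\<alpha> \<in> carrier ((Aut G)\<lparr>carrier := conj_aut G ` K\<rparr>)" "\<beta> \<in> carrier ((Aut G)\<lparr>carrier := conj_aut G ` K\<rparr>)"
      then obtain h k where hk: "h \<in> K" "k \<in> K" "\<alpha> = conj_aut G h" "\<beta> = conj_aut G k"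
        by auto
      then have "\<alpha> \<otimes>\<^bsub>Aut G\<^esub> \<beta> = conj_aut G (h \<circ> k)"
        using conj_aut_mult[OF norm(1) norm(1)] by simp
      then show "\<Psi> (\<alpha> \<otimes>\<^bsub>(Aut G)\<lparr>carrier := conj_aut G ` K\<rparr>\<^esub> \<beta>) = \<Psi> \<alpha> \<otimes>\<^bsub>(Aut G')\<lparr>carrier := H\<rparr>\<^esub> \<Psi> \<beta>"
        using hk mult \<Psi> K(2) by simp
    qed (use \<Psi> in \<open>auto simp: H_def\<close>)
    show "bij_betw \<Psi> (carrier ((Aut G)\<lparr>carrier := conj_aut G ` K\<rparr>)) (carrier ((Aut G')\<lparr>carrier := H\<rparr>))"
      unfolding bij_betw_def
    proof
      show "inj_on \<Psi> (carrier ((Aut G)\<lparr>carrier := conj_aut G ` K\<rparr>))"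
        using \<Psi> inj(2) by (auto simp: inj_on_def)
      show "\<Psi> ` carrier ((Aut G)\<lparr>carrier := conj_aut G ` K\<rparr>) = carrier ((Aut G')\<lparr>carrier := H\<rparr>)"
        using \<Psi> by (auto simp: H_def image_image)
    qed
  qed
  then show "(Aut G)\<lparr>carrier := conj_aut G ` K\<rparr> \<cong> (Aut G')\<lparr>carrier := H\<rparr>"
    by (auto simp: is_iso_def)
qed

section \<open>The exotic subgroups\<close>

lemma exotics_normalizes_F_inf: "h \<in> exotics m \<Longrightarrow> normalizes h (F_inf m)"
  using exoticsD[of h m] by (intro normalizesI) auto

lemma exotics_normalizes_B_R:
  assumes "m \<ge> 2" "h \<in> exotics m" "f \<in> B_R m"
  shows "conj_by h f \<in> B_R m"
  using assms exoticsD[OF assms(2)] by (intro conj_by_preserves_B_R) auto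

lemma translation_commute_iff:
  "h \<otimes>\<^bsub>homeo_group\<^esub> transl c = transl c \<otimes>\<^bsub>homeo_group\<^esub> h \<longleftrightarrow> (\<forall>x. h (x + c) = h x + c)"
  by (auto simp: fun_eq_iff transl_def)

lemma Aut0_eq:
  assumes m: "m \<ge> 2"
  shows "Aut0 m = conj_aut (F_inf m) ` exotics m"
proof (intro equalityI subsetI)
  fix \<alpha> assume "\<alpha> \<in> Aut0 m"
  then obtain h where \<alpha>: "\<alpha> \<in> carrier (Aut (F_inf m))" "implements h (F_inf m) \<alpha>"
    and h: "\<forall>x. h (x + (real m - 1)) = h x + (real m - 1)" "h 0 = 0"
    unfolding Aut0_def translation_commute_iff by blast
  note I = implements_conj_aut[OF \<alpha>(2,1)]
  have "h \<in> exotics m"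
    unfolding exotics_def
  proof (intro CollectI conjI ballI h)
    show hh: "h \<in> homeos"
      using I(2) by (simp add: normalizes_def)
    fix f assume f: "f \<in> F_inf m"
    show "conj_by h f \<in> F_inf m"
      using I(2) f by (auto simp: normalizes_def)
    obtain g where "g \<in> F_inf m" "f = conj_by h g"
      using I(2) f by (auto simp: normalizes_def)
    then show "conj_by (finv h) f \<in> F_inf m"
      using hh by simp
  qed
  then show "\<alpha> \<in> conj_aut (F_inf m) ` exotics m"
    using I(1) by blast
next
  fix \<alpha> assume "\<alpha> \<in> conj_aut (F_inf m) ` exotics m"
  then obtain h where h: "h \<in> exotics m" "\<alpha> = conj_aut (F_inf m) h"
    by blast
  have "\<alpha> \<in> carrier (Aut (F_inf m))"
    unfolding h(2) by (rule conj_aut_Aut[OF F_inf_subgroup[OF m] exotics_normalizes_F_inf[OF h(1)]])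
  moreover have "implements h (F_inf m) \<alpha>"
    using exoticsD(1)[OF h(1)] by (simp add: implements_def h(2) conj_aut_def)
  ultimately show "\<alpha> \<in> Aut0 m"
    unfolding Aut0_def translation_commute_iff using exoticsD(2,3)[OF h(1)] by blast
qed

definition locally_inner_exotics :: "nat \<Rightarrow> (real \<Rightarrow> real) set" where
  "locally_inner_exotics m =
     {h \<in> exotics m. \<forall>i. \<exists>w\<in>C0 m. conj_by h (pl_gen m i) = conj_by w (pl_gen m i)}"

lemma Aut0_LI_eq:
  assumes m: "m \<ge> 2"
  shows "{\<alpha> \<in> Aut0 m. locally_inner m \<alpha>} = conj_aut (F_inf m) ` locally_inner_exotics m"
  using pl_gen_F_inf[OF m]
  by (auto simp: Aut0_eq[OF m] locally_inner_exotics_def locally_inner_def conj_aut_def)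

lemma C0_iff: "w \<in> C0 m \<longleftrightarrow> w \<in> B_R m \<and> (\<forall>x. w (x + (real m - 1)) = w x + (real m - 1)) \<and> w 0 = 0"
  unfolding C0_def translation_commute_iff by simp

lemma C0_homeos: "m \<ge> 2 \<Longrightarrow> w \<in> C0 m \<Longrightarrow> w \<in> homeos"
  using homeo_subgroupD(1)[OF B_R_subgroup] by (auto simp: C0_iff)

lemma C0_id: "m \<ge> 2 \<Longrightarrow> id \<in> C0 m"
  using homeo_subgroupD(2)[OF B_R_subgroup] by (simp add: C0_iff)

lemma C0_comp:
  assumes m: "m \<ge> 2" and v: "v \<in> C0 m" and w: "w \<in> C0 m"
  shows "v \<circ> w \<in> C0 m"
proof -
  have "v \<circ> w \<in> B_R m"
    using v w by (intro homeo_subgroupD(3)[OF B_R_subgroup[OF m]]) (auto simp: C0_iff)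
  then show ?thesis
    using v w by (simp add: C0_iff)
qed

lemma finv_commute_translation:
  assumes "h \<in> homeos" "\<And>x. h (x + c) = h x + c"
  shows "finv h (x + c) = finv h x + c"
proof -
  have "finv h (h (finv h x + c)) = finv h x + c"
    using assms(1) by simp
  then show ?thesis
    using assms by simp
qed

lemma C0_finv:
  assumes m: "m \<ge> 2" and w: "w \<in> C0 m"
  shows "finv w \<in> C0 m"
proof -
  have h: "w \<in> homeos"
    using C0_homeos[OF m w] .
  have "finv w (w 0) = 0"
    using h by simp
  moreover have "finv w \<in> B_R m"
    using w by (intro homeo_subgroupD(4)[OF B_R_subgroup[OF m]]) (auto simp: C0_iff)
  ultimately show ?thesis
    using w finv_commute_translation[OF h] by (simp add: C0_iff)
qed

lemma C0_conj:
  assumes m: "m \<ge> 2" and h: "h \<in> exotics m" and w: "w \<in> C0 m"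
  shows "conj_by h w \<in> C0 m"
proof -
  note H = exoticsD[OF h]
  have "finv h 0 = 0"
    using homeos_inv_apply[OF H(1), of 0] H(3) by simp
  then show ?thesis
    using exotics_normalizes_B_R[OF m h] w H(2,3) finv_commute_translation[OF H(1,2)]
    by (simp add: C0_iff conj_by_eq[OF H(1)])
qed

text \<open>Locally inner elements are closed under composition and inversion because the group
  \<^const>\<open>C0\<close> is normalized by all of \<^const>\<open>exotics\<close>.\<close>

lemma locally_inner_exotics_id: "m \<ge> 2 \<Longrightarrow> id \<in> locally_inner_exotics m"
  using C0_id exotics_id unfolding locally_inner_exotics_def by blast

lemma conj_by_conj_by:
  assumes "h \<in> homeos" "w \<in> homeos"
  shows "conj_by h (conj_by w f) = conj_by (conj_by h w) (conj_by h f)"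
proof -
  have "conj_by h w \<circ> h = h \<circ> w"
    using assms by (auto simp: conj_by_eq)
  then show ?thesis
    using assms by (simp add: conj_by_comp conj_by_homeos)
qed

lemma locally_inner_exotics_comp:
  assumes m: "m \<ge> 2" and h: "h \<in> locally_inner_exotics m" and k: "k \<in> locally_inner_exotics m"
  shows "h \<circ> k \<in> locally_inner_exotics m"
proof -
  have hE: "h \<in> exotics m" and kE: "k \<in> exotics m"
    using h k by (auto simp: locally_inner_exotics_def)
  note hh = exoticsD(1)[OF hE] and kh = exoticsD(1)[OF kE]
  have "\<exists>w\<in>C0 m. conj_by (h \<circ> k) (pl_gen m i) = conj_by w (pl_gen m i)" for i
  proof -
    obtain v where v: "v \<in> C0 m" "conj_by h (pl_gen m i) = conj_by v (pl_gen m i)"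
      using h by (auto simp: locally_inner_exotics_def)
    obtain w where w: "w \<in> C0 m" "conj_by k (pl_gen m i) = conj_by w (pl_gen m i)"
      using k by (auto simp: locally_inner_exotics_def)
    have "conj_by (h \<circ> k) (pl_gen m i) = conj_by h (conj_by w (pl_gen m i))"
      using conj_by_comp[OF hh kh] w(2) by metis
    also have "\<dots> = conj_by (conj_by h w) (conj_by v (pl_gen m i))"
      unfolding conj_by_conj_by[OF hh C0_homeos[OF m w(1)]] v(2) ..
    also have "\<dots> = conj_by (conj_by h w \<circ> v) (pl_gen m i)"
      using C0_homeos[OF m C0_conj[OF m hE w(1)]] C0_homeos[OF m v(1)] by (rule conj_by_comp)
    finally show ?thesis
      using C0_comp[OF m C0_conj[OF m hE w(1)] v(1)] by blast
  qed
  then show ?thesis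
    using exotics_comp[OF hE kE] unfolding locally_inner_exotics_def by blast
qed

lemma locally_inner_exotics_finv:
  assumes m: "m \<ge> 2" and h: "h \<in> locally_inner_exotics m"
  shows "finv h \<in> locally_inner_exotics m"
proof -
  have hE: "h \<in> exotics m"
    using h by (auto simp: locally_inner_exotics_def)
  note hh = exoticsD(1)[OF hE]
  have "\<exists>w\<in>C0 m. conj_by (finv h) (pl_gen m i) = conj_by w (pl_gen m i)" for i
  proof -
    obtain v where v: "v \<in> C0 m" "conj_by h (pl_gen m i) = conj_by v (pl_gen m i)"
      using h by (auto simp: locally_inner_exotics_def)
    define w where "w = conj_by (finv h) v"
    have w: "w \<in> C0 m"
      unfolding w_def by (rule C0_conj[OF m exotics_finv[OF hE] v(1)])
    have "pl_gen m i = conj_by (finv h) (conj_by v (pl_gen m i))"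
      using hh v(2) by (metis conj_by_inv_cancel(1))
    also have "\<dots> = conj_by w (conj_by (finv h) (pl_gen m i))"
      unfolding w_def by (rule conj_by_conj_by[OF homeos_inv[OF hh] C0_homeos[OF m v(1)]])
    finally have "conj_by (finv w) (pl_gen m i) = conj_by (finv h) (pl_gen m i)"
      using C0_homeos[OF m w] by (metis conj_by_inv_cancel(1))
    then show ?thesis
      using C0_finv[OF m w] by metis
  qed
  then show ?thesis
    using exotics_finv[OF hE] unfolding locally_inner_exotics_def by blast
qed

context gap_pair
begin

lemma hat_normalizes_B_R:
  assumes h: "h \<in> exotics m"
  shows "normalizes (hat h) (B_R n)"
proof (rule normalizesI)
  show "hat h \<in> homeos"
    by (rule hat(1)[OF h])
  show "conj_by (hat h) f \<in> B_R n" if "f \<in> B_R n" for f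
    by (rule conj_by_preserves_B_R[OF n2 hat(1)[OF h] hat_preserves_F_inf[OF h] that])
  show "conj_by (finv (hat h)) f \<in> B_R n" if "f \<in> B_R n" for f
    using conj_by_preserves_B_R[OF n2 hat(1) hat_preserves_F_inf that] exotics_finv[OF h] hat_finv[OF h] by metis
qed

lemma exotic_subgroup:
  assumes K: "K \<subseteq> exotics m" "id \<in> K" "\<And>h k. h \<in> K \<Longrightarrow> k \<in> K \<Longrightarrow> h \<circ> k \<in> K" "\<And>h. h \<in> K \<Longrightarrow> finv h \<in> K"
  shows "\<exists>H. subgroup H (Aut (B_R n)) \<and>
    (Aut (F_inf m))\<lparr>carrier := conj_aut (F_inf m) ` K\<rparr> \<cong> (Aut (B_R n))\<lparr>carrier := H\<rparr> \<and>
    H \<inter> Aut_in (A_R n) (B_R n) = {\<one>\<^bsub>Aut (B_R n)\<^esub>}"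
proof -
  define H where "H = (\<lambda>h. conj_aut (B_R n) (hat h)) ` K"
  have inj1: "inj_on (conj_aut (F_inf m)) K"
    using K(1) exoticsD(1) by (intro inj_onI conj_aut_inj[OF m2 subset_refl]) blast+
  have inj2: "inj_on (\<lambda>h. conj_aut (B_R n) (hat h)) K"
  proof (rule inj_onI)
    fix h k assume hk: "h \<in> K" "k \<in> K" and eq: "conj_aut (B_R n) (hat h) = conj_aut (B_R n) (hat k)"
    then have E: "h \<in> exotics m" "k \<in> exotics m"
      using K(1) by auto
    have "hat h = hat k"
      by (rule conj_aut_inj[OF n2 F_inf_subset_B_R[OF n2] hat(1)[OF E(1)] hat(1)[OF E(2)] eq])
    then show "h = k"
      by (rule hat_inj[OF E])
  qed
  have emb: "subgroup H (Aut (B_R n))"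
    "(Aut (F_inf m))\<lparr>carrier := conj_aut (F_inf m) ` K\<rparr> \<cong> (Aut (B_R n))\<lparr>carrier := H\<rparr>"
  proof -
    have hom: "K \<subseteq> homeos" "\<And>h. h \<in> K \<Longrightarrow> normalizes h (F_inf m)"
      "\<And>h. h \<in> K \<Longrightarrow> normalizes (hat h) (B_R n)"
      "\<And>h k. h \<in> K \<Longrightarrow> k \<in> K \<Longrightarrow> hat (h \<circ> k) = hat h \<circ> hat k"
      using K(1) exoticsD(1)[of _ m] exotics_normalizes_F_inf[of _ m] hat_normalizes_B_R hat_comp
      by (meson subsetD subsetI)+
    show "subgroup H (Aut (B_R n))"
      "(Aut (F_inf m))\<lparr>carrier := conj_aut (F_inf m) ` K\<rparr> \<cong> (Aut (B_R n))\<lparr>carrier := H\<rparr>"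
      unfolding H_def
      using conj_aut_embedding[OF F_inf_subgroup[OF m2] B_R_subgroup[OF n2] K(2,3,4) hom hat_id inj1 inj2]
      by auto
  qed
  have one: "\<one>\<^bsub>Aut (B_R n)\<^esub> = conj_aut (B_R n) (hat id)"
    by (simp add: one_Aut hat_id)
  have "\<alpha> = \<one>\<^bsub>Aut (B_R n)\<^esub>" if \<alpha>: "\<alpha> \<in> H" "\<alpha> \<in> Aut_in (A_R n) (B_R n)" for \<alpha>
  proof -
    obtain h where h: "h \<in> exotics m" "\<alpha> = conj_aut (B_R n) (hat h)"
      using \<alpha>(1) K(1) by (auto simp: H_def)
    obtain \<beta> k where k: "\<alpha> \<in> carrier (Aut (B_R n))" "\<beta> \<in> carrier (Aut (A_R n))"
      "implements k (A_R n) \<beta>" "implements k (B_R n) \<alpha>"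
      using \<alpha>(2) by (auto simp: Aut_in_def)
    have "conj_aut (B_R n) k = conj_aut (B_R n) (hat h)"
      using implements_conj_aut(1)[OF k(4,1)] h(2) by simp
    then have kh: "k = hat h"
      using k(4) hat(1)[OF h(1)] by (intro conj_aut_inj[OF n2 F_inf_subset_B_R[OF n2]]) (auto simp: implements_def)
    have "conj_by (hat h) (transl (of_int r)) \<in> A_R n" for r
      using implements_conj_aut(2)[OF k(3,2)] transl_A_R[OF n2, of r] unfolding kh normalizes_def by blast
    then have "hat h = id"
      by (rule hat_rigid[OF h(1)])
    then show ?thesis
      by (simp add: h(2) one_Aut)
  qed
  moreover have "\<one>\<^bsub>Aut (B_R n)\<^esub> \<in> H"
    using K(2) one by (auto simp: H_def)
  moreover have "\<one>\<^bsub>Aut (B_R n)\<^esub> \<in> Aut_in (A_R n) (B_R n)"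
  proof -
    have norm: "normalizes id G" for G
      by (simp add: normalizes_def homeos_id)
    have impl: "implements id G (conj_aut G id)" for G
      by (simp add: implements_def homeos_id conj_aut_def)
    have "conj_aut (A_R n) id \<in> carrier (Aut (A_R n))" "conj_aut (B_R n) id \<in> carrier (Aut (B_R n))"
      using conj_aut_Aut norm A_R_subgroup[OF n2] B_R_subgroup[OF n2] by auto
    then show ?thesis
      unfolding Aut_in_def one_Aut using impl by blast
  qed
  ultimately have "H \<inter> Aut_in (A_R n) (B_R n) = {\<one>\<^bsub>Aut (B_R n)\<^esub>}"
    by blast
  then show ?thesis
    using emb by blast
qed

end

theorem theorem6p3p2:
  fixes m n :: nat
  assumes "2 \<le> m"
  shows "(m < n - 1 \<longrightarrow>
           (\<exists>H. subgroup H (Aut (B_R n)) \<and> Aut0_group m \<cong> (Aut (B_R n))\<lparr>carrier := H\<rparr> \<and>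
                H \<inter> Aut_in (A_R n) (B_R n) = {\<one>\<^bsub>Aut (B_R n)\<^esub>})) \<and>
         (m = n - 1 \<longrightarrow>
           (\<exists>H. subgroup H (Aut (B_R n)) \<and> Aut0_LI_group m \<cong> (Aut (B_R n))\<lparr>carrier := H\<rparr> \<and>
                H \<inter> Aut_in (A_R n) (B_R n) = {\<one>\<^bsub>Aut (B_R n)\<^esub>}))"
proof (intro conjI impI)
  assume "m < n - 1"
  then interpret gap_pair m n
    using assms by unfold_locales auto
  show "\<exists>H. subgroup H (Aut (B_R n)) \<and> Aut0_group m \<cong> (Aut (B_R n))\<lparr>carrier := H\<rparr> \<and>
      H \<inter> Aut_in (A_R n) (B_R n) = {\<one>\<^bsub>Aut (B_R n)\<^esub>}"
    unfolding Aut0_eq[OF assms]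
    by (rule exotic_subgroup[OF subset_refl exotics_id exotics_comp exotics_finv])
next
  assume "m = n - 1"
  then interpret gap_pair m n
    using assms by unfold_locales auto
  have "locally_inner_exotics m \<subseteq> exotics m"
    by (auto simp: locally_inner_exotics_def)
  then show "\<exists>H. subgroup H (Aut (B_R n)) \<and> Aut0_LI_group m \<cong> (Aut (B_R n))\<lparr>carrier := H\<rparr> \<and>
      H \<inter> Aut_in (A_R n) (B_R n) = {\<one>\<^bsub>Aut (B_R n)\<^esub>}"
    unfolding Aut0_LI_eq[OF assms]
    using locally_inner_exotics_id[OF assms] locally_inner_exotics_comp[OF assms] locally_inner_exotics_finv[OF assms]
    by (rule exotic_subgroup)
qed

end
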